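(* If the Generalised Riemann Hypothesis holds for Dirichlet $L$-functions, then $$\liminf_{q\to\infty}\ \min_{\chi\ne\chi_0}x_{\chi,1}\le\frac14,$$ where $q$ runs through odd primes and the minimum of the first scaled zero of $L(s,\chi)$ is taken over all non-trivial characters $\chi$ modulo $q$.
   Context: Let $q$ be an odd prime and $\chi$ a non-trivial Dirichlet character modulo $q$ ($\chi_0$ denotes the trivial character). The non-trivial zeros of the Dirichlet $L$-function $L(s,\chi)$ are written (with multiplicity) $\tfrac12+i\gamma_{\chi,j}$, ordered so that $\cdots\le\operatorname{Re}\gamma_{\chi,-2}\le\operatorname{Re}\gamma_{\chi,-1}<0\le\operatorname{Re}\gamma_{\chi,1}\le\operatorname{Re}\gamma_{\chi,2}\le\cdots$. The scaled zeros are $x_{\chi,j}=\frac{\log q}{2\pi}\gamma_{\chi,j}$. The Generalised Riemann Hypothesis asserts that all $\gamma_{\chi,j}$ are real. *)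

theory Defs
  imports "HOL-Complex_Analysis.Complex_Analysis" "HOL-Computational_Algebra.Primes"
begin

definition dirichlet_character :: "nat \<Rightarrow> (nat \<Rightarrow> complex) \<Rightarrow> bool" where
  "dirichlet_character q \<psi> \<longleftrightarrow>
     \<psi> 1 = 1 \<and>
     (\<forall>m n. \<psi> (m * n) = \<psi> m * \<psi> n) \<and>
     (\<forall>n. \<psi> (n + q) = \<psi> n) \<and>
     (\<forall>n. \<psi> n = 0 \<longleftrightarrow> \<not> coprime n q)"

definition trivial_character :: "nat \<Rightarrow> nat \<Rightarrow> complex" where
  "trivial_character q n = (if coprime n q then 1 else 0)"

definition nontrivial_characters :: "nat \<Rightarrow> (nat \<Rightarrow> complex) set" where
  "nontrivial_characters q = {\<psi>. dirichlet_character q \<psi> \<and> \<psi> \<noteq> trivial_character q}"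

text \<open>
  The L-function of a non-trivial character is the entire continuation of its Dirichlet series,
  which is unique by the identity theorem. For a trivial character there is no entire
  continuation (pole at 1), so \<open>dirichlet_L\<close> is only meaningful for non-trivial ones.
\<close>

definition dirichlet_L :: "(nat \<Rightarrow> complex) \<Rightarrow> complex \<Rightarrow> complex" where
  "dirichlet_L \<psi> = (THE f. f holomorphic_on UNIV \<and>
     (\<forall>s. Re s > 1 \<longrightarrow> (\<lambda>n. \<psi> (Suc n) / of_nat (Suc n) powr s) sums f s))"

definition nontrivial_zeros :: "(nat \<Rightarrow> complex) \<Rightarrow> complex set" where
  "nontrivial_zeros \<psi> = {s. 0 < Re s \<and> Re s < 1 \<and> dirichlet_L \<psi> s = 0}"

text \<open>
  The (possibly non-real) numbers \<open>\<gamma>\<close> such that \<open>1/2 + \<i>\<gamma>\<close> is a non-trivial zero.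
\<close>

definition zero_ordinates :: "(nat \<Rightarrow> complex) \<Rightarrow> complex set" where
  "zero_ordinates \<psi> = {\<gamma>. 1/2 + \<i> * \<gamma> \<in> nontrivial_zeros \<psi>}"

definition ordinate_multiplicity :: "(nat \<Rightarrow> complex) \<Rightarrow> complex \<Rightarrow> nat" where
  "ordinate_multiplicity \<psi> \<gamma> = nat (zorder (dirichlet_L \<psi>) (1/2 + \<i> * \<gamma>))"

text \<open>
  \<open>first_ordinates \<psi> n\<close> lists \<open>\<gamma>\<^sub>1, \<dots>, \<gamma>\<^sub>n\<close>, the \<open>n\<close> first ordinates with non-negative real part,
  repeated according to multiplicity and ordered by real part: each entry is an ordinate of
  least real part among those whose multiplicity is not yet exhausted. Ties between distinct
  ordinates of equal real part are broken arbitrarily. This is the right half of the two-sided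
  list of zeros; indices start at 1, and \<open>ordinate \<psi> 0\<close> has no meaning.
\<close>

primrec first_ordinates :: "(nat \<Rightarrow> complex) \<Rightarrow> nat \<Rightarrow> complex list" where
  "first_ordinates \<psi> 0 = []"
| "first_ordinates \<psi> (Suc n) = first_ordinates \<psi> n @
     [arg_min Re (\<lambda>\<gamma>. \<gamma> \<in> zero_ordinates \<psi> \<and> 0 \<le> Re \<gamma> \<and>
        count_list (first_ordinates \<psi> n) \<gamma> < ordinate_multiplicity \<psi> \<gamma>)]"

definition ordinate :: "(nat \<Rightarrow> complex) \<Rightarrow> nat \<Rightarrow> complex" where
  "ordinate \<psi> j = last (first_ordinates \<psi> j)"

definition scaled_zero :: "nat \<Rightarrow> (nat \<Rightarrow> complex) \<Rightarrow> nat \<Rightarrow> complex" where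
  "scaled_zero q \<psi> j = of_real (ln (real q) / (2 * pi)) * ordinate \<psi> j"

definition odd_primes :: "nat set" where
  "odd_primes = {q. prime q \<and> odd q}"

text \<open>
  Only the L-functions of non-trivial characters modulo odd primes are involved.
\<close>

definition generalised_riemann_hypothesis :: bool where
  "generalised_riemann_hypothesis \<longleftrightarrow>
     (\<forall>q\<in>odd_primes. \<forall>\<psi>\<in>nontrivial_characters q. \<forall>\<gamma>\<in>zero_ordinates \<psi>. \<gamma> \<in> \<real>)"

end

theory Submission
  imports Defs "HOL-Number_Theory.Number_Theory" "HOL-Real_Asymp.Real_Asymp"
begin

text \<open>
  Suppose that, for some \<open>\<beta> > 1/4\<close> and a large prime \<open>q\<close>, no even non-quadratic character \<open>\<psi>\<close> modulo
  \<open>q\<close> has a zero \<open>1/2 + i t\<close> with \<open>\<bar>t\<bar> log q / 2 \<pi> \<le> \<beta>\<close>. Under GRH the real part of \<open>\<xi>'/\<xi>\<close> is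
  nonnegative just to the right of the critical line, and tends to \<open>0\<close> along the part of the line
  near \<open>1/2\<close> that is free of zeros. Integrate it against \<open>F(\<Lambda> t)\<close>, where
  \<open>F(w) = (1 + \<kappa> - w\<^sup>2) (cos (\<pi> w / 2) / (1 - w\<^sup>2))\<^sup>2\<close> and \<open>\<Lambda> = \<sigma> log q / \<pi>\<close> with \<open>1 < \<sigma> < 2\<close>: since \<open>F\<close>
  is nonpositive outside \<open>[- sqrt (1 + \<kappa>), sqrt (1 + \<kappa>)]\<close>, \<open>\<Lambda>\<close> times the integral is bounded above. On
  the other hand \<open>F\<close> has exponential type \<open>\<pi>\<close>, so that shifting the contour to the right leaves only
  the terms \<open>n \<le> q\<^sup>\<sigma>\<close> of the Dirichlet series of \<open>L'/L\<close>, while the factor \<open>(q / \<pi>)\<^sup>s\<^sup>/\<^sup>2\<close> of \<open>\<xi>\<close>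
  contributes \<open>log q\<close> times the positive integral of \<open>F\<close>. In the sum over the characters the
  coefficients are bounded except for \<open>n \<equiv> \<plusminus>1\<close> modulo \<open>q\<close>, where they are at most of order \<open>q\<close>. So
  the sum of the Dirichlet series terms is \<open>O(q\<^sup>\<sigma>\<^sup>/\<^sup>2 log q)\<close>, whereas the main term is of order
  \<open>q log q\<close>, a contradiction. A low zero below the real axis is reflected by passing to
  the conjugate character.
\<close>

section \<open>Dirichlet series with bounded coefficient sums\<close>

text \<open>The constant is the limit of \<open>sqrt (1 + \<kappa>) / (2 * \<sigma>)\<close> as
  \<kappa> tends to 0 and \<sigma> to 2. At \<sigma> = 2 the bound q^(\<sigma>/2) log q would reach
  the size of the main term. At \<kappa> = 0 the integral of F vanishes, and no other choice does
  better: by Poisson summation over the odd integers, an integrable function of exponential type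
  \<pi> that is nonpositive outside [-1, 1] has integral at most 0. Positivity of Re \<xi>'/\<xi>
  plays the part of the sum over zeros in the explicit formula; it comes from comparing |\<xi>| at
  two points by Phragmen-Lindelof. Even characters share the Gamma factor Gamma(s/2), and half of
  all characters is enough for the orders of magnitude. Quadratic ones are excluded because GRH
  concerns only the open strip, and nonvanishing on Re s = 1 is proved for characters with
  nontrivial square. The admissible distance \<delta> from the critical line depends on the
  character, the constants of the final estimate do not; finitely many characters therefore share
  one \<delta>, which stays positive throughout.\<close>

lemma summation_by_parts:
  fixes a b :: "nat \<Rightarrow> 'a :: comm_ring_1"
  shows "(\<Sum>k<n. a k * b k) = (\<Sum>k<n. a k) * b n + (\<Sum>k<n. (\<Sum>j\<le>k. a j) * (b k - b (Suc k)))"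
  by (induction n) (simp_all add: algebra_simps flip: lessThan_Suc_atMost)

text \<open>Abel's inequality: after summation by parts the differences of \<open>b\<close> are
  nonnegative and telescope.\<close>

lemma norm_sum_decreasing_le:
  fixes a :: "nat \<Rightarrow> complex" and b :: "nat \<Rightarrow> real"
  assumes B: "\<And>n. norm (\<Sum>k<n. a k) \<le> B"
    and dec: "\<And>n. b (Suc n) \<le> b n" and nn: "\<And>n. 0 \<le> b n"
  shows "norm (\<Sum>k<n. a k * of_real (b k)) \<le> B * b 0"
proof -
  have "norm (\<Sum>k<n. a k * of_real (b k)) \<le> norm ((\<Sum>k<n. a k) * of_real (b n))
      + norm (\<Sum>k<n. (\<Sum>j\<le>k. a j) * (of_real (b k) - of_real (b (Suc k))))"
    by (subst summation_by_parts) (rule norm_triangle_ineq)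
  also have "\<dots> \<le> B * b n + (\<Sum>k<n. B * (b k - b (Suc k)))"
  proof (rule add_mono)
    show "norm ((\<Sum>k<n. a k) * of_real (b n)) \<le> B * b n"
      using B[of n] nn[of n] by (simp add: norm_mult mult_right_mono)
    have "norm ((\<Sum>j\<le>k. a j) * (of_real (b k) - of_real (b (Suc k)))) \<le> B * (b k - b (Suc k))" for k
      using B[of "Suc k"] dec[of k]
      by (simp only: norm_mult lessThan_Suc_atMost norm_of_real flip: of_real_diff)
        (auto intro: mult_right_mono)
    then show "norm (\<Sum>k<n. (\<Sum>j\<le>k. a j) * (of_real (b k) - of_real (b (Suc k))))
        \<le> (\<Sum>k<n. B * (b k - b (Suc k)))"
      by (intro sum_norm_le) auto
  qed
  also have "\<dots> = B * b 0"
    by (subst sum_distrib_left[symmetric]) (simp add: sum_lessThan_telescope' algebra_simps)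
  finally show ?thesis .
qed

text \<open>Dirichlet's test. For the Cauchy criterion, Abel's inequality is applied to the sequence
  shifted by \<open>m\<close>; its partial sums are differences of two original ones, hence bounded
  by \<open>2 * B\<close>.\<close>

lemma bounded_sums_decreasing_tendsto:
  fixes a :: "nat \<Rightarrow> complex" and b :: "nat \<Rightarrow> real"
  assumes B: "\<And>n. norm (\<Sum>k<n. a k) \<le> B"
    and dec: "\<And>n. b (Suc n) \<le> b n" and lim: "b \<longlonglongrightarrow> 0"
  shows "summable (\<lambda>n. a n * of_real (b n))"
proof -
  have nn: "0 \<le> b n" for n
    using decseq_ge[OF decseq_SucI lim] dec by auto
  have "norm (\<Sum>k\<in>{m..<n}. a k * of_real (b k)) \<le> 2 * B * b m" for m n
  proof -
    have B': "norm (\<Sum>k<j. a (k + m)) \<le> 2 * B" for j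
    proof -
      have "(\<Sum>k<j. a (k + m)) = (\<Sum>k<j + m. a k) - (\<Sum>k<m. a k)"
        by (induction j) auto
      then show ?thesis
        using norm_triangle_ineq4[of "\<Sum>k<j + m. a k" "\<Sum>k<m. a k"] B[of "j + m"] B[of m] by simp
    qed
    have "norm (\<Sum>k<n - m. a (k + m) * of_real (b (k + m))) \<le> 2 * B * b (0 + m)"
      by (rule norm_sum_decreasing_le) (use B' dec nn in auto)
    moreover have "(\<Sum>k\<in>{m..<n}. a k * of_real (b k)) = (\<Sum>k<n - m. a (k + m) * of_real (b (k + m)))"
      by (rule sum.reindex_bij_witness[of _ "\<lambda>k. k + m" "\<lambda>k. k - m"]) auto
    ultimately show ?thesis
      by simp
  qed
  moreover have "0 \<le> B"
    using B[of 0] by simp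
  moreover have "\<exists>N. \<forall>m\<ge>N. 2 * B * b m < e" if "e > 0" for e
  proof -
    have "(\<lambda>m. 2 * B * b m) \<longlonglongrightarrow> 2 * B * 0"
      by (intro tendsto_intros lim)
    then show ?thesis
      using order_tendstoD(2)[of _ "2 * B * 0" sequentially e] that
      by (auto simp: eventually_sequentially)
  qed
  ultimately show ?thesis
    unfolding summable_Cauchy by (meson order.strict_trans1)
qed

lemma has_vector_derivative_of_real_powr:
  fixes s :: complex
  assumes "t > 0"
  shows "((\<lambda>t. of_real t powr s) has_vector_derivative s * of_real t powr (s - 1)) (at t)"
  using has_vector_derivative_real_field[OF has_field_derivative_powr[of "of_real t" s]] assms by simp

text \<open>The derivative of t^(-s) is dominated by that of a real multiple of t^(-Re s). The
  resulting bound telescopes over consecutive \<open>x\<close>, which gives the explicit estimate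
  \<open>B * norm s / Re s\<close> for the whole series.\<close>

lemma norm_powr_diff_le:
  assumes "Re s > 0" "x > 0"
  shows "norm (of_real x powr (-s) - of_real (x + 1) powr (-s))
      \<le> norm s / Re s * (x powr (- Re s) - (x + 1) powr (- Re s))"
proof -
  have *: "norm (complex_of_real (x + 1) powr (-s) - complex_of_real x powr (-s)) \<le>
     - (norm s / Re s * (x + 1) powr (- Re s)) - - (norm s / Re s * x powr (- Re s))"
  proof (rule differentiable_bound_general)
    show "x < x + 1" by simp
    show "continuous_on {x..x + 1} (\<lambda>t. complex_of_real t powr - s)"
      using assms by (intro continuous_intros) auto
    show "continuous_on {x..x + 1} (\<lambda>t. - (cmod s / Re s * t powr - Re s))"
      using assms by (intro continuous_intros) auto
    fix t assume t: "x < t" "t < x + 1"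
    show "((\<lambda>t. complex_of_real t powr - s) has_vector_derivative
        (- s) * of_real t powr (- s - 1)) (at t)"
      using assms t by (intro has_vector_derivative_of_real_powr) auto
    have "((\<lambda>t. - (cmod s / Re s * t powr - Re s)) has_real_derivative
         cmod s * t powr (- Re s - 1)) (at t)"
      using assms t by (auto intro!: derivative_eq_intros simp: powr_diff)
    then show "((\<lambda>t. - (cmod s / Re s * t powr - Re s)) has_vector_derivative
         cmod s * t powr (- Re s - 1)) (at t)"
      by (simp add: has_real_derivative_iff_has_vector_derivative)
    show "norm ((- s) * of_real t powr (- s - 1)) \<le> cmod s * t powr (- Re s - 1)"
      using assms t by (simp add: norm_mult norm_powr_real_powr)
  qed
  show ?thesis
    using * by (simp add: norm_minus_commute algebra_simps)
qed

text \<open>A cruder variant with a single power on the right. It varies monotonically with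
  \<open>norm s\<close> and \<open>Re s\<close>, as the locally uniform majorant in
  \<open>holomorphic_dseries\<close> requires.\<close>

lemma norm_powr_diff_le':
  assumes "Re s > 0" "x > 0"
  shows "norm (of_real x powr (-s) - of_real (x + 1) powr (-s)) \<le> norm s * x powr (- Re s - 1)"
proof -
  have *: "norm (complex_of_real (x + 1) powr (-s) - complex_of_real x powr (-s)) \<le>
     (norm s * x powr (- Re s - 1)) * (x + 1) - (norm s * x powr (- Re s - 1)) * x"
  proof (rule differentiable_bound_general)
    show "x < x + 1" by simp
    show "continuous_on {x..x + 1} (\<lambda>t. complex_of_real t powr - s)"
      using assms by (intro continuous_intros) auto
    show "continuous_on {x..x + 1} (\<lambda>t. (norm s * x powr (- Re s - 1)) * t)"
      using assms by (intro continuous_intros) auto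
    fix t assume t: "x < t" "t < x + 1"
    show "((\<lambda>t. complex_of_real t powr - s) has_vector_derivative
        (- s) * of_real t powr (- s - 1)) (at t)"
      using assms t by (intro has_vector_derivative_of_real_powr) auto
    have "((\<lambda>t. (norm s * x powr (- Re s - 1)) * t) has_real_derivative
         (norm s * x powr (- Re s - 1))) (at t)"
      using assms t by (auto intro!: derivative_eq_intros)
    then show "((\<lambda>t. (norm s * x powr (- Re s - 1)) * t) has_vector_derivative
         (norm s * x powr (- Re s - 1))) (at t)"
      by (simp add: has_real_derivative_iff_has_vector_derivative)
    have "t powr (- Re s - 1) \<le> x powr (- Re s - 1)"
      using assms t by (intro powr_mono2') auto
    then show "norm ((- s) * of_real t powr (- s - 1)) \<le> cmod s * x powr (- Re s - 1)"
      using assms t by (simp add: norm_mult norm_powr_real_powr mult_left_mono)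
  qed
  show ?thesis
    using * by (simp add: norm_minus_commute algebra_simps)
qed

text \<open>The coefficient at 0 is skipped. An ordered sum is used because inside the critical
  strip the series of a nontrivial character converges only conditionally.\<close>

definition dseries :: "(nat \<Rightarrow> complex) \<Rightarrow> complex \<Rightarrow> complex" where
  "dseries a s = (\<Sum>n. a (Suc n) / of_nat (Suc n) powr s)"

lemma telescope_powr_sums:
  assumes "r > 0"
  shows "(\<lambda>n. real (Suc n) powr (- r) - (real (Suc n) + 1) powr (- r)) sums 1"
proof -
  have "(\<lambda>n. real (Suc n) powr (- r)) \<longlonglongrightarrow> 0"
    using assms by (intro tendsto_neg_powr filterlim_compose[OF filterlim_real_sequentially filterlim_Suc]) auto
  then have "(\<lambda>n. real (Suc n) powr (- r) - real (Suc (Suc n)) powr (- r)) sums (real (Suc 0) powr (- r) - 0)"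
    by (rule telescope_sums')
  then show ?thesis
    by (simp add: add.commute add.left_commute)
qed

context
  fixes a :: "nat \<Rightarrow> complex" and B :: real
  assumes bounded_sums: "\<And>n. norm (\<Sum>k<n. a (Suc k)) \<le> B"
begin

text \<open>The terms after summation by parts. Their series converges absolutely and locally
  uniformly in Re s > 0, so that Weierstrass' theorem applies to it.\<close>

definition summand :: "nat \<Rightarrow> complex \<Rightarrow> complex" where
  "summand n s = (\<Sum>k\<le>n. a (Suc k)) * (of_real (Suc n) powr (-s) - of_real (Suc n + 1) powr (-s))"

lemma norm_coeff_sum: "norm (\<Sum>k\<le>n. a (Suc k)) \<le> B"
  using bounded_sums[of "Suc n"] by (simp only: lessThan_Suc_atMost)

lemma B_nonneg: "0 \<le> B"
  using bounded_sums[of 0] by simp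

lemma norm_summand_le:
  assumes "Re s > 0"
  shows "norm (summand n s) \<le>
    B * norm s / Re s * (real (Suc n) powr (- Re s) - (real (Suc n) + 1) powr (- Re s))"
proof -
  have "norm (summand n s) \<le> B * (norm s / Re s * (real (Suc n) powr (- Re s) - (real (Suc n) + 1) powr (- Re s)))"
    unfolding summand_def norm_mult using B_nonneg norm_coeff_sum assms
    using norm_powr_diff_le[OF assms, of "real (Suc n)"]
    by (intro mult_mono) (auto simp: add.commute)
  then show ?thesis
    by simp
qed

lemma norm_summand_le':
  assumes "Re s > 0"
  shows "norm (summand n s) \<le> B * (norm s * real (Suc n) powr (- Re s - 1))"
  unfolding summand_def norm_mult using B_nonneg norm_coeff_sum assms
  using norm_powr_diff_le'[OF assms, of "real (Suc n)"]
  by (intro mult_mono) (auto simp: add.commute)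

lemma dseries_sums_summand:
  assumes "Re s > 0"
  shows "summable (\<lambda>n. summand n s)"
    and "(\<lambda>n. a (Suc n) / of_nat (Suc n) powr s) sums (\<Sum>n. summand n s)"
    and "norm (\<Sum>n. summand n s) \<le> B * norm s / Re s"
proof -
  let ?t = "\<lambda>n. B * norm s / Re s * (real (Suc n) powr (- Re s) - (real (Suc n) + 1) powr (- Re s))"
  have t: "?t sums (B * norm s / Re s * 1)"
    using assms by (intro sums_mult telescope_powr_sums)
  show sm: "summable (\<lambda>n. summand n s)"
    by (rule summable_comparison_test'[OF sums_summable[OF t]]) (use assms norm_summand_le in auto)
  have "norm (\<Sum>n. summand n s) \<le> (\<Sum>n. ?t n)"
    using norm_suminf_le[OF norm_summand_le[OF assms] sums_summable[OF t]] by simp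
  then show "norm (\<Sum>n. summand n s) \<le> B * norm s / Re s"
    using sums_unique[OF t] by simp
  \<comment> \<open>The boundary term of the summation by parts vanishes in the limit, so the
    original and the transformed series have the same sum.\<close>
  have "(\<lambda>n. (\<Sum>k<n. a (Suc k)) * of_real (Suc n) powr (-s)) \<longlonglongrightarrow> 0"
  proof (rule Lim_null_comparison)
    have "norm ((\<Sum>k<n. a (Suc k)) * of_real (Suc n) powr (-s)) \<le> B * real (Suc n) powr (- Re s)" for n
    proof -
      have "norm (complex_of_real (Suc n) powr (-s)) = real (Suc n) powr (- Re s)"
        by (subst norm_powr_real_powr) auto
      then show ?thesis
        unfolding norm_mult using bounded_sums[of n] by (intro mult_mono) (auto simp: B_nonneg)
    qed
    then show "\<forall>\<^sub>F n in sequentially. norm ((\<Sum>k<n. a (Suc k)) * of_real (Suc n) powr (-s)) \<le> B * real (Suc n) powr (- Re s)"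
      by auto
    have "(\<lambda>n. B * real (Suc n) powr (- Re s)) \<longlonglongrightarrow> B * 0"
      using assms by (intro tendsto_intros tendsto_neg_powr filterlim_compose[OF filterlim_real_sequentially filterlim_Suc]) auto
    then show "(\<lambda>n. B * real (Suc n) powr (- Re s)) \<longlonglongrightarrow> 0"
      by simp
  qed
  from tendsto_add[OF this summable_LIMSEQ[OF sm]]
  have "(\<lambda>n. (\<Sum>k<n. a (Suc k)) * of_real (Suc n) powr (-s) + (\<Sum>k<n. summand k s)) \<longlonglongrightarrow> (\<Sum>n. summand n s)"
    by simp
  moreover have "(\<Sum>k<n. a (Suc k)) * of_real (Suc n) powr (-s) + (\<Sum>k<n. summand k s)
     = (\<Sum>k<n. a (Suc k) / of_nat (Suc k) powr s)" for n
    using summation_by_parts[of "\<lambda>k. a (Suc k)" "\<lambda>k. of_real (Suc k) powr (-s)" n]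
    by (simp add: powr_minus_divide summand_def)
  ultimately show "(\<lambda>n. a (Suc n) / of_nat (Suc n) powr s) sums (\<Sum>n. summand n s)"
    by (simp add: sums_def)
qed

lemma dseries_sums: "Re s > 0 \<Longrightarrow> (\<lambda>n. a (Suc n) / of_nat (Suc n) powr s) sums dseries a s"
  unfolding dseries_def using dseries_sums_summand(2) sums_summable by blast

lemma norm_dseries_le: "Re s > 0 \<Longrightarrow> norm (dseries a s) \<le> B * norm s / Re s"
  unfolding dseries_def using dseries_sums_summand(2,3) by (metis sums_unique)

lemma holomorphic_dseries: "dseries a holomorphic_on {s. Re s > 0}"
proof -
  have op: "open {s. Re s > 0}"
    by (simp add: open_halfspace_Re_gt)
  obtain g where g: "\<forall>s\<in>{s. Re s > 0}. (\<lambda>n. summand n s) sums g s \<and> g field_differentiable (at s)"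
  proof (rule series_differentiable_comparison_complex[OF op, of summand])
    fix n s assume "s \<in> {s. Re s > 0}"
    have "summand n holomorphic_on UNIV"
      unfolding summand_def[abs_def] by (intro holomorphic_intros)
    then show "summand n field_differentiable at s"
      using holomorphic_on_imp_differentiable_at by blast
  next
    fix s :: complex assume s: "s \<in> {s. Re s > 0}"
    \<comment> \<open>On the ball of this radius the real part stays above \<open>d\<close>, so one
      power of \<open>Suc n\<close> majorises all summands there.\<close>
    define d where "d = Re s / 2"
    define h where "h = (\<lambda>n. complex_of_real (B * ((norm s + d) * real (Suc n) powr (- d - 1))))"
    have d: "d > 0" using s by (simp add: d_def)
    have "summable (\<lambda>n. real n powr (- d - 1))"
      using d by (simp add: summable_real_powr_iff)
    then have "summable (\<lambda>n. B * ((norm s + d) * real (Suc n) powr (- d - 1)))"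
      by (intro summable_mult) (subst summable_Suc_iff)
    then have "summable h"
      unfolding h_def by (rule summable_of_real)
    moreover have "range h \<subseteq> \<real>\<^sub>\<ge>\<^sub>0"
      using d B_nonneg by (auto simp: h_def)
    moreover have "norm (summand n y) \<le> norm (h n)" if y: "y \<in> ball s d" for n y
    proof -
      have "Re s - Re y \<le> norm (s - y)"
        using complex_Re_le_cmod[of "s - y"] by simp
      also have "\<dots> < d" using y by (simp add: dist_norm)
      finally have Re_y: "Re y > d" by (simp add: d_def)
      have "norm y \<le> norm s + d"
        using y norm_triangle_ineq2[of y s] by (simp add: dist_norm norm_minus_commute)
      then have "norm y * real (Suc n) powr (- Re y - 1) \<le> (norm s + d) * real (Suc n) powr (- d - 1)"
        using Re_y d by (intro mult_mono powr_mono) auto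
      then have "norm (summand n y) \<le> B * ((norm s + d) * real (Suc n) powr (- d - 1))"
        using norm_summand_le'[of y n] Re_y d B_nonneg
        by (meson less_trans mult_left_mono order_trans)
      then show ?thesis
        using d B_nonneg unfolding h_def norm_of_real by (smt (verit))
    qed
    ultimately show "\<exists>d h. 0 < d \<and> summable h \<and> range h \<subseteq> \<real>\<^sub>\<ge>\<^sub>0 \<and>
       (\<forall>\<^sub>F n in sequentially. \<forall>y\<in>ball s d \<inter> {s. 0 < Re s}. cmod (summand n y) \<le> cmod (h n))"
      using d by (intro exI[of _ d] exI[of _ h]) auto
  qed blast
  have "g s = dseries a s" if "Re s > 0" for s
    using g that dseries_sums_summand(2)[OF that] unfolding dseries_def
    by (metis mem_Collect_eq sums_unique)
  moreover have "g holomorphic_on {s. Re s > 0}"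
    using g op by (auto simp: holomorphic_on_def intro: field_differentiable_at_within)
  ultimately show ?thesis
    by (auto intro: holomorphic_transform)
qed

end

section \<open>Dirichlet characters\<close>

lemma dirichlet_character_mult: "dirichlet_character q \<psi> \<Longrightarrow> \<psi> (m * n) = \<psi> m * \<psi> n"
  and dirichlet_character_1: "dirichlet_character q \<psi> \<Longrightarrow> \<psi> (Suc 0) = 1"
  and dirichlet_character_eq_0_iff: "dirichlet_character q \<psi> \<Longrightarrow> \<psi> n = 0 \<longleftrightarrow> \<not> coprime n q"
  by (auto simp: dirichlet_character_def)

lemma dirichlet_character_power: "dirichlet_character q \<psi> \<Longrightarrow> \<psi> (n ^ k) = \<psi> n ^ k"
  by (induction k) (simp_all add: dirichlet_character_mult dirichlet_character_1)

lemma dirichlet_character_add_mult: "dirichlet_character q \<psi> \<Longrightarrow> \<psi> (n + k * q) = \<psi> n"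
proof (induction k)
  case (Suc k)
  have "\<psi> (n + Suc k * q) = \<psi> ((n + k * q) + q)"
    by (simp add: algebra_simps)
  also have "\<dots> = \<psi> (n + k * q)"
    using Suc.prems by (simp only: dirichlet_character_def)
  finally show ?case
    using Suc by simp
qed simp

lemma dirichlet_character_mod:
  assumes "dirichlet_character q \<psi>"
  shows "\<psi> (n mod q) = \<psi> n"
  using dirichlet_character_add_mult[OF assms, of "n mod q" "n div q"] by (simp only: mod_div_mult_eq)

lemma dirichlet_character_cong:
  assumes "dirichlet_character q \<psi>" "m mod q = n mod q"
  shows "\<psi> m = \<psi> n"
  using dirichlet_character_mod[OF assms(1), of m] dirichlet_character_mod[OF assms(1), of n] assms(2)
  by simp

lemma dirichlet_character_root_of_unity:
  assumes "dirichlet_character q \<psi>" "coprime n q"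
  shows "\<psi> n ^ totient q = 1"
proof -
  have "[n ^ totient q = 1] (mod q)"
    using assms by (intro euler_theorem) (auto simp: coprime_commute)
  then have "\<psi> (n ^ totient q) = \<psi> 1"
    by (intro dirichlet_character_cong[OF assms(1)]) (simp add: cong_def)
  then show ?thesis
    using assms by (simp add: dirichlet_character_power dirichlet_character_1)
qed

lemma norm_dirichlet_character:
  assumes "dirichlet_character q \<psi>" "q > 0"
  shows "norm (\<psi> n) = (if coprime n q then 1 else 0)"
proof (cases "coprime n q")
  case True
  have "norm (\<psi> n) ^ totient q = 1"
    using dirichlet_character_root_of_unity[OF assms(1) True] by (metis norm_one norm_power)
  then have "norm (\<psi> n) = 1"
    using assms(2) power_eq_1_iff[of "norm (\<psi> n)" "totient q"] by simp
  with True show ?thesis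
    by simp
qed (use dirichlet_character_eq_0_iff[OF assms(1)] in auto)

lemma norm_dirichlet_character_le: "dirichlet_character q \<psi> \<Longrightarrow> q > 0 \<Longrightarrow> norm (\<psi> n) \<le> 1"
  by (simp add: norm_dirichlet_character)

text \<open>A character is determined by its values on one period, and each of these is 0 or a root
  of unity of order dividing \<open>totient q\<close>. Finiteness makes the \<open>Min\<close> in
  the theorem a genuine minimum.\<close>

lemma finite_dirichlet_characters:
  assumes "q > 0"
  shows "finite {\<psi>. dirichlet_character q \<psi>}"
proof -
  define V where "V = insert 0 {z::complex. z ^ totient q = 1}"
  have "finite V"
    using finite_roots_unity[of "totient q"] assms by (simp add: V_def totient_gt_0_iff Suc_leI)
  define E where "E = (\<lambda>\<psi>::nat \<Rightarrow> complex. restrict \<psi> {..<q})"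
  have "E ` {\<psi>. dirichlet_character q \<psi>} \<subseteq> {..<q} \<rightarrow>\<^sub>E V"
  proof
    fix f assume "f \<in> E ` {\<psi>. dirichlet_character q \<psi>}"
    then obtain \<psi> where \<psi>: "dirichlet_character q \<psi>" "f = restrict \<psi> {..<q}"
      by (auto simp: E_def)
    have "\<psi> n \<in> V" for n
      unfolding V_def using dirichlet_character_root_of_unity[OF \<psi>(1), of n]
        dirichlet_character_eq_0_iff[OF \<psi>(1), of n] by blast
    then show "f \<in> {..<q} \<rightarrow>\<^sub>E V"
      unfolding \<psi>(2) by (intro restrict_PiE_iff[THEN iffD2]) blast
  qed
  then have "finite (E ` {\<psi>. dirichlet_character q \<psi>})"
    using \<open>finite V\<close> finite_PiE finite_subset by (metis finite_lessThan)
  moreover have "inj_on E {\<psi>. dirichlet_character q \<psi>}"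
  proof (rule inj_onI)
    fix \<psi> \<phi> assume *: "\<psi> \<in> {\<psi>. dirichlet_character q \<psi>}" "\<phi> \<in> {\<psi>. dirichlet_character q \<psi>}" "E \<psi> = E \<phi>"
    have "\<psi> n = \<phi> n" for n
    proof -
      have "E \<psi> (n mod q) = E \<phi> (n mod q)" using * by simp
      then have "\<psi> (n mod q) = \<phi> (n mod q)"
        using assms by (simp add: E_def)
      then show ?thesis
        using * by (simp add: dirichlet_character_mod)
    qed
    then show "\<psi> = \<phi>" by blast
  qed
  ultimately show ?thesis
    using finite_imageD by blast
qed

lemma finite_nontrivial_characters: "q > 0 \<Longrightarrow> finite (nontrivial_characters q)"
  unfolding nontrivial_characters_def
  by (rule finite_subset[OF _ finite_dirichlet_characters]) auto

lemma dirichlet_character_cnj: "dirichlet_character q \<psi> \<Longrightarrow> dirichlet_character q (\<lambda>n. cnj (\<psi> n))"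
  unfolding dirichlet_character_def
  by (elim conjE, intro conjI) (simp_all only: complex_cnj_mult complex_cnj_one complex_cnj_zero_iff, simp_all)

lemma nontrivial_character_cnj:
  "\<psi> \<in> nontrivial_characters q \<Longrightarrow> (\<lambda>n. cnj (\<psi> n)) \<in> nontrivial_characters q"
proof -
  assume *: "\<psi> \<in> nontrivial_characters q"
  have "\<psi> = trivial_character q" if "(\<lambda>n. cnj (\<psi> n)) = trivial_character q"
  proof
    fix n
    have "cnj (\<psi> n) = trivial_character q n"
      by (rule fun_cong[OF that])
    then have "cnj (cnj (\<psi> n)) = cnj (trivial_character q n)"
      by simp
    then show "\<psi> n = trivial_character q n"
      by (simp add: trivial_character_def split: if_splits)
  qed
  then show ?thesis
    using * by (auto simp: nontrivial_characters_def dirichlet_character_cnj)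
qed

lemma dirichlet_character_square: "dirichlet_character q \<psi> \<Longrightarrow> dirichlet_character q (\<lambda>n. \<psi> n ^ 2)"
  unfolding dirichlet_character_def
  by (elim conjE, intro conjI) (simp_all only: power_mult_distrib power_one zero_eq_power2 power_eq_0_iff pos2, simp_all)

lemma bij_betw_mult_mod:
  fixes n q :: nat
  assumes "coprime n q" "q > 0"
  shows "bij_betw (\<lambda>a. a * n mod q) {..<q} {..<q}"
proof -
  have "inj_on (\<lambda>a. a * n mod q) {..<q}"
  proof (rule inj_onI)
    fix a b assume *: "a \<in> {..<q}" "b \<in> {..<q}" "a * n mod q = b * n mod q"
    then have "[a = b] (mod q)"
      using cong_mult_rcancel_nat[OF assms(1), of a b] *(3) unfolding cong_def by blast
    then show "a = b"
      using * by (simp add: cong_def)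
  qed
  moreover have "(\<lambda>a. a * n mod q) ` {..<q} \<subseteq> {..<q}"
    using assms by auto
  ultimately show ?thesis
    by (simp add: bij_betw_def endo_inj_surj)
qed

lemma sum_dirichlet_character:
  assumes "\<psi> \<in> nontrivial_characters q" "q > 0"
  shows "(\<Sum>a<q. \<psi> a) = 0"
proof -
  have \<psi>: "dirichlet_character q \<psi>" "\<psi> \<noteq> trivial_character q"
    using assms by (auto simp: nontrivial_characters_def)
  then obtain n where n: "coprime n q" "\<psi> n \<noteq> 1"
    by (metis dirichlet_character_eq_0_iff trivial_character_def ext)
  have "(\<Sum>a<q. \<psi> a) = (\<Sum>a<q. \<psi> (a * n mod q))"
    by (rule sum.reindex_bij_betw[OF bij_betw_mult_mod[OF n(1) assms(2)], symmetric])
  also have "\<dots> = (\<Sum>a<q. \<psi> a) * \<psi> n"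
    using \<psi> by (simp add: dirichlet_character_mod dirichlet_character_mult sum_distrib_right)
  finally show ?thesis
    using n by simp
qed

lemma sum_dirichlet_character_Suc:
  assumes "\<psi> \<in> nontrivial_characters q" "q > 0"
  shows "(\<Sum>k<q. \<psi> (Suc k)) = 0"
proof -
  have \<psi>: "dirichlet_character q \<psi>" using assms by (auto simp: nontrivial_characters_def)
  have "\<psi> 0 + (\<Sum>k<q. \<psi> (Suc k)) = (\<Sum>a<q. \<psi> a) + \<psi> q"
    by (simp only: sum.lessThan_Suc_shift[of \<psi> q, symmetric] sum.lessThan_Suc)
  moreover have "\<psi> q = \<psi> 0"
    by (rule dirichlet_character_cong[OF \<psi>]) simp
  ultimately show ?thesis
    using sum_dirichlet_character[OF assms] by simp
qed

text \<open>Full periods cancel, leaving fewer than \<open>q\<close> terms of modulus at most 1. A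
  crude bound is enough: it enters only convergence and growth statements for a fixed character, not
  the final estimate.\<close>

lemma norm_sum_dirichlet_character_le:
  assumes "\<psi> \<in> nontrivial_characters q" "q > 0"
  shows "norm (\<Sum>k<n. \<psi> (Suc k)) \<le> real q"
proof (induction n rule: less_induct)
  case (less n)
  have \<psi>: "dirichlet_character q \<psi>" using assms by (auto simp: nontrivial_characters_def)
  show ?case
  proof (cases "n < q")
    case True
    have "norm (\<Sum>k<n. \<psi> (Suc k)) \<le> (\<Sum>k<n. 1)"
      by (intro sum_norm_le norm_dirichlet_character_le[OF \<psi> assms(2)])
    then show ?thesis
      using True by simp
  next
    case False
    have "(\<Sum>k<m + q. \<psi> (Suc k)) = (\<Sum>k<m. \<psi> (Suc k))" for m
    proof (induction m)
      case 0
      then show ?case using sum_dirichlet_character_Suc[OF assms] by simp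
    next
      case (Suc m)
      then show ?case
        using dirichlet_character_add_mult[OF \<psi>, of "Suc m" 1] by simp
    qed
    from this[of "n - q"] show ?thesis
      using less[of "n - q"] False assms by simp
  qed
qed

section \<open>Gauss sums to prime modulus and an explicit family of even characters\<close>

definition gauss_sum :: "nat \<Rightarrow> (nat \<Rightarrow> complex) \<Rightarrow> complex" where
  "gauss_sum q \<psi> = (\<Sum>b<q. \<psi> b * cis (2 * pi * real b / real q))"

lemma cis_mod_eq:
  fixes m n q :: nat
  assumes "q > 0" "m mod q = n mod q"
  shows "cis (2 * pi * real m / real q) = cis (2 * pi * real n / real q)"
proof -
  have *: "cis (2 * pi * real k / real q) = cis (2 * pi * real (k mod q) / real q)" for k
  proof -
    have "real k = real (k mod q) + real q * real (k div q)"
      by (metis mod_mult_div_eq of_nat_add of_nat_mult)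
    then have "2 * pi * real k / real q = 2 * pi * real (k mod q) / real q + 2 * pi * real (k div q)"
      using assms by (simp add: field_simps)
    moreover have "cis (2 * pi * real (k div q)) = 1"
      by (intro cis_multiple_2pi) auto
    ultimately show ?thesis
      by (simp flip: cis_mult)
  qed
  show ?thesis
    using *[of m] *[of n] assms by simp
qed

text \<open>If \<open>n\<close> is coprime to \<open>q\<close>, multiplication by \<open>n\<close>
  permutes the residues. Otherwise \<open>q\<close> divides \<open>n\<close>, by primality, and both
  sides vanish because a nontrivial character sums to 0.\<close>

lemma gauss_sum_separable:
  assumes "\<psi> \<in> nontrivial_characters q" "prime q"
  shows "(\<Sum>b<q. cnj (\<psi> b) * cis (2 * pi * real (n * b) / real q)) = \<psi> n * gauss_sum q (\<lambda>b. cnj (\<psi> b))"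
proof -
  have \<psi>: "dirichlet_character q \<psi>" using assms by (auto simp: nontrivial_characters_def)
  have q: "q > 0" using assms prime_gt_0_nat by auto
  show ?thesis
  proof (cases "coprime n q")
    case True
    have unit: "\<psi> n * cnj (\<psi> n) = 1"
      using norm_dirichlet_character[OF \<psi> q, of n] True by (simp add: complex_norm_square[symmetric])
    have "gauss_sum q (\<lambda>b. cnj (\<psi> b)) =
        (\<Sum>b<q. cnj (\<psi> (b * n mod q)) * cis (2 * pi * real (b * n mod q) / real q))"
      unfolding gauss_sum_def
      by (rule sum.reindex_bij_betw[OF bij_betw_mult_mod[OF True q], symmetric])
    also have "\<dots> = (\<Sum>b<q. cnj (\<psi> n) * (cnj (\<psi> b) * cis (2 * pi * real (n * b) / real q)))"
    proof (rule sum.cong)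
      fix b
      have "cis (2 * pi * real (b * n mod q) / real q) = cis (2 * pi * real (n * b) / real q)"
        using q by (intro cis_mod_eq) (auto simp: mult.commute)
      then show "cnj (\<psi> (b * n mod q)) * cis (2 * pi * real (b * n mod q) / real q) =
         cnj (\<psi> n) * (cnj (\<psi> b) * cis (2 * pi * real (n * b) / real q))"
        using \<psi> by (simp add: dirichlet_character_mod dirichlet_character_mult mult_ac)
    qed auto
    finally have "\<psi> n * gauss_sum q (\<lambda>b. cnj (\<psi> b)) =
        (\<psi> n * cnj (\<psi> n)) * (\<Sum>b<q. cnj (\<psi> b) * cis (2 * pi * real (n * b) / real q))"
      by (simp add: sum_distrib_left mult_ac)
    then show ?thesis
      using unit by simp
  next
    case False
    then have "q dvd n"
      using assms(2) by (meson coprime_commute prime_imp_coprime)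
    then have "cis (2 * pi * real (n * b) / real q) = 1" for b
      using cis_mod_eq[OF q, of "n * b" 0] by simp
    moreover have "(\<Sum>b<q. cnj (\<psi> b)) = 0"
      using sum_dirichlet_character[OF nontrivial_character_cnj[OF assms(1)] q] .
    ultimately show ?thesis
      using False dirichlet_character_eq_0_iff[OF \<psi>, of n] by simp
  qed
qed

lemma prime_dvd_square_minus_one:
  fixes n q :: nat
  assumes "prime q" "[n ^ 2 = 1] (mod q)"
  shows "[n = 1] (mod q) \<or> [n = q - 1] (mod q)"
proof -
  have "int q dvd int n ^ 2 - 1"
    using assms(2) by (simp add: cong_iff_dvd_diff flip: cong_int_iff)
  also have "int n ^ 2 - 1 = (int n - 1) * (int n + 1)"
    by (simp add: algebra_simps power2_eq_square)
  finally consider "int q dvd int n - 1" | "int q dvd int n + 1"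
    using assms(1) prime_dvd_mult_iff[of "int q"] by auto
  then show ?thesis
  proof cases
    case 1
    then have "[int n = int 1] (mod int q)"
      by (simp add: cong_iff_dvd_diff)
    then show ?thesis
      by (simp only: cong_int_iff) simp
  next
    case 2
    have eq: "int n - int (q - 1) = (int n + 1) - int q"
      using prime_gt_0_nat[OF assms(1)] by (simp add: of_nat_diff)
    have "int q dvd (int n + 1) - int q"
      using 2 by (intro dvd_diff) auto
    then have "[int n = int (q - 1)] (mod int q)"
      by (simp only: cong_iff_dvd_diff eq)
    then show ?thesis
      by (simp only: cong_int_iff) simp
  qed
qed

lemma cis_2pi_frac_eq_1_iff:
  assumes "h > 0"
  shows "cis (2 * pi * real k / real h) = 1 \<longleftrightarrow> h dvd k"
  using complex_root_unity_eq_1[of h k] assms by (simp add: cis_conv_exp mult_ac)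

text \<open>With a primitive root \<open>g\<close> and discrete logarithm \<open>ind\<close>, put X
  j n = e(j ind(n) / h), where h = (q - 1) / 2. The denominator \<open>h\<close> instead of
  \<open>q - 1\<close> makes the characters even: since (-1)^2 = 1, \<open>h\<close> divides the
  index of -1. Over all j < h the values at \<open>n\<close> form a geometric sum, which vanishes
  unless \<open>h\<close> divides ind(n), that is, unless n is 1 or -1 modulo \<open>q\<close>. The
  characters whose square is trivial belong to \<open>j = 0\<close> and possibly
  \<open>j = h div 2\<close>; deleting them accounts for the summand 2 in the last bound.\<close>

lemma even_character_family:
  assumes "prime q" "odd q"
  obtains X :: "nat \<Rightarrow> nat \<Rightarrow> complex" and J :: "nat set" where
    "finite J" "real (card J) \<ge> (real q - 5) / 2"
    "\<And>j. j \<in> J \<Longrightarrow> dirichlet_character q (X j)"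
    "\<And>j. j \<in> J \<Longrightarrow> X j (q - 1) = 1"
    "\<And>j. j \<in> J \<Longrightarrow> (\<lambda>n. X j n ^ 2) \<noteq> trivial_character q"
    "\<And>n. norm (\<Sum>j\<in>J. X j n) \<le> (if [n = 1] (mod q) \<or> [n = q - 1] (mod q) then real q else 0) + 2"
proof -
  define h where "h = (q - 1) div 2"
  have q: "q \<ge> 3"
    using assms prime_ge_2_nat[of q] by (cases "q = 2") auto
  have q_eq: "q - 1 = 2 * h"
    using assms q by (simp add: h_def)
  have h: "h > 0" using q_eq q by auto
  obtain g where g: "residue_primroot q g"
    using prime_primitive_root_exists[of q] assms(1) q by auto
  have cop_g: "coprime q g" and ord_g: "ord q g = q - 1"
    using g assms(1) by (auto simp: residue_primroot_def totient_prime)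
  have bij: "bij_betw (\<lambda>i. g ^ i mod q) {..<q - 1} (totatives q)"
    using residue_primroot_is_generator[of q g] g q assms(1) by (simp add: totient_prime)
  define ind where "ind = (\<lambda>n. inv_into {..<q - 1} (\<lambda>i. g ^ i mod q) (n mod q))"
  have ind: "[g ^ ind n = n] (mod q)" if "coprime n q" for n
  proof -
    have "\<not> q dvd n"
      using that q coprime_common_divisor[of n q q] by auto
    then have "n mod q \<noteq> 0"
      by (simp add: dvd_eq_mod_eq_0)
    then have "n mod q \<in> totatives q"
      using assms(1) q by (simp add: totatives_prime)
    then have "g ^ ind n mod q = n mod q"
      unfolding ind_def using bij by (metis (no_types, lifting) bij_betw_def f_inv_into_f)
    then show ?thesis
      by (simp add: cong_def)
  qed
  have expo: "[d = e] (mod 2 * h)" if "[g ^ d = g ^ e] (mod q)" for d e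
    using that order_divides_expdiff[OF cop_g] ord_g q_eq by simp
  define X where "X = (\<lambda>j n. if coprime n q then cis (2 * pi * real (j * ind n) / real h) else 0)"
  have cis_cong: "cis (2 * pi * real a / real h) = cis (2 * pi * real b / real h)"
    if "[a = b] (mod h)" for a b
    using that h by (intro cis_mod_eq) (auto simp: cong_def)
  have X_eq: "X j n = cis (2 * pi * real (j * d) / real h)" if "[g ^ d = n] (mod q)" "coprime n q" for j n d
  proof -
    have "[ind n = d] (mod 2 * h)"
      using ind[OF that(2)] that(1) by (intro expo) (metis cong_sym cong_trans)
    then have "[j * ind n = j * d] (mod h)"
      by (intro cong_mult cong_refl) (metis cong_modulus_mult_nat mult.commute)
    then show ?thesis
      using that(2) by (simp only: X_def if_True cis_cong)
  qed
  have char: "dirichlet_character q (X j)" for j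
    unfolding dirichlet_character_def
  proof (intro conjI allI)
    show "X j 1 = 1"
      using X_eq[of 0 1 j] by simp
    fix m n
    show "X j (m * n) = X j m * X j n"
    proof (cases "coprime m q \<and> coprime n q")
      case True
      then have "[g ^ (ind m + ind n) = m * n] (mod q)"
        unfolding power_add by (intro cong_mult ind) auto
      then have "X j (m * n) = cis (2 * pi * real (j * (ind m + ind n)) / real h)"
        using True by (intro X_eq) auto
      also have "\<dots> = X j m * X j n"
        using True by (simp add: X_def cis_mult add_divide_distrib ring_distribs)
      finally show ?thesis .
    qed (auto simp: X_def)
    show "X j (n + q) = X j n"
    proof -
      have "coprime (n + q) q = coprime n q"
        unfolding coprime_iff_gcd_eq_1 by simp
      then show ?thesis
        by (simp add: X_def ind_def)
    qed
    show "(X j n = 0) = (\<not> coprime n q)"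
      by (simp add: X_def)
  qed
  define J where "J = {j. j < h \<and> \<not> h dvd 2 * j}"
  have J: "J \<subseteq> {..<h}" and fin: "finite J" by (auto simp: J_def)
  have compl: "card ({..<h} - J) \<le> 2"
  proof -
    have "{..<h} - J \<subseteq> {0, h div 2}"
    proof
      fix j assume "j \<in> {..<h} - J"
      then obtain c where c: "2 * j = h * c" "j < h" by (auto simp: J_def)
      then have "h * c < h * 2" by linarith
      then have "c < 2" by simp
      then have "c = 0 \<or> c = 1" by auto
      then show "j \<in> {0, h div 2}" using c by auto
    qed
    then have "card ({..<h} - J) \<le> card {0, h div 2}" by (intro card_mono) auto
    also have "\<dots> \<le> 2" by (simp add: card_insert_if)
    finally show ?thesis .
  qed
  show ?thesis
  proof (rule that[of J X])
    show "finite J" by fact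
    have "card ({..<h} - J) = h - card J"
      using J fin by (simp add: card_Diff_subset)
    then have "card J + 2 \<ge> h" using compl by linarith
    moreover have "real q = 2 * real h + 1"
      using q_eq q by linarith
    ultimately show "real (card J) \<ge> (real q - 5) / 2"
      by (simp add: field_simps)
    fix j assume "j \<in> J"
    then have j: "\<not> h dvd 2 * j" by (auto simp: J_def)
    show "dirichlet_character q (X j)" by (rule char)
    have cop1: "coprime (q - 1) q" using q coprime_diff_one_left_nat[of q] by simp
    have "int q dvd (int q - 1) ^ 2 - 1"
      by (simp add: power2_eq_square algebra_simps)
    then have "[(q - 1) ^ 2 = 1] (mod q)"
      using q by (simp add: cong_iff_dvd_diff of_nat_diff flip: cong_int_iff)
    then have "[g ^ (2 * ind (q - 1)) = g ^ 0] (mod q)"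
      using cong_pow[OF ind[OF cop1], of 2] by (simp add: power_mult mult.commute[of 2]) (metis cong_trans)
    then have "[2 * ind (q - 1) = 0] (mod 2 * h)"
      by (rule expo)
    then have "h dvd ind (q - 1)"
      by (simp add: cong_0_iff)
    then show "X j (q - 1) = 1"
      using cop1 cis_2pi_frac_eq_1_iff[OF h, of "j * ind (q - 1)"] unfolding X_def by simp
    \<comment> \<open>The generator has index 1, so it detects that the square is nontrivial as soon
      as \<open>h\<close> does not divide \<open>2 * j\<close>.\<close>
    have "X j g = cis (2 * pi * real (j * 1) / real h)"
      using cop_g by (intro X_eq) (auto simp: coprime_commute)
    then have "X j g ^ 2 = cis (2 * pi * real (2 * j) / real h)"
      by (simp add: power2_eq_square cis_mult mult_ac)
    then have "X j g ^ 2 \<noteq> 1"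
      using j cis_2pi_frac_eq_1_iff[OF h, of "2 * j"] by simp
    moreover have "trivial_character q g = 1"
      using cop_g by (simp add: trivial_character_def coprime_commute)
    ultimately show "(\<lambda>n. X j n ^ 2) \<noteq> trivial_character q"
      by metis
  next
    fix n
    have n1: "norm (X j n) \<le> 1" for j by (simp add: X_def)
    have full: "norm (\<Sum>j<h. X j n) \<le> (if [n = 1] (mod q) \<or> [n = q - 1] (mod q) then real q else 0)"
    proof (cases "[n = 1] (mod q) \<or> [n = q - 1] (mod q)")
      case True
      have "norm (\<Sum>j<h. X j n) \<le> (\<Sum>j<h. 1)"
        by (intro sum_norm_le n1)
      also have "\<dots> \<le> real q" using q_eq by simp
      finally show ?thesis using True by simp
    next
      case False
      have "(\<Sum>j<h. X j n) = 0"
      proof (cases "coprime n q")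
        case True
        define z where "z = cis (2 * pi * real (ind n) / real h)"
        have "X j n = z ^ j" for j
          using True by (simp add: X_def z_def Complex.DeMoivre mult_ac)
        moreover have "z ^ h = 1"
          using h by (simp add: z_def Complex.DeMoivre cis_multiple_2pi)
        moreover have "z \<noteq> 1"
        proof
          assume "z = 1"
          then have "h dvd ind n" using cis_2pi_frac_eq_1_iff[OF h, of "ind n"] by (simp add: z_def)
          then have "ord q g dvd 2 * ind n" using ord_g q_eq by simp
          then have "[g ^ (2 * ind n) = 1] (mod q)" by (simp only: ord_divides)
          moreover have "[g ^ (2 * ind n) = n ^ 2] (mod q)"
            using cong_pow[OF ind[OF True], of 2] by (simp add: power_mult mult.commute[of 2])
          ultimately have "[n ^ 2 = 1] (mod q)" by (metis cong_sym cong_trans)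
          then show False using prime_dvd_square_minus_one[OF assms(1)] False by blast
        qed
        ultimately show ?thesis
          using geometric_sum[of z h] by simp
      qed (simp add: X_def)
      then show ?thesis by simp
    qed
    have "(\<Sum>j<h. X j n) = (\<Sum>j\<in>{..<h} - J. X j n) + (\<Sum>j\<in>J. X j n)"
      by (rule sum.subset_diff) (use J in auto)
    then have "norm (\<Sum>j\<in>J. X j n) \<le> norm (\<Sum>j<h. X j n) + norm (\<Sum>j\<in>{..<h} - J. X j n)"
      by (metis add_diff_cancel_left' norm_triangle_ineq4)
    also have "norm (\<Sum>j\<in>{..<h} - J. X j n) \<le> (\<Sum>j\<in>{..<h} - J. 1)"
      by (intro sum_norm_le n1)
    also have "\<dots> \<le> 2" using compl by simp
    finally show "norm (\<Sum>j\<in>J. X j n) \<le> (if [n = 1] (mod q) \<or> [n = q - 1] (mod q) then real q else 0) + 2"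
      using full by linarith
  qed
qed

section \<open>The functional equation\<close>

text \<open>The logarithmic derivative of the reflection formula for Gamma.\<close>

lemma Digamma_reflection:
  fixes w :: complex
  assumes "w \<notin> \<int>"
  shows "Digamma (1 - w) - Digamma w = of_real pi * cot (of_real pi * w)"
proof -
  have nz: "w \<notin> \<int>\<^sub>\<le>\<^sub>0" "1 - w \<notin> \<int>\<^sub>\<le>\<^sub>0"
    using assms nonpos_Ints_subset_Ints Ints_diff[of 1 "1 - w"] by auto
  have s0: "sin (of_real pi * w) \<noteq> 0"
    using assms by (metis (no_types, opaque_lifting) Ints_of_int mult.commute mult_right_cancel of_real_eq_0_iff pi_neq_zero sin_eq_0 of_real_mult of_real_of_int_eq)
  have "((\<lambda>z. Gamma z * Gamma (1 - z)) has_field_derivative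
      Gamma w * Digamma w * Gamma (1 - w) - Gamma (1 - w) * Digamma (1 - w) * Gamma w) (at w)"
    using nz by (auto intro!: derivative_eq_intros)
  moreover have "((\<lambda>z. of_real pi / sin (of_real pi * z)) has_field_derivative
      - (of_real pi * of_real pi * cos (of_real pi * w)) / sin (of_real pi * w) ^ 2) (at w)"
    using s0 by (auto intro!: derivative_eq_intros simp: power2_eq_square)
  moreover have "(\<lambda>z. Gamma z * Gamma (1 - z)) = (\<lambda>z::complex. of_real pi / sin (of_real pi * z))"
    by (simp add: Gamma_reflection_complex fun_eq_iff)
  ultimately have "Gamma w * Digamma w * Gamma (1 - w) - Gamma (1 - w) * Digamma (1 - w) * Gamma w
      = - (of_real pi * of_real pi * cos (of_real pi * w)) / sin (of_real pi * w) ^ 2"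
    using DERIV_unique by metis
  then have "(Gamma w * Gamma (1 - w)) * (Digamma w - Digamma (1 - w))
      = - (of_real pi * of_real pi * cos (of_real pi * w)) / sin (of_real pi * w) ^ 2"
    by (simp add: algebra_simps)
  then show ?thesis
    unfolding Gamma_reflection_complex
  proof -
    define S where "S = sin (of_real pi * w)"
    define X where "X = Digamma w - Digamma (1 - w)"
    assume eq: "of_real pi / sin (of_real pi * w) * (Digamma w - Digamma (1 - w))
      = - (of_real pi * of_real pi * cos (of_real pi * w)) / sin (of_real pi * w) ^ 2"
    have S0: "S \<noteq> 0" using s0 by (simp add: S_def)
    have "X = (of_real pi / S * X) * (S / of_real pi)"
      using S0 by simp
    also have "of_real pi / S * X = - (of_real pi * of_real pi * cos (of_real pi * w)) / S ^ 2"
      using eq by (simp only: S_def X_def)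
    also have "\<dots> * (S / of_real pi) = - (of_real pi * cot (of_real pi * w))"
      using S0 by (simp add: cot_def power2_eq_square flip: S_def)
    finally show ?thesis
      by (simp add: X_def algebra_simps)
  qed
qed

text \<open>The defining series of \<open>Digamma\<close> at \<open>1 - w\<close> and
  \<open>w\<close> are subtracted; the terms \<open>inverse (of_nat (Suc k))\<close> and Euler's
  constant cancel. The poles come out paired as \<open>- w\<close> shifted down and
  \<open>1 - w\<close> shifted up, which suits the reflection of residues b to q - b.\<close>

lemma cot_partial_fractions:
  fixes w :: complex
  assumes "w \<notin> \<int>"
  shows "(\<lambda>k. 1 / (w + of_nat k) - 1 / (1 - w + of_nat k)) sums (of_real pi * cot (of_real pi * w))"
proof -
  have nz: "w \<noteq> 0" "1 - w \<noteq> 0"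
    using assms by auto
  have "(\<lambda>k. (inverse (of_nat (Suc k)) - inverse ((1 - w) + of_nat k)) -
             (inverse (of_nat (Suc k)) - inverse (w + of_nat k))) sums
        ((Digamma (1 - w) + euler_mascheroni) - (Digamma w + euler_mascheroni))"
    unfolding Digamma_def diff_add_cancel by (intro sums_diff summable_sums summable_Digamma nz)
  then show ?thesis
    using Digamma_reflection[OF assms] by (simp add: inverse_eq_divide)
qed

text \<open>A geometric series in exp(2 \<pi> i w), which has modulus less than 1 in the upper
  half-plane.\<close>

lemma cot_q_expansion:
  fixes w :: complex
  assumes "Im w > 0"
  shows "(\<lambda>n. exp (2 * of_real pi * \<i> * of_nat (Suc n) * w)) sums ((\<i> * cot (of_real pi * w) - 1) / 2)"
proof -
  define E where "E = exp (\<i> * (of_real pi * w))"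
  have "norm E < 1"
    using assms by (simp add: E_def)
  then have E2: "norm (E ^ 2) < 1"
    by (simp add: norm_power power_less_one_iff abs_square_less_1)
  then have E1: "E ^ 2 \<noteq> 1"
    by auto
  have E0: "E \<noteq> 0" by (simp add: E_def)
  have 1: "exp (2 * of_real pi * \<i> * of_nat (Suc n) * w) = (E ^ 2) * (E ^ 2) ^ n" for n
    by (simp add: E_def flip: exp_of_nat_mult exp_add power_mult) (simp add: algebra_simps)
  have 2: "(\<lambda>n. (E ^ 2) * (E ^ 2) ^ n) sums (E ^ 2 * (1 / (1 - E ^ 2)))"
    using E2 by (intro sums_mult geometric_sums)
  have 3: "E ^ 2 * (1 / (1 - E ^ 2)) = (\<i> * cot (of_real pi * w) - 1) / 2"
  proof -
    have inv: "exp (- (\<i> * (of_real pi * w))) = inverse E"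
      by (simp add: E_def exp_minus)
    have s: "sin (of_real pi * w) = (E - inverse E) / (2 * \<i>)"
      unfolding sin_exp_eq inv E_def[symmetric] by simp
    have c: "cos (of_real pi * w) = (E + inverse E) / 2"
      unfolding cos_exp_eq inv E_def[symmetric] by simp
    have ne: "E - inverse E \<noteq> 0" "1 - E ^ 2 \<noteq> 0" "E ^ 2 - 1 \<noteq> 0"
      using E1 E0 by (auto simp: field_simps power2_eq_square)
    have "cot (of_real pi * w) = \<i> * (E ^ 2 + 1) / (E ^ 2 - 1)"
      unfolding cot_def s c using ne E0 by (simp add: field_simps power2_eq_square)
    then show ?thesis
      using ne by (simp add: field_simps)
  qed
  show ?thesis
    using 2 unfolding 1 3 .
qed

section \<open>Mellin transforms of the exponential and the Cauchy kernel\<close>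

lemma absolutely_integrable_scale:
  fixes f :: "real \<Rightarrow> real"
  assumes "(f has_integral I) {0<..}" "\<And>x. x > 0 \<Longrightarrow> f x \<ge> 0" "c > 0"
  shows "((\<lambda>x. f (c * x)) has_integral (I / c)) {0<..}"
proof -
  have im: "(\<lambda>x. c * x) ` {0<..} = {0<..}"
    using assms(3) by (force simp: image_iff intro!: bexI[of _ "y / c" for y])
  have "f absolutely_integrable_on {0<..} \<and> integral {0<..} f = I"
    using assms(1,2) by (auto intro!: nonnegative_absolutely_integrable_1 simp: integral_unique has_integral_integrable)
  then have "(\<lambda>x. \<bar>c\<bar> *\<^sub>R f (c * x)) absolutely_integrable_on {0<..} \<and>
      integral {0<..} (\<lambda>x. \<bar>c\<bar> *\<^sub>R f (c * x)) = I"
    using has_absolute_integral_change_of_variables_1'[of "{0<..}" "\<lambda>x. c * x" "\<lambda>_. c" f I] assms(3)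
    unfolding im by (force intro!: derivative_eq_intros simp: inj_on_def)
  then have "((\<lambda>x. c * f (c * x)) has_integral I) {0<..}"
    using assms(3) by (simp add: has_integral_iff set_lebesgue_integral_eq_integral)
  from has_integral_mult_right[OF this, of "1 / c"] show ?thesis
    using assms(3) by simp
qed

lemma has_integral_exp_powr:
  assumes "s > 0" "c > (0::real)"
  shows "((\<lambda>y. exp (- c * y) * y powr (s - 1)) has_integral (Gamma s * c powr (- s))) {0<..}"
proof -
  have "((\<lambda>t. t powr (s - 1) / exp t) has_integral Gamma s) {0..}"
    by (rule Gamma_integral_real[OF assms(1)])
  then have "((\<lambda>t. if t \<in> {0<..} then t powr (s - 1) / exp t else 0) has_integral Gamma s) {0..}"
    by (rule has_integral_spike[of "{0}", rotated 2]) auto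
  then have "((\<lambda>t. t powr (s - 1) / exp t) has_integral Gamma s) {0<..}"
    by (subst (asm) has_integral_restrict) auto
  from absolutely_integrable_scale[OF this _ assms(2)]
  have "((\<lambda>y. (c * y) powr (s - 1) / exp (c * y)) has_integral (Gamma s / c)) {0<..}"
    by simp
  from has_integral_mult_right[OF this, of "c powr (1 - s)"]
  have "((\<lambda>y. c powr (1 - s) * ((c * y) powr (s - 1) / exp (c * y))) has_integral (c powr (1 - s) * (Gamma s / c))) {0<..}" .
  moreover have "c powr (1 - s) * (Gamma s / c) = Gamma s * c powr (- s)"
    using assms by (simp add: powr_diff powr_minus field_simps)
  moreover have "c powr (1 - s) * ((c * y) powr (s - 1) / exp (c * y)) = exp (- c * y) * y powr (s - 1)" if "y \<in> {0<..}" for y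
    using assms that by (simp add: powr_mult exp_minus field_simps flip: powr_add)
  ultimately show ?thesis
    by (metis (no_types, lifting) has_integral_cong)
qed

text \<open>By the reflection formula this is \<pi> / (2 cos(\<pi> s / 2)). The product form is kept
  because its two factors are the ones that \<open>gamma_factor_identity\<close> combines.\<close>

definition mellin_cauchy :: "real \<Rightarrow> real" where
  "mellin_cauchy s = Gamma ((1 + s) / 2) * Gamma ((1 - s) / 2) / 2"

text \<open>The substitution t = v^2 / (1 + v^2) turns this into the Beta integral with parameters
  (1 + s) / 2 and (1 - s) / 2, whose sum is 1.\<close>

lemma has_integral_mellin_cauchy:
  assumes "0 < s" "s < 1"
  shows "((\<lambda>v. v powr s / (1 + v\<^sup>2)) has_integral mellin_cauchy s) {0<..}"
proof -
  define \<alpha> \<beta> where "\<alpha> = (1 + s) / 2" and "\<beta> = (1 - s) / 2"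
  have ab: "\<alpha> > 0" "\<beta> > 0" "\<alpha> + \<beta> = 1" using assms by (auto simp: \<alpha>_def \<beta>_def field_simps)
  define f where "f = (\<lambda>t::real. t powr (\<alpha> - 1) * (1 - t) powr (\<beta> - 1))"
  define g where "g = (\<lambda>v::real. v\<^sup>2 / (1 + v\<^sup>2))"
  have pos: "1 + v\<^sup>2 > 0" for v :: real
    by (simp add: add_pos_nonneg)
  have "(f has_integral Beta \<alpha> \<beta>) {0..1}"
    unfolding f_def using ab by (intro has_integral_Beta_real)
  then have f: "(f has_integral Beta \<alpha> \<beta>) {0<..<1}"
    by (simp add: has_integral_Icc_iff_Ioo)
  have im: "g ` {0<..} = {0<..<1}"
  proof
    show "g ` {0<..} \<subseteq> {0<..<1}" using pos by (auto simp: g_def field_simps)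
    show "{0<..<1} \<subseteq> g ` {0<..}"
    proof
      fix t :: real assume t: "t \<in> {0<..<1}"
      then have "g (sqrt (t / (1 - t))) = t" by (simp add: g_def field_simps)
      moreover have "sqrt (t / (1 - t)) \<in> {0<..}" using t by simp
      ultimately show "t \<in> g ` {0<..}" by (metis imageI)
    qed
  qed
  have inj: "inj_on g {0<..}"
  proof (rule inj_onI)
    fix x y :: real assume xy: "x \<in> {0<..}" "y \<in> {0<..}" "g x = g y"
    then have "x\<^sup>2 * (1 + y\<^sup>2) = y\<^sup>2 * (1 + x\<^sup>2)"
      using pos[of x] pos[of y] by (simp add: g_def frac_eq_eq less_imp_neq[THEN not_sym])
    then have "x\<^sup>2 = y\<^sup>2" by (simp add: algebra_simps)
    then show "x = y" using xy by simp
  qed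
  have der: "(g has_field_derivative (2 * v / (1 + v\<^sup>2)\<^sup>2)) (at v within {0<..})" for v
    unfolding g_def using pos[of v]
    by (auto intro!: derivative_eq_intros simp: power2_eq_square field_simps)
  have "f absolutely_integrable_on {0<..<1} \<and> integral {0<..<1} f = Beta \<alpha> \<beta>"
    using f by (auto intro!: nonnegative_absolutely_integrable_1 simp: integral_unique has_integral_integrable f_def)
  then have "(\<lambda>v. \<bar>2 * v / (1 + v\<^sup>2)\<^sup>2\<bar> *\<^sub>R f (g v)) absolutely_integrable_on {0<..} \<and>
      integral {0<..} (\<lambda>v. \<bar>2 * v / (1 + v\<^sup>2)\<^sup>2\<bar> *\<^sub>R f (g v)) = Beta \<alpha> \<beta>"
    using has_absolute_integral_change_of_variables_1'[of "{0<..}" g "\<lambda>v. 2 * v / (1 + v\<^sup>2)\<^sup>2" f "Beta \<alpha> \<beta>"] der inj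
    unfolding im by auto
  then have "((\<lambda>v. \<bar>2 * v / (1 + v\<^sup>2)\<^sup>2\<bar> *\<^sub>R f (g v)) has_integral Beta \<alpha> \<beta>) {0<..}"
    by (simp add: has_integral_iff set_lebesgue_integral_eq_integral)
  from has_integral_mult_right[OF this, of "1/2"]
  have "((\<lambda>v. 1/2 * (\<bar>2 * v / (1 + v\<^sup>2)\<^sup>2\<bar> *\<^sub>R f (g v))) has_integral (1/2 * Beta \<alpha> \<beta>)) {0<..}" .
  moreover have "1/2 * (\<bar>2 * v / (1 + v\<^sup>2)\<^sup>2\<bar> *\<^sub>R f (g v)) = v powr s / (1 + v\<^sup>2)" if "v \<in> {0<..}" for v
  proof -
    have v: "v > 0" using that by simp
    define u where "u = 1 + v\<^sup>2"
    have u: "u > 0" using pos[of v] by (simp add: u_def)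
    have 1: "1 - g v = 1 / u" using u by (simp add: g_def u_def field_simps)
    have h1: "g v powr (\<alpha> - 1) = v powr (2 * (\<alpha> - 1)) / u powr (\<alpha> - 1)"
      using v u unfolding g_def u_def[symmetric]
      by (simp add: powr_divide powr_powr flip: powr_numeral)
    have h2: "(1 - g v) powr (\<beta> - 1) = u powr (1 - \<beta>)"
      unfolding 1 using u by (simp add: powr_divide powr_minus_divide[symmetric])
    have h3: "u powr (1 - \<beta>) / u powr (\<alpha> - 1) = u"
    proof -
      have "1 - \<beta> - (\<alpha> - 1) = 1" using ab by simp
      then show ?thesis
        using u by (simp only: powr_diff[symmetric] powr_one less_imp_le)
    qed
    have "f (g v) = v powr (2 * (\<alpha> - 1)) * (u powr (1 - \<beta>) / u powr (\<alpha> - 1))"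
      unfolding f_def h1 h2 by simp
    then have "f (g v) = v powr (2 * (\<alpha> - 1)) * u"
      unfolding h3 .
    moreover have "2 * (\<alpha> - 1) = s - 1" by (simp add: \<alpha>_def field_simps)
    moreover have "v powr (s - 1) * v = v powr s" using v by (simp add: powr_diff)
    ultimately show ?thesis
      using v u unfolding u_def[symmetric] by (simp add: field_simps power2_eq_square)
  qed
  ultimately have "((\<lambda>v. v powr s / (1 + v\<^sup>2)) has_integral (1/2 * Beta \<alpha> \<beta>)) {0<..}"
    by (metis (no_types, lifting) has_integral_cong)
  moreover have "1/2 * Beta \<alpha> \<beta> = mellin_cauchy s"
    using ab by (simp add: Beta_def mellin_cauchy_def \<alpha>_def \<beta>_def)
  ultimately show ?thesis by simp
qed

lemma has_integral_cauchy_powr: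
  assumes "0 < s" "s < 1" "c > 0"
  shows "((\<lambda>y. y / (c\<^sup>2 + y\<^sup>2) * y powr (s - 1)) has_integral (mellin_cauchy s * c powr (s - 1))) {0<..}"
proof -
  from absolutely_integrable_scale[OF has_integral_mellin_cauchy[OF assms(1,2)], of "1 / c"] assms
  have "((\<lambda>y. (1 / c * y) powr s / (1 + (1 / c * y)\<^sup>2)) has_integral (mellin_cauchy s / (1 / c))) {0<..}"
    by (simp add: add_pos_nonneg less_imp_le)
  from has_integral_mult_right[OF this, of "c powr (s - 2)"]
  have "((\<lambda>y. c powr (s - 2) * ((1 / c * y) powr s / (1 + (1 / c * y)\<^sup>2))) has_integral (c powr (s - 2) * (mellin_cauchy s / (1 / c)))) {0<..}" .
  moreover have "c powr (s - 2) * (mellin_cauchy s / (1 / c)) = mellin_cauchy s * c powr (s - 1)"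
    using assms powr_add[of c "s - 2" 1] by simp
  moreover have "c powr (s - 2) * ((1 / c * y) powr s / (1 + (1 / c * y)\<^sup>2)) = y / (c\<^sup>2 + y\<^sup>2) * y powr (s - 1)"
    if "y \<in> {0<..}" for y
  proof -
    have y: "y > 0" using that by simp
    have 1: "(1 / c * y) powr s = y powr s / c powr s"
      using y assms by (simp add: powr_divide)
    have 2: "c powr (s - 2) = c powr s / c\<^sup>2"
      using assms by (simp add: powr_diff powr_numeral)
    have 3: "y powr (s - 1) = y powr s / y"
      using y by (simp add: powr_diff)
    have 4: "c powr s > 0" "c\<^sup>2 + y\<^sup>2 > 0"
      using assms y by (auto simp: add_pos_pos)
    have 5: "1 + (1 / c * y)\<^sup>2 = (c\<^sup>2 + y\<^sup>2) / c\<^sup>2"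
      using assms by (simp add: field_simps power2_eq_square)
    define D P C where "D = c\<^sup>2 + y\<^sup>2" and "P = c powr s" and "C = c\<^sup>2"
    have "D \<noteq> 0" "P \<noteq> 0" "C \<noteq> 0"
      using 4 assms by (auto simp: D_def P_def C_def)
    then show ?thesis
      unfolding 1 2 3 5 using y by (simp flip: D_def P_def C_def)
  qed
  ultimately show ?thesis
    by (metis (no_types, lifting) has_integral_cong)
qed

text \<open>By Abel's inequality every partial sum is dominated by \<open>B * k 0 y\<close>, so
  dominated convergence allows termwise integration without absolute convergence. This is what makes
  the Mellin transforms available inside the critical strip.\<close>

lemma integral_bounded_sums_decreasing:
  fixes a :: "nat \<Rightarrow> complex" and k :: "nat \<Rightarrow> real \<Rightarrow> real"
  assumes B: "\<And>n. norm (\<Sum>j<n. a j) \<le> B"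
    and int: "\<And>n. (k n has_integral w n) {0<..}"
    and dec: "\<And>n y. y > 0 \<Longrightarrow> k (Suc n) y \<le> k n y"
    and lim: "\<And>y. y > 0 \<Longrightarrow> (\<lambda>n. k n y) \<longlonglongrightarrow> 0"
  shows "(\<lambda>n. a n * of_real (w n)) sums integral {0<..} (\<lambda>y. \<Sum>n. a n * of_real (k n y))"
proof -
  have nn: "0 \<le> k n y" if "y > 0" for n y
    using decseq_ge[OF decseq_SucI lim[OF that]] dec[OF that] by auto
  have part: "((\<lambda>y. \<Sum>n<N. a n * of_real (k n y)) has_integral (\<Sum>n<N. a n * of_real (w n))) {0<..}" for N
    by (intro has_integral_sum has_integral_mult_right has_integral_of_real int) auto
  have "(\<lambda>N. integral {0<..} (\<lambda>y. \<Sum>n<N. a n * of_real (k n y)))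
     \<longlonglongrightarrow> integral {0<..} (\<lambda>y. \<Sum>n. a n * of_real (k n y))"
  proof (rule dominated_convergence(2))
    show "(\<lambda>y. \<Sum>n<N. a n * of_real (k n y)) integrable_on {0<..}" for N
      using part[of N] by (rule has_integral_integrable)
    show "(\<lambda>y. B * k 0 y) integrable_on {0<..}"
      using has_integral_mult_right[OF int[of 0], of B] by (rule has_integral_integrable)
    fix y :: real assume "y \<in> {0<..}"
    then have y: "y > 0" by simp
    show "norm (\<Sum>n<N. a n * of_real (k n y)) \<le> B * k 0 y" for N
      by (rule norm_sum_decreasing_le) (use B dec nn y in auto)
    show "(\<lambda>N. \<Sum>n<N. a n * of_real (k n y)) \<longlonglongrightarrow> (\<Sum>n. a n * of_real (k n y))"
      by (intro summable_LIMSEQ bounded_sums_decreasing_tendsto[of a B]) (use B dec lim y in auto)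
  qed
  then show ?thesis
    unfolding sums_def integral_unique[OF part] .
qed

context
  fixes q :: nat and \<psi> :: "nat \<Rightarrow> complex"
  assumes q: "prime q" and \<psi>: "\<psi> \<in> nontrivial_characters q" and even: "\<psi> (q - 1) = 1"
begin

lemma q_gt_1: "q > 1" and q_gt_0: "q > 0"
  using q prime_gt_1_nat prime_gt_0_nat by auto

lemma is_char: "dirichlet_character q \<psi>"
  using \<psi> by (simp add: nontrivial_characters_def)

lemma char_0: "\<psi> 0 = 0"
  using dirichlet_character_eq_0_iff[OF is_char, of 0] q_gt_1 by simp

lemma char_minus:
  assumes "0 < b" "b < q"
  shows "\<psi> (q - b) = \<psi> b"
proof -
  have "int q dvd (int q - int b) - (int q - 1) * int b"
    by (simp add: algebra_simps)
  then have "[q - b = (q - 1) * b] (mod q)"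
    using assms by (simp add: cong_iff_dvd_diff of_nat_diff flip: cong_int_iff)
  then have "\<psi> (q - b) = \<psi> ((q - 1) * b)"
    by (intro dirichlet_character_cong[OF is_char]) (simp only: cong_def)
  then show ?thesis
    using even by (simp add: dirichlet_character_mult[OF is_char])
qed

lemma sum_cnj_char_reflect: "(\<Sum>b<q. cnj (\<psi> b) * f (q - b)) = (\<Sum>b<q. cnj (\<psi> b) * f b)"
proof -
  have eq: "(\<Sum>b<q. cnj (\<psi> b) * h b) = (\<Sum>b\<in>{0<..<q}. cnj (\<psi> b) * h b)" for h
    by (rule sum.mono_neutral_right) (use char_0 in auto)
  have "(\<Sum>b\<in>{0<..<q}. cnj (\<psi> b) * f (q - b)) = (\<Sum>b\<in>{0<..<q}. cnj (\<psi> b) * f b)"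
    by (rule sum.reindex_bij_witness[of _ "\<lambda>b. q - b" "\<lambda>b. q - b"]) (auto simp: char_minus)
  then show ?thesis
    using eq[of "\<lambda>b. f (q - b)"] eq[of f] by simp
qed

lemma norm_sum_cnj_char_le: "norm (\<Sum>k<n. cnj (\<psi> (Suc k))) \<le> real q"
  by (rule norm_sum_dirichlet_character_le[OF nontrivial_character_cnj[OF \<psi>] q_gt_0])

lemma summable_char_cauchy:
  assumes y: "y > 0"
  shows "summable (\<lambda>m. cnj (\<psi> (Suc m)) * of_real (y / ((real (Suc m) / real q)\<^sup>2 + y\<^sup>2)))"
proof (intro bounded_sums_decreasing_tendsto[of _ "real q"] norm_sum_cnj_char_le)
  show "y / ((real (Suc (Suc n)) / real q)\<^sup>2 + y\<^sup>2) \<le> y / ((real (Suc n) / real q)\<^sup>2 + y\<^sup>2)" for n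
    using y by (intro divide_left_mono add_right_mono power_mono divide_right_mono mult_pos_pos add_nonneg_pos) auto
  have "filterlim (\<lambda>n. (real (Suc n) / real q)\<^sup>2 + y\<^sup>2) at_top sequentially"
    using q_gt_0 by real_asymp
  then show "(\<lambda>n. y / ((real (Suc n) / real q)\<^sup>2 + y\<^sup>2)) \<longlonglongrightarrow> 0"
    by (intro tendsto_divide_0[OF tendsto_const] filterlim_at_top_imp_at_infinity)
qed

lemma summable_char_exp:
  assumes y: "y > 0"
  shows "summable (\<lambda>n. \<psi> (Suc n) * of_real (exp (- 2 * pi * real (Suc n) * y)))"
proof (intro bounded_sums_decreasing_tendsto[of _ "real q"] norm_sum_dirichlet_character_le[OF \<psi> q_gt_0])
  show "exp (- 2 * pi * real (Suc (Suc n)) * y) \<le> exp (- 2 * pi * real (Suc n) * y)" for n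
    using y by simp
  show "(\<lambda>n. exp (- 2 * pi * real (Suc n) * y)) \<longlonglongrightarrow> 0"
    using y by real_asymp
qed

text \<open>The functional equation is obtained as the Mellin transform of this identity, which plays the
  role of the theta transformation: it is the expansion of \<open>\<pi> cot (\<pi> w)\<close> in partial fractions and in
  powers of \<open>exp (2 \<pi> i w)\<close>, averaged over \<open>w = b / q + i y\<close> with the weights of an even character.\<close>

lemma character_partial_fractions:
  assumes y: "y > 0"
  shows "of_real pi * gauss_sum q (\<lambda>b. cnj (\<psi> b)) * (\<Sum>n. \<psi> (Suc n) * of_real (exp (- 2 * pi * real (Suc n) * y)))
    = (\<Sum>m. cnj (\<psi> (Suc m)) * of_real (y / ((real (Suc m) / real q)\<^sup>2 + y\<^sup>2)))"
proof -
  define \<tau> where "\<tau> = gauss_sum q (\<lambda>b. cnj (\<psi> b))"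
  define w where "w = (\<lambda>b. complex_of_real (real b / real q) + \<i> * of_real y)"
  define r where "r = (\<lambda>m. y / ((real m / real q)\<^sup>2 + y\<^sup>2))"
  have w: "w b \<notin> \<int>" for b
  proof
    assume "w b \<in> \<int>"
    then obtain k :: int where "w b = of_int k" by (elim Ints_cases)
    then have "Im (w b) = 0" by simp
    then show False using y by (simp add: w_def)
  qed
  have r_eq: "1 / (of_real (real m / real q) + \<i> * of_real y) - 1 / (of_real (real m / real q) - \<i> * of_real y)
     = - 2 * \<i> * of_real (r m)" for m
  proof -
    let ?c = "real m / real q"
    have "?c\<^sup>2 + y\<^sup>2 > 0" using y by (simp add: add_nonneg_pos)
    then have d: "complex_of_real ?c ^ 2 + of_real y ^ 2 \<noteq> 0"
      by (metis less_irrefl of_real_add of_real_eq_0_iff of_real_power)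
    have "(of_real ?c + \<i> * of_real y) * (of_real ?c - \<i> * of_real y) = complex_of_real ?c ^ 2 + of_real y ^ 2"
      by (simp add: algebra_simps power2_eq_square)
    then have nz: "complex_of_real ?c + \<i> * of_real y \<noteq> 0" "complex_of_real ?c - \<i> * of_real y \<noteq> 0"
      and pr: "(of_real ?c + \<i> * of_real y) * (of_real ?c - \<i> * of_real y) = complex_of_real ?c ^ 2 + of_real y ^ 2"
      using d by auto
    have "1 / (of_real ?c + \<i> * of_real y) - 1 / (complex_of_real ?c - \<i> * of_real y)
       = (- 2 * \<i> * of_real y) / ((of_real ?c + \<i> * of_real y) * (of_real ?c - \<i> * of_real y))"
      using nz by (simp add: diff_frac_eq)
    then show ?thesis
      unfolding pr r_def by simp
  qed
  have q0: "complex_of_nat q \<noteq> 0" using q_gt_0 by simp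
  \<comment> \<open>The \<open>k\<close>-th partial fractions at all points \<open>w b\<close> make
    up the block of \<open>m\<close> from \<open>k * q\<close> to \<open>k * q + q - 1\<close>.
    Evenness replaces \<open>b\<close> by \<open>q - b\<close> in the second fraction, after which
    the two are complex conjugates.\<close>
  have split: "(\<Sum>b<q. cnj (\<psi> b) * (1 / (w b + of_nat k) - 1 / (1 - w b + of_nat k)))
      = - 2 * \<i> * (\<Sum>m\<in>{k * q..<k * q + q}. cnj (\<psi> m) * of_real (r m))" for k
  proof -
    define f where "f = (\<lambda>b. 1 / (complex_of_real (real (b + k * q) / real q) - \<i> * of_real y))"
    have 1: "w b + of_nat k = of_real (real (b + k * q) / real q) + \<i> * of_real y" for b
      using q0 by (simp add: w_def field_simps)
    have 2: "cnj (\<psi> b) * (1 / (1 - w b + of_nat k)) = cnj (\<psi> b) * f (q - b)" if "b < q" for b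
    proof -
      have "1 - w b + of_nat k = complex_of_real (real ((q - b) + k * q) / real q) - \<i> * of_real y"
        using q0 that by (simp add: w_def field_simps of_nat_diff)
      then show ?thesis by (simp add: f_def)
    qed
    have "(\<Sum>b<q. cnj (\<psi> b) * (1 / (w b + of_nat k) - 1 / (1 - w b + of_nat k)))
       = (\<Sum>b<q. cnj (\<psi> b) * (1 / (w b + of_nat k))) - (\<Sum>b<q. cnj (\<psi> b) * (1 / (1 - w b + of_nat k)))"
      by (simp add: right_diff_distrib sum_subtractf)
    also have "(\<Sum>b<q. cnj (\<psi> b) * (1 / (1 - w b + of_nat k))) = (\<Sum>b<q. cnj (\<psi> b) * f (q - b))"
      by (intro sum.cong 2) auto
    also have "\<dots> = (\<Sum>b<q. cnj (\<psi> b) * f b)"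
      by (rule sum_cnj_char_reflect)
    also have "(\<Sum>b<q. cnj (\<psi> b) * (1 / (w b + of_nat k))) - (\<Sum>b<q. cnj (\<psi> b) * f b)
        = (\<Sum>b<q. cnj (\<psi> b) * (- 2 * \<i> * of_real (r (b + k * q))))"
      unfolding 1 f_def sum_subtractf[symmetric] right_diff_distrib[symmetric] r_eq ..
    also have "\<dots> = - 2 * \<i> * (\<Sum>b<q. cnj (\<psi> (b + k * q)) * of_real (r (b + k * q)))"
      by (simp add: sum_distrib_left dirichlet_character_add_mult[OF is_char] mult_ac)
    also have "(\<Sum>b<q. cnj (\<psi> (b + k * q)) * of_real (r (b + k * q)))
        = (\<Sum>m\<in>{k * q..<k * q + q}. cnj (\<psi> m) * complex_of_real (r m))"
      by (rule sum.reindex_bij_witness[of _ "\<lambda>m. m - k * q" "\<lambda>b. b + k * q"]) auto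
    finally show ?thesis .
  qed
  have "(\<lambda>k. \<Sum>b<q. cnj (\<psi> b) * (1 / (w b + of_nat k) - 1 / (1 - w b + of_nat k)))
      sums (\<Sum>b<q. cnj (\<psi> b) * (of_real pi * cot (of_real pi * w b)))"
    by (intro sums_sum sums_mult cot_partial_fractions w)
  from sums_mult[OF this, of "\<i> / 2"]
  have lhs: "(\<lambda>k. \<Sum>m\<in>{k * q..<k * q + q}. cnj (\<psi> m) * of_real (r m))
      sums (\<i> / 2 * (\<Sum>b<q. cnj (\<psi> b) * (of_real pi * cot (of_real pi * w b))))"
    unfolding split by (simp add: mult.assoc[symmetric])
  have "(\<lambda>m. cnj (\<psi> (Suc m)) * of_real (r (Suc m))) sums (\<Sum>m. cnj (\<psi> (Suc m)) * of_real (r (Suc m)))"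
    using summable_char_cauchy[OF y] unfolding r_def by (rule summable_sums)
  then have "(\<lambda>m. cnj (\<psi> m) * of_real (r m)) sums (\<Sum>m. cnj (\<psi> (Suc m)) * of_real (r (Suc m)))"
    using sums_Suc_iff[of "\<lambda>m. cnj (\<psi> m) * complex_of_real (r m)"] char_0 by simp
  from sums_group[OF this q_gt_0]
  have "(\<lambda>k. \<Sum>m\<in>{k * q..<k * q + q}. cnj (\<psi> m) * of_real (r m)) sums (\<Sum>m. cnj (\<psi> (Suc m)) * of_real (r (Suc m)))" .
  then have A: "(\<Sum>m. cnj (\<psi> (Suc m)) * of_real (r (Suc m)))
      = \<i> / 2 * (\<Sum>b<q. cnj (\<psi> b) * (of_real pi * cot (of_real pi * w b)))"
    using lhs sums_unique2 by blast
  have Imw: "Im (w b) > 0" for b using y by (simp add: w_def)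
  have trm: "(\<Sum>b<q. cnj (\<psi> b) * exp (2 * of_real pi * \<i> * of_nat (Suc n) * w b))
      = \<tau> * (\<psi> (Suc n) * of_real (exp (- 2 * pi * real (Suc n) * y)))" for n
  proof -
    have "exp (2 * of_real pi * \<i> * of_nat (Suc n) * w b)
        = cis (2 * pi * real (Suc n * b) / real q) * of_real (exp (- 2 * pi * real (Suc n) * y))" for b
    proof -
      have "2 * of_real pi * \<i> * of_nat (Suc n) * w b
        = \<i> * of_real (2 * pi * real (Suc n * b) / real q) + of_real (- 2 * pi * real (Suc n) * y)"
        using q0 by (simp add: w_def add_divide_distrib algebra_simps)
      then show ?thesis
        by (simp only: exp_add cis_conv_exp exp_of_real)
    qed
    then have "(\<Sum>b<q. cnj (\<psi> b) * exp (2 * of_real pi * \<i> * of_nat (Suc n) * w b))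
       = (\<Sum>b<q. cnj (\<psi> b) * cis (2 * pi * real (Suc n * b) / real q)) * of_real (exp (- 2 * pi * real (Suc n) * y))"
      by (simp only: sum_distrib_right mult.assoc)
    then show ?thesis
      unfolding gauss_sum_separable[OF \<psi> q] \<tau>_def by (simp only: mult_ac)
  qed
  have "(\<lambda>n. \<Sum>b<q. cnj (\<psi> b) * exp (2 * of_real pi * \<i> * of_nat (Suc n) * w b))
      sums (\<Sum>b<q. cnj (\<psi> b) * ((\<i> * cot (of_real pi * w b) - 1) / 2))"
    by (intro sums_sum sums_mult cot_q_expansion Imw)
  then have C: "(\<lambda>n. \<tau> * (\<psi> (Suc n) * of_real (exp (- 2 * pi * real (Suc n) * y))))
      sums (\<Sum>b<q. cnj (\<psi> b) * ((\<i> * cot (of_real pi * w b) - 1) / 2))"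
    unfolding trm .
  have c0: "(\<Sum>b<q. cnj (\<psi> b)) = 0"
    by (rule sum_dirichlet_character[OF nontrivial_character_cnj[OF \<psi>] q_gt_0])
  have D: "(\<Sum>b<q. cnj (\<psi> b) * ((\<i> * cot (of_real pi * w b) - 1) / 2))
      = \<i> / 2 * (\<Sum>b<q. cnj (\<psi> b) * cot (of_real pi * w b)) - (\<Sum>b<q. cnj (\<psi> b)) / 2"
    by (simp add: sum_distrib_left sum_divide_distrib diff_divide_distrib right_diff_distrib sum_subtractf mult_ac)
  have "(\<Sum>n. \<tau> * (\<psi> (Suc n) * of_real (exp (- 2 * pi * real (Suc n) * y))))
     = \<tau> * (\<Sum>n. \<psi> (Suc n) * of_real (exp (- 2 * pi * real (Suc n) * y)))"
    by (rule suminf_mult[OF summable_char_exp[OF y]])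
  then have G1: "\<tau> * (\<Sum>n. \<psi> (Suc n) * of_real (exp (- 2 * pi * real (Suc n) * y)))
      = \<i> / 2 * (\<Sum>b<q. cnj (\<psi> b) * cot (of_real pi * w b))"
    using sums_unique[OF C] unfolding D c0 by simp
  have G2: "(\<Sum>b<q. cnj (\<psi> b) * (of_real pi * cot (of_real pi * w b)))
     = of_real pi * (\<Sum>b<q. cnj (\<psi> b) * cot (of_real pi * w b))"
    by (simp add: sum_distrib_left mult_ac)
  have "of_real pi * \<tau> * (\<Sum>n. \<psi> (Suc n) * of_real (exp (- 2 * pi * real (Suc n) * y)))
      = of_real pi * (\<tau> * (\<Sum>n. \<psi> (Suc n) * of_real (exp (- 2 * pi * real (Suc n) * y))))"
    by (rule mult.assoc)
  also have "\<dots> = (\<Sum>m. cnj (\<psi> (Suc m)) * of_real (r (Suc m)))"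
    unfolding G1 A G2 by (rule mult.left_commute)
  finally show ?thesis
    unfolding \<tau>_def r_def .
qed

end

lemma dseries_cnj:
  assumes "\<And>n. norm (\<Sum>k<n. a (Suc k)) \<le> B" "Re s > 0"
  shows "dseries (\<lambda>n. cnj (a n)) (cnj s) = cnj (dseries a s)"
proof -
  have "(\<lambda>n. a (Suc n) / of_nat (Suc n) powr s) sums dseries a s"
    by (rule dseries_sums[of a B]) (use assms in auto)
  then have "(\<lambda>n. cnj (a (Suc n) / of_nat (Suc n) powr s)) sums cnj (dseries a s)"
    by (simp only: sums_cnj)
  moreover have "cnj (a (Suc n) / of_nat (Suc n) powr s) = cnj (a (Suc n)) / of_nat (Suc n) powr (cnj s)" for n
    by (simp add: cnj_powr del: of_nat_Suc)
  ultimately show ?thesis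
    unfolding dseries_def by (simp only: sums_unique[symmetric])
qed

text \<open>Comparison with half the telescoping series of 1 / (n (n + 1)). It supplies an explicit
  region where the series is bounded away from 0, which anchors all later nonvanishing and lower
  bounds.\<close>

lemma norm_dseries_minus_1_le:
  assumes "\<And>n. norm (a n) \<le> 1" "a (Suc 0) = 1" "Re s \<ge> 3"
  shows "norm (dseries a s - 1) \<le> 1 / 2"
proof -
  have le: "norm (a (Suc (Suc n)) / of_nat (Suc (Suc n)) powr s) \<le> 1 / 2 * (1 / real (Suc n) - 1 / real (Suc (Suc n)))" for n
  proof -
    have "norm (a (Suc (Suc n)) / of_nat (Suc (Suc n)) powr s) = norm (a (Suc (Suc n))) / real (Suc (Suc n)) powr Re s"
      by (simp add: norm_divide norm_powr_real_powr del: of_nat_Suc)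
    also have "\<dots> \<le> 1 / real (Suc (Suc n)) powr 3"
      using assms by (intro frac_le powr_mono) auto
    also have "real (Suc (Suc n)) powr 3 = real (Suc (Suc n)) ^ 3"
      by (simp add: powr_numeral del: of_nat_Suc)
    also have "1 / real (Suc (Suc n)) ^ 3 \<le> 1 / 2 * (1 / (real (Suc n) * real (Suc (Suc n))))"
    proof -
      define x where "x = real (Suc n)"
      have x: "x \<ge> 1" by (simp add: x_def)
      have "2 * (x * (x + 1)) \<le> (x + 1) * (x + 1) * (x + 1)"
        using x by (intro order_trans[OF _ mult_right_mono[of "2 * x" "(x + 1) * (x + 1)" "x + 1"]]) (auto simp: algebra_simps)
      then have "1 / (x + 1) ^ 3 \<le> 1 / (2 * (x * (x + 1)))"
        using x by (intro divide_left_mono) (auto simp: power3_eq_cube)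
      moreover have "real (Suc (Suc n)) = x + 1" by (simp add: x_def)
      ultimately show ?thesis
        unfolding x_def by simp
    qed
    also have "1 / (real (Suc n) * real (Suc (Suc n))) = 1 / real (Suc n) - 1 / real (Suc (Suc n))"
      by (simp add: field_simps)
    finally show ?thesis .
  qed
  have "(\<lambda>n. 1 / real (Suc n)) \<longlonglongrightarrow> 0"
    using LIMSEQ_Suc[OF lim_1_over_n] by simp
  then have "(\<lambda>n. 1 / real (Suc n) - 1 / real (Suc (Suc n))) sums (1 / real (Suc 0) - 0)"
    by (rule telescope_sums')
  from sums_mult[OF this, of "1/2"]
  have t: "(\<lambda>n. 1 / 2 * (1 / real (Suc n) - 1 / real (Suc (Suc n)))) sums (1/2)"
    by simp
  have sm: "summable (\<lambda>n. a (Suc (Suc n)) / of_nat (Suc (Suc n)) powr s)"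
    by (rule summable_comparison_test'[OF sums_summable[OF t]]) (use le in auto)
  then have "(\<lambda>n. a (Suc (Suc n)) / of_nat (Suc (Suc n)) powr s) sums (\<Sum>n. a (Suc (Suc n)) / of_nat (Suc (Suc n)) powr s)"
    by (rule summable_sums)
  then have "(\<lambda>n. a (Suc n) / of_nat (Suc n) powr s) sums
      ((\<Sum>n. a (Suc (Suc n)) / of_nat (Suc (Suc n)) powr s) + a (Suc 0) / of_nat (Suc 0) powr s)"
    by (subst sums_Suc_iff[symmetric]) auto
  then have "dseries a s = (\<Sum>n. a (Suc (Suc n)) / of_nat (Suc (Suc n)) powr s) + 1"
    unfolding dseries_def using sums_unique assms(2) by fastforce
  then have "norm (dseries a s - 1) = norm (\<Sum>n. a (Suc (Suc n)) / of_nat (Suc (Suc n)) powr s)"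
    by simp
  also have "\<dots> \<le> (\<Sum>n. 1 / 2 * (1 / real (Suc n) - 1 / real (Suc (Suc n))))"
    by (rule norm_suminf_le[OF le sums_summable[OF t]])
  also have "\<dots> = 1/2"
    using sums_unique[OF t] by simp
  finally show ?thesis .
qed

lemma norm_dseries_ge_half:
  assumes "\<And>n. norm (a n) \<le> 1" "a (Suc 0) = 1" "Re s \<ge> 3"
  shows "norm (dseries a s) \<ge> 1 / 2"
  using norm_dseries_minus_1_le[of a s, OF assms] norm_triangle_ineq2[of 1 "1 - dseries a s"]
  by (simp add: norm_minus_commute)

text \<open>Legendre duplication for Gamma(s/2) Gamma((1 + s)/2) converts the constants of the two
  Mellin transforms into the symmetric Gamma factors; Gamma((1 - s)/2) comes from
  \<open>mellin_cauchy\<close>.\<close>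

lemma gamma_factor_identity:
  assumes "0 < s" "s < 1" "q > (0::real)"
  shows "q powr (- (1/2)) * (q / pi) powr (s / 2) * Gamma (s / 2) * (q powr (1 - s) * mellin_cauchy s)
    = (q / pi) powr ((1 - s) / 2) * Gamma ((1 - s) / 2) * (pi * (Gamma s * (2 * pi) powr (- s)))"
proof -
  define z where "z = complex_of_real (s / 2)"
  have "z \<notin> \<int>\<^sub>\<le>\<^sub>0" "z + 1/2 \<notin> \<int>\<^sub>\<le>\<^sub>0"
    using assms by (auto simp: z_def elim!: nonpos_Ints_cases simp: complex_eq_iff)
  then have "Gamma z * Gamma (z + 1/2) = exp ((1 - 2*z) * of_real (ln 2)) * of_real (sqrt pi) * Gamma (2*z)"
    by (rule Gamma_legendre_duplication)
  moreover have "z + 1/2 = complex_of_real ((1 + s) / 2)" by (simp add: z_def add_divide_distrib)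
  moreover have "exp ((1 - 2*z) * of_real (ln 2)) = complex_of_real (2 powr (1 - s))"
    by (simp add: z_def powr_def exp_of_real[symmetric])
  moreover have "2 * z = complex_of_real s" by (simp add: z_def)
  ultimately have "complex_of_real (Gamma (s / 2) * Gamma ((1 + s) / 2)) = complex_of_real (2 powr (1 - s) * sqrt pi * Gamma s)"
    by (simp add: z_def Gamma_complex_of_real del: of_real_divide of_real_add)
  then have leg: "Gamma (s / 2) * Gamma ((1 + s) / 2) = 2 powr (1 - s) * sqrt pi * Gamma s"
    by (simp only: of_real_eq_iff)
  have q: "q powr (- (1/2)) * q powr (s / 2) * q powr (1 - s) = q powr ((1 - s) / 2)"
    by (simp flip: powr_add) (simp add: field_simps)
  have p: "pi powr (- (s / 2)) * sqrt pi = pi powr (- ((1 - s) / 2)) * (pi * pi powr (- s))"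
  proof -
    have "pi powr (- ((1 - s) / 2)) * (pi powr 1 * pi powr (- s)) = pi powr (- (s / 2)) * pi powr (1/2)"
      by (simp only: powr_add[symmetric]) (simp add: field_simps)
    then show ?thesis by (simp add: powr_half_sqrt)
  qed
  have two: "2 powr (1 - s) / 2 = 2 powr (- s)"
    using powr_diff[of 2 "1" s] by (simp add: powr_minus field_simps)
  have "q powr (- (1/2)) * (q / pi) powr (s / 2) * Gamma (s / 2) * (q powr (1 - s) * mellin_cauchy s)
     = (q powr (- (1/2)) * q powr (s / 2) * q powr (1 - s)) * pi powr (- (s / 2)) * (Gamma (s / 2) * Gamma ((1 + s) / 2)) * Gamma ((1 - s) / 2) / 2"
    using assms by (simp add: mellin_cauchy_def powr_divide powr_minus_divide[of pi] mult_ac)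
  also have "\<dots> = q powr ((1 - s) / 2) * (pi powr (- (s / 2)) * sqrt pi) * (2 powr (1 - s) / 2) * Gamma s * Gamma ((1 - s) / 2)"
    unfolding q leg by simp
  also have "\<dots> = q powr ((1 - s) / 2) * pi powr (- ((1 - s) / 2)) * Gamma ((1 - s) / 2) * (pi * (Gamma s * (2 powr (- s) * pi powr (- s))))"
    unfolding p two by (simp only: mult_ac)
  also have "2 powr (- s) * pi powr (- s) = (2 * pi) powr (- s)"
    by (simp add: powr_mult)
  also have "q powr ((1 - s) / 2) * pi powr (- ((1 - s) / 2)) = (q / pi) powr ((1 - s) / 2)"
    using assms by (simp add: powr_divide powr_minus_divide)
  finally show ?thesis .
qed

text \<open>Gamma(s/2) is the factor for even characters. Being built on \<open>dseries\<close>, it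
  is used for Re s > 0 only; this contains the strip 0 < Re s < 1, which is invariant under the
  reflection.\<close>

definition completed_L :: "nat \<Rightarrow> (nat \<Rightarrow> complex) \<Rightarrow> complex \<Rightarrow> complex" where
  "completed_L q \<psi> s = of_real (real q / pi) powr (s / 2) * Gamma (s / 2) * dseries \<psi> s"

lemma half_not_nonpos_Ints: "Re s > 0 \<Longrightarrow> s / 2 \<notin> \<int>\<^sub>\<le>\<^sub>0"
  by (auto elim!: nonpos_Ints_cases simp: complex_eq_iff)

context
  fixes q :: nat and \<psi> :: "nat \<Rightarrow> complex"
  assumes q: "prime q" and \<psi>: "\<psi> \<in> nontrivial_characters q"
begin

lemma norm_sum_char_le: "norm (\<Sum>k<n. \<psi> (Suc k)) \<le> real q"
  using norm_sum_dirichlet_character_le[OF \<psi>] q prime_gt_0_nat by auto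

lemma norm_char_le_1: "norm (\<psi> n) \<le> 1"
  using norm_dirichlet_character_le[of q \<psi> n] \<psi> q prime_gt_0_nat by (auto simp: nontrivial_characters_def)

lemma char_Suc_0: "\<psi> (Suc 0) = 1"
  using \<psi> dirichlet_character_1 by (auto simp: nontrivial_characters_def)

lemma holomorphic_completed_L: "completed_L q \<psi> holomorphic_on {s. Re s > 0}"
proof -
  have "real q / pi \<noteq> 0" using q prime_gt_0_nat by auto
  then show ?thesis
    unfolding completed_L_def[abs_def] using half_not_nonpos_Ints
    by (intro holomorphic_intros holomorphic_dseries[OF norm_sum_char_le]) auto
qed

lemma completed_L_eq_0_iff: "Re s > 0 \<Longrightarrow> completed_L q \<psi> s = 0 \<longleftrightarrow> dseries \<psi> s = 0"
  using half_not_nonpos_Ints[of s] q prime_gt_0_nat[of q] by (auto simp: completed_L_def Gamma_eq_zero_iff)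

lemma completed_L_cnj:
  assumes "Re s > 0"
  shows "completed_L q (\<lambda>n. cnj (\<psi> n)) (cnj s) = cnj (completed_L q \<psi> s)"
proof -
  have "cnj (of_real (real q / pi) powr (s / 2)) = of_real (real q / pi) powr (cnj s / 2)"
    by (subst cnj_powr) (auto simp: divide_nonneg_pos)
  then show ?thesis
    using dseries_cnj[OF norm_sum_char_le assms] by (simp add: completed_L_def cnj_Gamma)
qed

text \<open>By the identity theorem, vanishing on the strip would spread to s = 3. A nonzero value
  inside the strip is used to show that the Gauss sum is nonzero and that the root number has
  modulus 1.\<close>

lemma completed_L_nonzero_point:
  obtains s where "0 < Re s" "Re s < 1" "completed_L q \<psi> s \<noteq> 0"
proof -
  have "\<exists>s. 0 < Re s \<and> Re s < 1 \<and> dseries \<psi> s \<noteq> 0"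
  proof (rule ccontr)
    assume "\<not> ?thesis"
    then have *: "dseries \<psi> s = 0" if "s \<in> {s. 0 < Re s} \<inter> {s. Re s < 1}" for s
      using that by auto
    have "dseries \<psi> 3 = 0"
    proof (rule analytic_continuation[OF holomorphic_dseries[OF norm_sum_char_le], of "{s. 0 < Re s} \<inter> {s. Re s < 1}" "1/2"])
      show "(1/2::complex) islimpt {s. 0 < Re s} \<inter> {s. Re s < 1}"
        by (rule interior_limit_point, subst interior_open)
          (auto intro: open_halfspace_Re_gt open_halfspace_Re_lt)
    qed (use * in \<open>auto simp: open_halfspace_Re_gt convex_halfspace_Re_gt intro: convex_connected\<close>)
    then show False
      using norm_dseries_ge_half[of \<psi> 3, OF norm_char_le_1 char_Suc_0] by simp
  qed
  then show ?thesis
    using that completed_L_eq_0_iff by auto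
qed

end

section \<open>Logarithmic derivatives of Dirichlet series\<close>

lemma has_sum_dirichlet_product:
  fixes f g :: "nat \<Rightarrow> complex"
  assumes f: "(f has_sum F) {0<..}" "(\<lambda>n. norm (f n)) summable_on {0<..}"
    and g: "(g has_sum G) {0<..}" "(\<lambda>n. norm (g n)) summable_on {0<..}"
  shows "((\<lambda>n. \<Sum>d | d dvd n. f d * g (n div d)) has_sum (F * G)) {0<..}"
proof -
  define h where "h = (\<lambda>(d, m). f d * g m)"
  have "(\<lambda>x. norm (h x)) summable_on ({0<..} \<times> {0<..})"
  proof (rule summable_on_SigmaI)
    fix d
    have "((\<lambda>m. norm (f d) * norm (g m)) has_sum (norm (f d) * infsum (\<lambda>m. norm (g m)) {0<..})) {0<..}"
      by (intro has_sum_cmult_right has_sum_infsum g)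
    then show "((\<lambda>m. norm (h (d, m))) has_sum (norm (f d) * infsum (\<lambda>m. norm (g m)) {0<..})) {0<..}"
      by (simp add: h_def norm_mult)
  next
    show "(\<lambda>d. norm (f d) * infsum (\<lambda>m. norm (g m)) {0<..}) summable_on {0<..}"
      using f(2) by (rule summable_on_cmult_left)
  qed auto
  then have sm: "h summable_on ({0<..} \<times> {0<..})"
    by (rule abs_summable_summable)
  have "(h has_sum (F * G)) ({0<..} \<times> {0<..})"
  proof (rule has_sum_SigmaI[OF _ _ sm])
    show "((\<lambda>m. h (d, m)) has_sum (f d * G)) {0<..}" for d
      unfolding h_def by (simp add: has_sum_cmult_right g(1))
    show "((\<lambda>d. f d * G) has_sum (F * G)) {0<..}"
      using f(1) by (rule has_sum_cmult_left)
  qed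
  also have "(h has_sum (F * G)) ({0<..} \<times> {0<..}) \<longleftrightarrow>
      ((\<lambda>(n, d). f d * g (n div d)) has_sum (F * G)) (SIGMA n:{0<..}. {d. d dvd n})"
    by (rule has_sum_reindex_bij_witness[of _ "\<lambda>(n, d). (d, n div d)" "\<lambda>(d, m). (d * m, d)"])
      (auto simp: h_def dvd_div_mult_self)
  finally have "((\<lambda>(n, d). f d * g (n div d)) has_sum (F * G)) (SIGMA n:{0<..}. {d. d dvd n})" .
  then show ?thesis
  proof (rule has_sum_SigmaD)
    fix n :: nat assume "n \<in> {0<..}"
    then have "finite {d. d dvd n}" by simp
    then show "((\<lambda>d. case (n, d) of (n, d) \<Rightarrow> f d * g (n div d)) has_sum (\<Sum>d | d dvd n. f d * g (n div d))) {d. d dvd n}"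
      by (simp add: has_sum_finite)
  qed
qed

text \<open>This growth condition yields absolute convergence to the right of 1 and is preserved by
  multiplication with logarithms.\<close>

definition subpolynomial :: "(nat \<Rightarrow> complex) \<Rightarrow> bool" where
  "subpolynomial c \<longleftrightarrow> (\<forall>e>0. \<exists>C. \<forall>n. norm (c (Suc n)) \<le> C * real (Suc n) powr e)"

lemma subpolynomialI_bounded:
  assumes "\<And>n. norm (c n) \<le> 1"
  shows "subpolynomial c"
  unfolding subpolynomial_def
proof (intro allI impI exI)
  fix e :: real and n assume "e > 0"
  then have "1 \<le> real (Suc n) powr e"
    by (intro ge_one_powr_ge_zero) auto
  then show "norm (c (Suc n)) \<le> 1 * real (Suc n) powr e"
    using assms[of "Suc n"] by linarith
qed

lemma subpolynomial_mult_ln: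
  assumes "subpolynomial c" "\<And>n. norm (b n) \<le> norm (c n) * ln (real n)"
  shows "subpolynomial b"
  unfolding subpolynomial_def
proof (intro allI impI)
  fix e :: real assume e: "e > 0"
  then obtain C where C: "\<And>n. norm (c (Suc n)) \<le> C * real (Suc n) powr (e / 2)"
    using assms(1) unfolding subpolynomial_def by (meson half_gt_zero)
  have "norm (b (Suc n)) \<le> (C / (e / 2)) * real (Suc n) powr e" for n
  proof -
    have "norm (b (Suc n)) \<le> norm (c (Suc n)) * ln (real (Suc n))"
      by (rule assms(2))
    also have "\<dots> \<le> (C * real (Suc n) powr (e / 2)) * (real (Suc n) powr (e / 2) / (e / 2))"
      using e C[of n] ln_powr_bound[of "real (Suc n)" "e / 2"]
      by (intro mult_mono order_trans[OF norm_ge_zero C[of n]]) auto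
    also have "\<dots> = (C / (e / 2)) * (real (Suc n) powr (e / 2) * real (Suc n) powr (e / 2))"
      by simp
    also have "real (Suc n) powr (e / 2) * real (Suc n) powr (e / 2) = real (Suc n) powr e"
      by (simp flip: powr_add)
    finally show ?thesis .
  qed
  then show "\<exists>C. \<forall>n. norm (b (Suc n)) \<le> C * real (Suc n) powr e"
    by blast
qed

lemma subpolynomial_times_ln:
  assumes "subpolynomial c"
  shows "subpolynomial (\<lambda>n. c n * of_real (ln (real n)))"
proof (rule subpolynomial_mult_ln[OF assms])
  fix n
  have "ln (real n) \<ge> 0"
    by (cases "n = 0") auto
  then show "norm (c n * of_real (ln (real n))) \<le> norm (c n) * ln (real n)"
    by (simp add: norm_mult)
qed

lemma norm_dseries_term:
  "norm (c (Suc n) / of_nat (Suc n) powr s) = norm (c (Suc n)) * real (Suc n) powr (- Re s)"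
  by (simp add: norm_divide norm_powr_real_powr powr_minus_divide del: of_nat_Suc)

lemma subpolynomial_summable:
  assumes "subpolynomial c" "x > 1"
  shows "summable (\<lambda>n. norm (c (Suc n)) * real (Suc n) powr (- x))"
proof -
  define e where "e = (x - 1) / 2"
  have e: "e > 0" using assms by (simp add: e_def)
  then obtain C where C: "\<And>n. norm (c (Suc n)) \<le> C * real (Suc n) powr e"
    using assms(1) unfolding subpolynomial_def by meson
  have "summable (\<lambda>n. real (Suc n) powr (e - x))"
    by (subst summable_Suc_iff[of "\<lambda>n. real n powr (e - x)"]) (use assms in \<open>simp add: summable_real_powr_iff e_def field_simps\<close>)
  then have "summable (\<lambda>n. C * real (Suc n) powr (e - x))"
    by (rule summable_mult)
  then show ?thesis
  proof (rule summable_comparison_test')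
    fix n
    have "norm (c (Suc n)) * real (Suc n) powr (- x) \<le> (C * real (Suc n) powr e) * real (Suc n) powr (- x)"
      by (intro mult_right_mono C) auto
    also have "\<dots> = C * real (Suc n) powr (e - x)"
      by (simp add: powr_add[symmetric] mult.assoc)
    finally show "norm (norm (c (Suc n)) * real (Suc n) powr (- x)) \<le> C * real (Suc n) powr (e - x)"
      by simp
  qed
qed

lemma subpolynomial_sums:
  assumes "subpolynomial c" "Re s > 1"
  shows "summable (\<lambda>n. norm (c (Suc n) / of_nat (Suc n) powr s))"
    and "(\<lambda>n. c (Suc n) / of_nat (Suc n) powr s) sums dseries c s"
    and "norm (dseries c s) \<le> (\<Sum>n. norm (c (Suc n)) * real (Suc n) powr (- Re s))"
proof -
  show 1: "summable (\<lambda>n. norm (c (Suc n) / of_nat (Suc n) powr s))"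
    unfolding norm_dseries_term by (rule subpolynomial_summable[OF assms])
  then show "(\<lambda>n. c (Suc n) / of_nat (Suc n) powr s) sums dseries c s"
    unfolding dseries_def by (rule summable_sums[OF summable_norm_cancel])
  show "norm (dseries c s) \<le> (\<Sum>n. norm (c (Suc n)) * real (Suc n) powr (- Re s))"
    using summable_norm[OF 1] unfolding dseries_def norm_dseries_term .
qed

lemma dseries_has_field_derivative:
  assumes c: "subpolynomial c" and s: "Re s > 1"
  shows "(dseries c has_field_derivative - dseries (\<lambda>n. c n * of_real (ln (real n))) s) (at s)"
proof -
  let ?S = "{s. Re s > 1}"
  let ?f = "\<lambda>n s. c (Suc n) / of_nat (Suc n) powr s"
  let ?f' = "\<lambda>n s. - (c (Suc n) * of_real (ln (real (Suc n))) / of_nat (Suc n) powr s)"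
  have "\<exists>g g'. \<forall>s \<in> ?S. ((\<lambda>n. ?f n s) sums g s) \<and> ((\<lambda>n. ?f' n s) sums g' s) \<and> (g has_field_derivative g' s) (at s)"
  proof (rule series_and_derivative_comparison_local)
    show op: "open ?S" by (simp add: open_halfspace_Re_gt)
    show "(?f n has_field_derivative ?f' n s) (at s)" for n s
    proof -
      have "(\<lambda>s. c (Suc n) / of_nat (Suc n) powr s) = (\<lambda>s. c (Suc n) * of_nat (Suc n) powr (- s))"
        by (simp add: powr_minus_divide del: of_nat_Suc)
      moreover have "((\<lambda>s. c (Suc n) * of_nat (Suc n) powr (- s)) has_field_derivative
          c (Suc n) * (of_nat (Suc n) powr (- s) * (- Ln (of_nat (Suc n))))) (at s)"
      proof -
        define w where "w = complex_of_nat (Suc n)"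
        have "w \<noteq> 0" by (simp add: w_def del: of_nat_Suc)
        then have "((\<lambda>z. w powr z) has_field_derivative Ln w * w powr (- s)) (at (- s))"
          by (rule has_field_derivative_powr_right)
        moreover have "((\<lambda>s. - s) has_field_derivative - 1) (at s)"
          by (auto intro!: derivative_eq_intros)
        ultimately have "((\<lambda>s. of_nat (Suc n) powr (- s)) has_field_derivative Ln (of_nat (Suc n)) * of_nat (Suc n) powr (- s) * - 1) (at s)"
          unfolding w_def by (rule DERIV_chain2)
        from DERIV_cmult[OF this, of "c (Suc n)"] show ?thesis by (simp add: mult_ac del: of_nat_Suc)
      qed
      moreover have "Ln (complex_of_nat (Suc n)) = of_real (ln (real (Suc n)))"
        using Ln_of_real[of "real (Suc n)"] by simp
      ultimately show ?thesis
        by (simp add: powr_minus_divide del: of_nat_Suc)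
    qed
    fix s assume s: "s \<in> ?S"
    define d where "d = (Re s - 1) / 2"
    have d: "d > 0" using s by (simp add: d_def)
    have "norm (?f n y) \<le> norm (c (Suc n)) * real (Suc n) powr (- (1 + d))" if "y \<in> ball s d" for n y
    proof -
      have "Re s - Re y \<le> norm (s - y)"
        using complex_Re_le_cmod[of "s - y"] by simp
      also have "\<dots> < d" using that by (simp add: dist_norm)
      finally have "- Re y \<le> - (1 + d)" by (simp add: d_def field_simps)
      then show ?thesis
        unfolding norm_dseries_term by (intro mult_left_mono powr_mono) auto
    qed
    moreover have "summable (\<lambda>n. norm (c (Suc n)) * real (Suc n) powr (- (1 + d)))"
      using d by (intro subpolynomial_summable[OF c]) auto
    ultimately show "\<exists>d h. 0 < d \<and> summable h \<and> (\<forall>\<^sub>F n in sequentially. \<forall>y\<in>ball s d \<inter> ?S. norm (?f n y) \<le> h n)"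
      using d by (intro exI[of _ d] exI[of _ "\<lambda>n. norm (c (Suc n)) * real (Suc n) powr (- (1 + d))"]) auto
  qed
  then obtain g g' where g: "\<And>s. Re s > 1 \<Longrightarrow> (\<lambda>n. ?f n s) sums g s"
      "\<And>s. Re s > 1 \<Longrightarrow> (\<lambda>n. ?f' n s) sums g' s"
      "\<And>s. Re s > 1 \<Longrightarrow> (g has_field_derivative g' s) (at s)"
    by auto
  have g_eq: "g s = dseries c s" if "Re s > 1" for s
    using g(1)[OF that] subpolynomial_sums(2)[OF c that] sums_unique2 by blast
  have g'_eq: "g' s = - dseries (\<lambda>n. c n * of_real (ln (real n))) s"
    using g(2)[OF s] sums_minus[OF subpolynomial_sums(2)[OF subpolynomial_times_ln[OF c] s]] sums_unique2 by blast
  show ?thesis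
    unfolding g'_eq[symmetric]
    by (rule has_field_derivative_transform_within_open[OF g(3)[OF s], of "{s. Re s > 1}"])
      (use s g_eq in \<open>auto simp: open_halfspace_Re_gt\<close>)
qed

lemma holomorphic_dseries_Re_gt_1:
  assumes "subpolynomial c"
  shows "dseries c holomorphic_on {s. Re s > 1}"
  using dseries_has_field_derivative[OF assms]
  by (auto simp: holomorphic_on_def field_differentiable_def intro: has_field_derivative_at_within)

context
  fixes a :: "nat \<Rightarrow> complex"
  assumes a_mult: "\<And>m n. a (m * n) = a m * a n" and a_le: "\<And>n. norm (a n) \<le> 1"
begin

lemma subpolynomial_a: "subpolynomial a"
  by (rule subpolynomialI_bounded[OF a_le])

lemma subpolynomial_mangoldt: "subpolynomial (\<lambda>n. a n * mangoldt n)"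
proof (rule subpolynomial_mult_ln[OF subpolynomial_a])
  fix n
  have "norm (mangoldt n :: complex) \<le> ln (real n)"
    using mangoldt_le[of n] by (cases "n = 0") (simp_all add: norm_mangoldt)
  then show "norm (a n * mangoldt n) \<le> norm (a n) * ln (real n)"
    by (simp add: norm_mult mult_left_mono)
qed

lemma has_sum_dseries:
  assumes "subpolynomial c" "Re s > 1"
  shows "((\<lambda>n. c n / of_nat n powr s) has_sum dseries c s) {0<..}"
    and "(\<lambda>n. norm (c n / of_nat n powr s)) summable_on {0<..}"
proof -
  have bij: "bij_betw Suc UNIV {0<..}"
    by (rule bij_betwI[of _ _ _ "\<lambda>n. n - 1"]) auto
  have "((\<lambda>n. c (Suc n) / of_nat (Suc n) powr s) has_sum dseries c s) UNIV"
    by (rule norm_summable_imp_has_sum[OF subpolynomial_sums(1,2)[OF assms]])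
  then show "((\<lambda>n. c n / of_nat n powr s) has_sum dseries c s) {0<..}"
    by (subst (asm) has_sum_reindex_bij_betw[OF bij, of "\<lambda>n. c n / of_nat n powr s"])
  have "(\<lambda>n. norm (c (Suc n) / of_nat (Suc n) powr s)) summable_on UNIV"
    using subpolynomial_sums(1)[OF assms] by (intro norm_summable_imp_summable_on) auto
  then show "(\<lambda>n. norm (c n / of_nat n powr s)) summable_on {0<..}"
    by (subst (asm) summable_on_reindex_bij_betw[OF bij, of "\<lambda>n. norm (c n / of_nat n powr s)"])
qed

text \<open>The convolution identity that \<Lambda>(d) summed over d dividing n is ln n, twisted by
  completely multiplicative coefficients.\<close>

lemma dseries_mangoldt_mult:
  assumes s: "Re s > 1"
  shows "dseries (\<lambda>n. a n * mangoldt n) s * dseries a s = dseries (\<lambda>n. a n * of_real (ln (real n))) s"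
proof -
  have "((\<lambda>n. \<Sum>d | d dvd n. a d * mangoldt d / of_nat d powr s * (a (n div d) / of_nat (n div d) powr s))
      has_sum (dseries (\<lambda>n. a n * mangoldt n) s * dseries a s)) {0<..}"
    by (intro has_sum_dirichlet_product has_sum_dseries subpolynomial_mangoldt subpolynomial_a s)
  moreover have "(\<Sum>d | d dvd n. a d * mangoldt d / of_nat d powr s * (a (n div d) / of_nat (n div d) powr s))
      = a n * of_real (ln (real n)) / of_nat n powr s" if n: "n \<in> {0<..}" for n
  proof -
    have "(\<Sum>d | d dvd n. a d * mangoldt d / of_nat d powr s * (a (n div d) / of_nat (n div d) powr s))
       = (\<Sum>d | d dvd n. a n / of_nat n powr s * mangoldt d)"
    proof (rule sum.cong[OF refl])
      fix d assume "d \<in> {d. d dvd n}"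
      then obtain m where m: "n = d * m" by auto
      have d0: "d > 0" using m n by auto
      have 1: "a n = a d * a (n div d)"
        using d0 by (simp add: m a_mult)
      have "complex_of_nat (d * m) powr s = of_nat d powr s * of_nat m powr s"
        unfolding of_nat_mult by (rule powr_times_real) auto
      then have 2: "complex_of_nat n powr s = of_nat d powr s * of_nat (n div d) powr s"
        using d0 by (simp add: m)
      show "a d * mangoldt d / of_nat d powr s * (a (n div d) / of_nat (n div d) powr s) = a n / of_nat n powr s * mangoldt d"
        unfolding 1 2 by simp
    qed
    also have "\<dots> = a n / of_nat n powr s * of_real (ln (real n))"
      using n unfolding sum_distrib_left[symmetric] by (simp add: mangoldt_sum)
    finally show ?thesis by simp
  qed
  ultimately have "((\<lambda>n. a n * of_real (ln (real n)) / of_nat n powr s)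
      has_sum (dseries (\<lambda>n. a n * mangoldt n) s * dseries a s)) {0<..}"
    by (rule has_sum_cong[THEN iffD1, rotated])
  then show ?thesis
    using has_sum_dseries(1)[OF subpolynomial_times_ln[OF subpolynomial_a] s] has_sum_unique by blast
qed

lemma dseries_log_deriv:
  assumes "Re s > 1"
  shows "(dseries a has_field_derivative - (dseries a s * dseries (\<lambda>n. a n * mangoldt n) s)) (at s)"
  using dseries_has_field_derivative[OF subpolynomial_a assms] dseries_mangoldt_mult[OF assms]
  by (simp add: mult.commute)

text \<open>The series solves the linear differential equation L' = - P L. Multiplied by the
  exponential of a primitive of P it is constant on the half-plane, so one nonzero value is
  enough.\<close>

lemma dseries_nonzero_Re_gt_1:
  assumes s: "Re s > 1" and w: "Re w > 1" "dseries a w \<noteq> 0"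
  shows "dseries a s \<noteq> 0"
proof -
  let ?S = "{s. Re s > 1}"
  let ?P = "dseries (\<lambda>n. a n * mangoldt n)"
  obtain Q where Q: "\<And>x. x \<in> ?S \<Longrightarrow> (Q has_field_derivative ?P x) (at x within ?S)"
    using holomorphic_convex_primitive'[OF convex_halfspace_Re_gt open_halfspace_Re_gt
        holomorphic_dseries_Re_gt_1[OF subpolynomial_mangoldt]] by blast
  have Q': "(Q has_field_derivative ?P x) (at x)" if "x \<in> ?S" for x
    using Q[OF that] at_within_open[OF that open_halfspace_Re_gt] by simp
  have "((\<lambda>x. dseries a x * exp (Q x)) has_field_derivative 0) (at x)" if "x \<in> ?S" for x
  proof -
    have "((\<lambda>x. dseries a x * exp (Q x)) has_field_derivative
        (- (dseries a x * ?P x)) * exp (Q x) + exp (Q x) * ?P x * dseries a x) (at x)"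
      using that by (intro DERIV_mult DERIV_fun_exp Q' dseries_log_deriv) auto
    then show ?thesis by (simp add: algebra_simps)
  qed
  then obtain k where k: "\<And>x. x \<in> ?S \<Longrightarrow> dseries a x * exp (Q x) = k"
  proof -
    have "\<exists>c. \<forall>x\<in>?S. dseries a x * exp (Q x) = c"
      by (rule has_field_derivative_zero_constant[OF convex_halfspace_Re_gt])
        (rule has_field_derivative_at_within, fact)
    then show ?thesis using that by blast
  qed
  then have "k \<noteq> 0" using w k[of w] by auto
  then show ?thesis using k[of s] s by auto
qed

end

section \<open>Functional equation and entire continuation for even characters\<close>

context
  fixes q :: nat and \<psi> :: "nat \<Rightarrow> complex"
  assumes q: "prime q" and \<psi>: "\<psi> \<in> nontrivial_characters q" and even: "\<psi> (q - 1) = 1"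
begin

lemma q_pos: "real q > 0"
  using q prime_gt_0_nat by auto

lemma cnj_nontrivial: "(\<lambda>n. cnj (\<psi> n)) \<in> nontrivial_characters q"
  by (rule nontrivial_character_cnj[OF \<psi>])

lemma mellin_lhs:
  assumes "0 < s"
  shows "integral {0<..} (\<lambda>y. \<Sum>n. \<psi> (Suc n) * of_real (exp (- (2 * pi * real (Suc n)) * y) * y powr (s - 1)))
     = of_real (Gamma s * (2 * pi) powr (- s)) * dseries \<psi> (of_real s)"
proof -
  have "(\<lambda>n. \<psi> (Suc n) * of_real (Gamma s * (2 * pi * real (Suc n)) powr (- s))) sums
     integral {0<..} (\<lambda>y. \<Sum>n. \<psi> (Suc n) * of_real (exp (- (2 * pi * real (Suc n)) * y) * y powr (s - 1)))"
  proof (rule integral_bounded_sums_decreasing[OF norm_sum_char_le[OF q \<psi>]])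
    show "((\<lambda>y. exp (- (2 * pi * real (Suc n)) * y) * y powr (s - 1)) has_integral Gamma s * (2 * pi * real (Suc n)) powr (- s)) {0<..}" for n
      using assms by (intro has_integral_exp_powr) auto
    show "exp (- (2 * pi * real (Suc (Suc n))) * y) * y powr (s - 1) \<le> exp (- (2 * pi * real (Suc n)) * y) * y powr (s - 1)"
      if "y > 0" for n y
      using that by (intro mult_right_mono) auto
    show "(\<lambda>n. exp (- (2 * pi * real (Suc n)) * y) * y powr (s - 1)) \<longlonglongrightarrow> 0" if "y > 0" for y
      using that by real_asymp
  qed
  moreover have "(\<lambda>n. of_real (Gamma s * (2 * pi) powr (- s)) * (\<psi> (Suc n) / of_nat (Suc n) powr (of_real s)))
     sums (of_real (Gamma s * (2 * pi) powr (- s)) * dseries \<psi> (of_real s))"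
    using assms by (intro sums_mult dseries_sums[OF norm_sum_char_le[OF q \<psi>]]) auto
  moreover have "of_real (Gamma s * (2 * pi) powr (- s)) * (\<psi> (Suc n) / of_nat (Suc n) powr (of_real s))
     = \<psi> (Suc n) * of_real (Gamma s * (2 * pi * real (Suc n)) powr (- s))" for n
  proof -
    have "complex_of_nat (Suc n) powr (of_real s) = of_real (real (Suc n) powr s)"
      using powr_of_real[of "real (Suc n)" s] by simp
    moreover have "(2 * pi * real (Suc n)) powr (- s) = (2 * pi) powr (- s) / real (Suc n) powr s"
      by (simp add: powr_mult powr_minus_divide del: of_nat_Suc)
    ultimately show ?thesis by simp
  qed
  ultimately show ?thesis
    by (simp only: sums_unique2)
qed

lemma mellin_rhs:
  assumes "0 < s" "s < 1"
  shows "integral {0<..} (\<lambda>y. \<Sum>m. cnj (\<psi> (Suc m)) * of_real (y / ((real (Suc m) / real q)\<^sup>2 + y\<^sup>2) * y powr (s - 1)))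
     = of_real (real q powr (1 - s) * mellin_cauchy s) * dseries (\<lambda>n. cnj (\<psi> n)) (of_real (1 - s))"
proof -
  have "(\<lambda>m. cnj (\<psi> (Suc m)) * of_real (mellin_cauchy s * (real (Suc m) / real q) powr (s - 1))) sums
     integral {0<..} (\<lambda>y. \<Sum>m. cnj (\<psi> (Suc m)) * of_real (y / ((real (Suc m) / real q)\<^sup>2 + y\<^sup>2) * y powr (s - 1)))"
  proof (rule integral_bounded_sums_decreasing[OF norm_sum_char_le[OF q cnj_nontrivial]])
    show "((\<lambda>y. y / ((real (Suc m) / real q)\<^sup>2 + y\<^sup>2) * y powr (s - 1)) has_integral
        mellin_cauchy s * (real (Suc m) / real q) powr (s - 1)) {0<..}" for m
      using assms q_pos by (intro has_integral_cauchy_powr) auto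
    show "y / ((real (Suc (Suc m)) / real q)\<^sup>2 + y\<^sup>2) * y powr (s - 1) \<le> y / ((real (Suc m) / real q)\<^sup>2 + y\<^sup>2) * y powr (s - 1)"
      if "y > 0" for m y
      using that
      by (intro mult_right_mono divide_left_mono add_right_mono power_mono divide_right_mono mult_pos_pos add_nonneg_pos) auto
    show "(\<lambda>m. y / ((real (Suc m) / real q)\<^sup>2 + y\<^sup>2) * y powr (s - 1)) \<longlonglongrightarrow> 0" if "y > 0" for y
    proof -
      have "filterlim (\<lambda>n. (real (Suc n) / real q)\<^sup>2 + y\<^sup>2) at_top sequentially"
        using q_pos by real_asymp
      then have "(\<lambda>n. y / ((real (Suc n) / real q)\<^sup>2 + y\<^sup>2)) \<longlonglongrightarrow> 0"
        by (intro tendsto_divide_0[OF tendsto_const] filterlim_at_top_imp_at_infinity)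
      then show ?thesis
        by (rule tendsto_mult_left_zero)
    qed
  qed
  moreover have "(\<lambda>n. of_real (real q powr (1 - s) * mellin_cauchy s) * (cnj (\<psi> (Suc n)) / of_nat (Suc n) powr (of_real (1 - s))))
     sums (of_real (real q powr (1 - s) * mellin_cauchy s) * dseries (\<lambda>n. cnj (\<psi> n)) (of_real (1 - s)))"
    using assms by (intro sums_mult dseries_sums[OF norm_sum_char_le[OF q cnj_nontrivial]]) auto
  moreover have "of_real (real q powr (1 - s) * mellin_cauchy s) * (cnj (\<psi> (Suc n)) / of_nat (Suc n) powr (of_real (1 - s)))
     = cnj (\<psi> (Suc n)) * of_real (mellin_cauchy s * (real (Suc n) / real q) powr (s - 1))" for n
  proof -
    have "complex_of_nat (Suc n) powr (of_real (1 - s)) = of_real (real (Suc n) powr (1 - s))"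
      using powr_of_real[of "real (Suc n)" "1 - s"] by simp
    moreover have "(real (Suc n) / real q) powr (s - 1) = real q powr (1 - s) / real (Suc n) powr (1 - s)"
      using q_pos powr_minus_divide[of "real (Suc n)" "1 - s"] powr_minus_divide[of "real q" "1 - s"]
      by (simp add: powr_divide del: of_nat_Suc)
    ultimately show ?thesis by simp
  qed
  ultimately show ?thesis
    by (simp only: sums_unique2)
qed

text \<open>Mellin transform of \<open>character_partial_fractions\<close>. The variable is real
  here because termwise integration rests on kernels that are nonnegative and decreasing in
  \<open>n\<close>.\<close>

lemma functional_equation_real:
  assumes "0 < s" "s < 1"
  shows "of_real (pi * (Gamma s * (2 * pi) powr (- s))) * gauss_sum q (\<lambda>b. cnj (\<psi> b)) * dseries \<psi> (of_real s)
     = of_real (real q powr (1 - s) * mellin_cauchy s) * dseries (\<lambda>n. cnj (\<psi> n)) (of_real (1 - s))"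
proof -
  have "of_real pi * gauss_sum q (\<lambda>b. cnj (\<psi> b)) *
      integral {0<..} (\<lambda>y. \<Sum>n. \<psi> (Suc n) * of_real (exp (- (2 * pi * real (Suc n)) * y) * y powr (s - 1)))
    = integral {0<..} (\<lambda>y. of_real pi * gauss_sum q (\<lambda>b. cnj (\<psi> b)) *
       (\<Sum>n. \<psi> (Suc n) * of_real (exp (- (2 * pi * real (Suc n)) * y) * y powr (s - 1))))"
    by (rule integral_mult_right[symmetric])
  also have "\<dots> = integral {0<..} (\<lambda>y. \<Sum>m. cnj (\<psi> (Suc m)) * of_real (y / ((real (Suc m) / real q)\<^sup>2 + y\<^sup>2) * y powr (s - 1)))"
  proof (rule integral_cong)
    fix y :: real assume "y \<in> {0<..}"
    then have y: "y > 0" by simp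
    have 1: "(\<Sum>n. \<psi> (Suc n) * of_real (exp (- (2 * pi * real (Suc n)) * y) * y powr (s - 1)))
      = (\<Sum>n. \<psi> (Suc n) * of_real (exp (- 2 * pi * real (Suc n) * y))) * of_real (y powr (s - 1))"
      using suminf_mult2[OF summable_char_exp[OF q \<psi> even y], of "of_real (y powr (s - 1))"]
      by (simp add: mult.assoc del: of_nat_Suc)
    have 2: "(\<Sum>m. cnj (\<psi> (Suc m)) * of_real (y / ((real (Suc m) / real q)\<^sup>2 + y\<^sup>2) * y powr (s - 1)))
      = (\<Sum>m. cnj (\<psi> (Suc m)) * of_real (y / ((real (Suc m) / real q)\<^sup>2 + y\<^sup>2))) * of_real (y powr (s - 1))"
      using suminf_mult2[OF summable_char_cauchy[OF q \<psi> even y], of "of_real (y powr (s - 1))"]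
      by (simp add: mult.assoc del: of_nat_Suc)
    show "of_real pi * gauss_sum q (\<lambda>b. cnj (\<psi> b)) *
       (\<Sum>n. \<psi> (Suc n) * of_real (exp (- (2 * pi * real (Suc n)) * y) * y powr (s - 1)))
      = (\<Sum>m. cnj (\<psi> (Suc m)) * of_real (y / ((real (Suc m) / real q)\<^sup>2 + y\<^sup>2) * y powr (s - 1)))"
      unfolding 1 2 mult.assoc[symmetric] character_partial_fractions[OF q \<psi> even y] ..
  qed
  finally show ?thesis
    unfolding mellin_lhs[OF assms(1)] mellin_rhs[OF assms] by (simp add: mult_ac)
qed

text \<open>Both sides are holomorphic in the strip, so the real segment decides. There
  \<open>gamma_factor_identity\<close> matches the constants of the two Mellin transforms, up to the
  nonzero factor \<open>C\<close>.\<close>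

lemma functional_equation:
  assumes "0 < Re s" "Re s < 1"
  shows "gauss_sum q (\<lambda>b. cnj (\<psi> b)) * of_real (real q powr (- (1/2))) * completed_L q \<psi> s
     = completed_L q (\<lambda>n. cnj (\<psi> n)) (1 - s)"
proof -
  define \<tau> where "\<tau> = gauss_sum q (\<lambda>b. cnj (\<psi> b))"
  define S where "S = {s. 0 < Re s} \<inter> {s. Re s < 1}"
  define f where "f = (\<lambda>s. \<tau> * of_real (real q powr (- (1/2))) * completed_L q \<psi> s - completed_L q (\<lambda>n. cnj (\<psi> n)) (1 - s))"
  have "f s = 0"
  proof (rule analytic_continuation[of f S "of_real ` {0<..<1}" "of_real (1/2)"])
    have "(\<lambda>s. completed_L q (\<lambda>n. cnj (\<psi> n)) (1 - s)) holomorphic_on S"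
      by (rule holomorphic_on_compose_gen[OF _ holomorphic_completed_L[OF q cnj_nontrivial], unfolded o_def])
        (auto simp: S_def intro!: holomorphic_intros)
    moreover have "completed_L q \<psi> holomorphic_on S"
      by (rule holomorphic_on_subset[OF holomorphic_completed_L[OF q \<psi>]]) (auto simp: S_def)
    ultimately show "f holomorphic_on S"
      unfolding f_def by (intro holomorphic_intros)
    show "open S"
      by (simp add: S_def open_halfspace_Re_gt open_halfspace_Re_lt open_Int)
    show "connected S"
      unfolding S_def by (intro convex_connected convex_Int convex_halfspace_Re_gt convex_halfspace_Re_lt)
    show "of_real ` {0<..<1} \<subseteq> S" "complex_of_real (1/2) \<in> S" "s \<in> S"
      using assms by (auto simp: S_def)
    show "complex_of_real (1/2) islimpt of_real ` {0<..<1}"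
    proof -
      have "(1/2::real) islimpt {0<..<1}"
        by (rule interior_limit_point) auto
      then show ?thesis
        unfolding islimpt_approachable by (metis (no_types, lifting) dist_of_real image_iff of_real_eq_iff)
    qed
    fix z assume "z \<in> complex_of_real ` {0<..<1}"
    then obtain x where x: "z = of_real x" "0 < x" "x < 1" by auto
    define L L' where "L = dseries \<psi> (of_real x)" and "L' = dseries (\<lambda>n. cnj (\<psi> n)) (of_real (1 - x))"
    define A where "A = real q powr (- (1/2)) * (real q / pi) powr (x / 2) * Gamma (x / 2)"
    define A' where "A' = (real q / pi) powr ((1 - x) / 2) * Gamma ((1 - x) / 2)"
    define C where "C = pi * (Gamma x * (2 * pi) powr (- x))"
    define C' where "C' = real q powr (1 - x) * mellin_cauchy x"
    have eq: "A * C' = A' * C"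
      unfolding A_def A'_def C_def C'_def by (rule gamma_factor_identity[OF x(2,3) q_pos])
    have fe: "of_real C * \<tau> * L = of_real C' * L'"
      unfolding C_def C'_def \<tau>_def L_def L'_def by (rule functional_equation_real[OF x(2,3)])
    have "C \<noteq> 0"
      using x by (auto simp: C_def intro!: Gamma_real_pos less_imp_neq[THEN not_sym])
    have p1: "complex_of_real (real q / pi) powr (of_real x / 2) = of_real ((real q / pi) powr (x / 2))"
      using powr_of_real[of "real q / pi" "x / 2"] by simp
    have p2: "complex_of_real (real q / pi) powr ((1 - of_real x) / 2) = of_real ((real q / pi) powr ((1 - x) / 2))"
      using powr_of_real[of "real q / pi" "(1 - x) / 2"] by simp
    have g1: "Gamma (complex_of_real x / 2) = of_real (Gamma (x / 2))"
      using Gamma_complex_of_real[of "x / 2"] by simp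
    have g2: "Gamma ((1 - complex_of_real x) / 2) = of_real (Gamma ((1 - x) / 2))"
      using Gamma_complex_of_real[of "(1 - x) / 2"] by simp
    have fz: "f z = of_real A * \<tau> * L - of_real A' * L'"
      unfolding f_def completed_L_def x(1) p1 p2 g1 g2 A_def A'_def L_def L'_def by (simp add: mult_ac)
    have "of_real C * f z = of_real A * (of_real C * \<tau> * L) - of_real (A' * C) * L'"
      unfolding fz by (simp add: algebra_simps)
    also have "\<dots> = 0"
      unfolding fe eq[symmetric] by (simp add: mult_ac)
    finally show "f z = 0"
      using \<open>C \<noteq> 0\<close> by simp
  qed
  then show ?thesis
    by (simp add: f_def \<tau>_def)
qed

text \<open>Otherwise the functional equation would force the completed function of the conjugate
  character to vanish on the whole strip.\<close>

lemma gauss_sum_nonzero: "gauss_sum q (\<lambda>b. cnj (\<psi> b)) \<noteq> 0"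
proof
  assume 0: "gauss_sum q (\<lambda>b. cnj (\<psi> b)) = 0"
  obtain s where s: "0 < Re s" "Re s < 1" "completed_L q (\<lambda>n. cnj (\<psi> n)) s \<noteq> 0"
    by (rule completed_L_nonzero_point[OF q cnj_nontrivial])
  then show False
    using functional_equation[of "1 - s"] 0 by simp
qed

text \<open>The map s to 1 - cnj s is the reflection in the critical line. It is an involution, so
  applying the functional equation twice gives W^2 = 1 for the modulus W of the root number.\<close>

lemma norm_completed_L_reflect:
  assumes "0 < Re s" "Re s < 1"
  shows "norm (completed_L q \<psi> (1 - cnj s)) = norm (completed_L q \<psi> s)"
proof -
  define W where "W = norm (gauss_sum q (\<lambda>b. cnj (\<psi> b)) * of_real (real q powr (- (1/2))))"
  have *: "norm (completed_L q \<psi> (1 - cnj s)) = W * norm (completed_L q \<psi> s)" if "0 < Re s" "Re s < 1" for s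
  proof -
    have "norm (completed_L q (\<lambda>n. cnj (\<psi> n)) (1 - s)) = norm (completed_L q \<psi> (1 - cnj s))"
      using completed_L_cnj[OF q \<psi>, of "1 - cnj s"] that by simp
    then show ?thesis
      using functional_equation[OF that] unfolding W_def by (metis norm_mult)
  qed
  obtain z where z: "0 < Re z" "Re z < 1" "completed_L q \<psi> z \<noteq> 0"
    by (rule completed_L_nonzero_point[OF q \<psi>])
  have "norm (completed_L q \<psi> z) = W * (W * norm (completed_L q \<psi> z))"
    using *[of z] *[of "1 - cnj z"] z by simp
  then have "W ^ 2 = 1"
    using z by (simp add: power2_eq_square)
  moreover have "W \<ge> 0"
    by (simp add: W_def)
  ultimately have "W = 1"
    using power2_eq_1_iff[of W] by auto
  then show ?thesis
    using *[OF assms] by simp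
qed

text \<open>Solving the functional equation for \<open>dseries\<close> defines a continuation to Re
  s < 1, which is glued to the series along the strip. Together with uniqueness this evaluates the
  \<open>THE\<close> in \<open>dirichlet_L\<close>.\<close>

lemma dirichlet_L_continuation:
  shows "dirichlet_L \<psi> holomorphic_on UNIV" and "\<And>s. Re s > 0 \<Longrightarrow> dirichlet_L \<psi> s = dseries \<psi> s"
proof -
  define c where "c = gauss_sum q (\<lambda>b. cnj (\<psi> b)) * of_real (real q powr (- (1/2)))"
  have c: "c \<noteq> 0"
    using gauss_sum_nonzero q_pos by (simp add: c_def)
  \<comment> \<open>The reciprocal \<open>rGamma\<close> is entire, so \<open>R\<close> is
    holomorphic also at the poles of Gamma(s/2).\<close>
  define R where "R = (\<lambda>s. inverse c * of_real (real q / pi) powr (- s / 2) * rGamma (s / 2) * completed_L q (\<lambda>n. cnj (\<psi> n)) (1 - s))"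
  define F where "F = (\<lambda>s. if s \<in> {s. Re s > 0} then dseries \<psi> s else R s)"
  have agree: "dseries \<psi> s = R s" if "0 < Re s" "Re s < 1" for s
  proof -
    have "complex_of_real (real q / pi) powr (s / 2) \<noteq> 0"
      using q_pos by simp
    moreover have "complex_of_real (real q / pi) powr (- s / 2) = inverse (complex_of_real (real q / pi) powr (s / 2))"
      using powr_minus[of "complex_of_real (real q / pi)" "s / 2"] by simp
    moreover have "Gamma (s / 2) \<noteq> 0"
      using half_not_nonpos_Ints[OF that(1)] by (simp add: Gamma_eq_zero_iff)
    ultimately show ?thesis
      unfolding R_def functional_equation[OF that, symmetric] unfolding c_def[symmetric] completed_L_def rGamma_inverse_Gamma
      using c by (simp add: field_simps)
  qed
  have hol_R: "R holomorphic_on {s. Re s < 1}"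
  proof -
    have "(\<lambda>s. completed_L q (\<lambda>n. cnj (\<psi> n)) (1 - s)) holomorphic_on {s. Re s < 1}"
      by (rule holomorphic_on_compose_gen[OF _ holomorphic_completed_L[OF q cnj_nontrivial], unfolded o_def])
        (auto intro!: holomorphic_intros)
    then show ?thesis
      unfolding R_def using q_pos by (intro holomorphic_intros) auto
  qed
  have "F holomorphic_on ({s. Re s > 0} \<union> {s. Re s < 1})"
    unfolding F_def using agree
    by (intro holomorphic_on_If_Un holomorphic_dseries[OF norm_sum_char_le[OF q \<psi>]] hol_R
        open_halfspace_Re_gt open_halfspace_Re_lt) auto
  moreover have "{s. Re s > 0} \<union> {s. Re s < 1} = (UNIV :: complex set)"
    by auto
  ultimately have F: "F holomorphic_on UNIV"
    by simp
  have F_sums: "(\<lambda>n. \<psi> (Suc n) / of_nat (Suc n) powr s) sums F s" if "Re s > 1" for s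
    using dseries_sums[OF norm_sum_char_le[OF q \<psi>], of s] that by (simp add: F_def)
  have "dirichlet_L \<psi> = F"
    unfolding dirichlet_L_def
  proof (rule the_equality)
    show "F holomorphic_on UNIV \<and> (\<forall>s. Re s > 1 \<longrightarrow> (\<lambda>n. \<psi> (Suc n) / of_nat (Suc n) powr s) sums F s)"
      using F F_sums by blast
    fix g assume g: "g holomorphic_on UNIV \<and> (\<forall>s. Re s > 1 \<longrightarrow> (\<lambda>n. \<psi> (Suc n) / of_nat (Suc n) powr s) sums g s)"
    have "g s - F s = 0" for s
    proof (rule analytic_continuation[of "\<lambda>s. g s - F s" UNIV "{s. Re s > 1}" 2])
      show "(\<lambda>s. g s - F s) holomorphic_on UNIV"
        using g F by (intro holomorphic_intros) auto
      show "(2::complex) islimpt {s. Re s > 1}"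
        by (rule interior_limit_point, subst interior_open) (auto intro: open_halfspace_Re_gt)
      fix z :: complex assume "z \<in> {s. Re s > 1}"
      then show "g z - F z = 0"
        using g F_sums[of z] sums_unique2 by (metis eq_iff_diff_eq_0 mem_Collect_eq)
    qed auto
    then show "g = F" by auto
  qed
  then show "dirichlet_L \<psi> holomorphic_on UNIV" and "\<And>s. Re s > 0 \<Longrightarrow> dirichlet_L \<psi> s = dseries \<psi> s"
    using F by (auto simp: F_def)
qed

end

section \<open>Nonvanishing on the line of real part 1\<close>

lemma three_four_one:
  assumes "norm z = 0 \<or> norm z = 1"
  shows "3 + 4 * Re z + Re (z ^ 2) \<ge> 0"
proof (cases "z = 0")
  case False
  with assms have "(Re z)\<^sup>2 + (Im z)\<^sup>2 = 1"
    by (metis cmod_power2 norm_eq_zero power_one)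
  then have "3 + 4 * Re z + Re (z ^ 2) = 2 * (1 + Re z)\<^sup>2"
    by (simp add: power2_eq_square algebra_simps)
  then show ?thesis by simp
qed simp

lemma dseries_mangoldt_three_four_one:
  fixes \<psi> :: "nat \<Rightarrow> complex"
  assumes norm: "\<And>n. norm (\<psi> n) = 0 \<or> norm (\<psi> n) = 1"
    and mult: "\<And>m n. \<psi> (m * n) = \<psi> m * \<psi> n" and x: "x > 1"
  shows "3 * Re (dseries (\<lambda>n. mangoldt n) (of_real x))
     + 4 * Re (dseries (\<lambda>n. \<psi> n * mangoldt n) (Complex x t))
     + Re (dseries (\<lambda>n. \<psi> n ^ 2 * mangoldt n) (Complex x (2 * t))) \<ge> 0"
proof -
  have le: "norm (\<psi> n) \<le> 1" for n using norm[of n] by auto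
  then have le2: "norm (\<psi> n ^ 2) \<le> 1" for n by (simp add: norm_power power_le_one)
  have s0: "(\<lambda>n. mangoldt (Suc n) / of_nat (Suc n) powr complex_of_real x) sums dseries (\<lambda>n. mangoldt n) (of_real x)"
    using subpolynomial_sums(2)[OF subpolynomial_mangoldt[of "\<lambda>_. 1"], of "of_real x"] x by simp
  have s1: "(\<lambda>n. \<psi> (Suc n) * mangoldt (Suc n) / of_nat (Suc n) powr Complex x t) sums dseries (\<lambda>n. \<psi> n * mangoldt n) (Complex x t)"
    using subpolynomial_sums(2)[OF subpolynomial_mangoldt[of \<psi>], of "Complex x t"] x le mult by simp
  have s2: "(\<lambda>n. \<psi> (Suc n) ^ 2 * mangoldt (Suc n) / of_nat (Suc n) powr Complex x (2 * t)) sums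
      dseries (\<lambda>n. \<psi> n ^ 2 * mangoldt n) (Complex x (2 * t))"
    using subpolynomial_sums(2)[OF subpolynomial_mangoldt[of "\<lambda>n. \<psi> n ^ 2"], of "Complex x (2 * t)"] x le2 mult
    by (simp add: power_mult_distrib)
  have "(\<lambda>n. 3 * Re (mangoldt (Suc n) / of_nat (Suc n) powr complex_of_real x)
      + 4 * Re (\<psi> (Suc n) * mangoldt (Suc n) / of_nat (Suc n) powr Complex x t)
      + Re (\<psi> (Suc n) ^ 2 * mangoldt (Suc n) / of_nat (Suc n) powr Complex x (2 * t)))
     sums (3 * Re (dseries (\<lambda>n. mangoldt n) (of_real x))
     + 4 * Re (dseries (\<lambda>n. \<psi> n * mangoldt n) (Complex x t))
     + Re (dseries (\<lambda>n. \<psi> n ^ 2 * mangoldt n) (Complex x (2 * t))))"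
    by (intro sums_add sums_mult sums_Re s0 s1 s2)
  then show ?thesis
  proof (rule sums_le[OF _ sums_zero, rotated])
    fix n
    define m where "m = Suc n"
    define z where "z = \<psi> m * of_nat m powr (- \<i> * of_real t)"
    define r where "r = mangoldt m * real m powr (- x)"
    have m: "m > 0" by (simp add: m_def)
    have "norm (complex_of_nat m powr (- \<i> * of_real t)) = 1"
      using m by (simp add: norm_powr_real_powr)
    then have z: "3 + 4 * Re z + Re (z ^ 2) \<ge> 0"
      using norm[of m] by (intro three_four_one) (auto simp: z_def norm_mult)
    have r: "r \<ge> 0" by (simp add: r_def mangoldt_nonneg)
    have p0: "complex_of_nat m powr (- of_real x) = of_real (real m powr (- x))"
      using powr_of_real[of "real m" "- x"] by simp
    have e0: "mangoldt m / of_nat m powr complex_of_real x = of_real r"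
      using p0 by (simp add: r_def divide_inverse powr_minus)
    have e1: "\<psi> m * mangoldt m / of_nat m powr Complex x t = of_real r * z"
    proof -
      have "inverse (complex_of_nat m powr Complex x t) = of_nat m powr (- of_real x + - \<i> * of_real t)"
        by (simp add: powr_minus[symmetric] Complex_eq)
      also have "\<dots> = of_real (real m powr (- x)) * of_nat m powr (- \<i> * of_real t)"
        unfolding powr_add p0 ..
      finally show ?thesis
        by (simp add: divide_inverse z_def r_def)
    qed
    have e2: "\<psi> m ^ 2 * mangoldt m / of_nat m powr Complex x (2 * t) = of_real r * z ^ 2"
    proof -
      have "inverse (complex_of_nat m powr Complex x (2 * t)) = of_nat m powr (- of_real x + (- \<i> * of_real t + - \<i> * of_real t))"
        by (simp add: powr_minus[symmetric] Complex_eq mult_ac)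
      also have "\<dots> = of_real (real m powr (- x)) * (of_nat m powr (- \<i> * of_real t)) ^ 2"
        unfolding powr_add p0 power2_eq_square ..
      finally show ?thesis
        by (simp add: divide_inverse z_def r_def power_mult_distrib)
    qed
    have "3 * Re (of_real r) + 4 * Re (of_real r * z) + Re (of_real r * z ^ 2) = r * (3 + 4 * Re z + Re (z ^ 2))"
      by (simp add: algebra_simps)
    also have "\<dots> \<ge> 0" using r z by simp
    finally have fin: "0 \<le> 3 * Re (of_real r) + 4 * Re (of_real r * z) + Re (of_real r * z ^ 2)" .
    show "0 \<le> 3 * Re (mangoldt (Suc n) / of_nat (Suc n) powr complex_of_real x)
      + 4 * Re (\<psi> (Suc n) * mangoldt (Suc n) / of_nat (Suc n) powr Complex x t)
      + Re (\<psi> (Suc n) ^ 2 * mangoldt (Suc n) / of_nat (Suc n) powr Complex x (2 * t))"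
      unfolding m_def[symmetric] e0 e1 e2 by (rule fin)
  qed
qed

text \<open>The bound comes from summing \<open>ln n\<close> against the telescoping majorant
  \<open>n\<^sup>-\<^sup>x \<le> ((n - 1)\<^sup>1\<^sup>-\<^sup>x - n\<^sup>1\<^sup>-\<^sup>x) / (x - 1)\<close>; no pole of the zeta function is needed.\<close>

lemma dseries_mangoldt_real_le:
  assumes x: "x > 1"
  shows "Re (dseries (\<lambda>n. mangoldt n) (of_real x)) \<le> 1 / (x - 1)"
proof -
  define Z where "Z = (\<Sum>n. real (Suc n) powr (- x))"
  define Z1 where "Z1 = (\<Sum>n. ln (real (Suc n)) * real (Suc n) powr (- x))"
  define P where "P = dseries (\<lambda>n. mangoldt n) (of_real x)"
  have one: "subpolynomial (\<lambda>_. 1)" by (rule subpolynomialI_bounded) simp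
  have pw: "1 / complex_of_nat (Suc n) powr of_real x = of_real (real (Suc n) powr (- x))" for n
    using powr_of_real[of "real (Suc n)" x] by (simp add: powr_minus_divide del: of_nat_Suc)
  have Zs: "summable (\<lambda>n. real (Suc n) powr (- x))"
    using subpolynomial_summable[OF one x] by simp
  have Z1s: "summable (\<lambda>n. ln (real (Suc n)) * real (Suc n) powr (- x))"
    using subpolynomial_summable[OF subpolynomial_times_ln[OF one] x] by (simp add: abs_of_nonneg)
  have Zeq: "dseries (\<lambda>_. 1) (of_real x) = of_real Z"
    unfolding dseries_def pw Z_def by (rule suminf_of_real[OF Zs, symmetric])
  have Z1eq: "dseries (\<lambda>n. of_real (ln (real n))) (of_real x) = of_real Z1"
  proof -
    have "of_real (ln (real (Suc n))) / complex_of_nat (Suc n) powr of_real x = of_real (ln (real (Suc n)) * real (Suc n) powr (- x))" for n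
      using pw[of n] by (simp add: divide_inverse del: of_nat_Suc)
    then show ?thesis
      unfolding dseries_def Z1_def by (simp only: suminf_of_real[OF Z1s])
  qed
  have "P * of_real Z = of_real Z1"
    using dseries_mangoldt_mult[of "\<lambda>_. 1" "of_real x"] x unfolding P_def Zeq[symmetric] Z1eq[symmetric] by simp
  moreover have Zpos: "Z > 0"
    unfolding Z_def by (rule suminf_pos[OF Zs]) auto
  ultimately have "P = of_real (Z1 / Z)"
    by (simp add: field_simps)
  then have RP: "Re P = Z1 / Z" by (simp only: Re_complex_of_real)
  have "(x - 1) * Z1 \<le> Z"
  proof -
    define b where "b = (\<lambda>n. ln (real (Suc n)) * real (Suc n) powr (1 - x))"
    have blim: "b \<longlonglongrightarrow> 0"
      unfolding b_def using x by real_asymp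
    \<comment> \<open>The telescoping part \<open>b n - b (Suc n)\<close> absorbs the logarithm;
      what remains is ln (y + 1) - ln y, at most 1 / y, which turns y^(1 - x) into a term of
      \<open>Z\<close>.\<close>
    have step: "(x - 1) * (ln (real (Suc (Suc n))) * real (Suc (Suc n)) powr (- x)) \<le> real (Suc n) powr (- x) + (b n - b (Suc n))" for n
    proof -
      define y where "y = real (Suc n)"
      have y: "y \<ge> 1" "real (Suc (Suc n)) = y + 1" by (auto simp: y_def)
      obtain u where u: "y < u" "u < y + 1" "(y + 1) powr (1 - x) - y powr (1 - x) = (y + 1 - y) * ((1 - x) * u powr (- x))"
      proof -
        have "\<exists>u>y. u < y + 1 \<and> (y + 1) powr (1 - x) - y powr (1 - x) = (y + 1 - y) * ((1 - x) * u powr (- x))"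
        proof (rule MVT2)
          fix v assume "y \<le> v" "v \<le> y + 1"
          then show "((\<lambda>v. v powr (1 - x)) has_real_derivative (1 - x) * v powr (- x)) (at v)"
            using y has_real_derivative_powr[of v "1 - x"] by simp
        qed simp
        then show ?thesis using that by blast
      qed
      have "(y + 1) powr (- x) \<le> u powr (- x)"
        using u y x by (intro powr_mono2') auto
      then have "(x - 1) * (y + 1) powr (- x) \<le> (x - 1) * u powr (- x)"
        using x by (intro mult_left_mono) auto
      also have "\<dots> = y powr (1 - x) - (y + 1) powr (1 - x)"
        using u(3) by (simp add: algebra_simps)
      finally have "ln (y + 1) * ((x - 1) * (y + 1) powr (- x)) \<le> ln (y + 1) * (y powr (1 - x) - (y + 1) powr (1 - x))"
        using y by (intro mult_left_mono) auto
      also have "\<dots> = (ln (y + 1) - ln y) * y powr (1 - x) + (ln y * y powr (1 - x) - ln (y + 1) * (y + 1) powr (1 - x))"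
        by (simp add: algebra_simps)
      also have "(ln (y + 1) - ln y) * y powr (1 - x) \<le> 1 / y * y powr (1 - x)"
      proof (rule mult_right_mono)
        have "ln (y + 1) - ln y = ln ((y + 1) / y)"
          using y by (subst ln_div) auto
        also have "(y + 1) / y = 1 + 1 / y"
          using y by (simp add: field_simps)
        also have "ln (1 + 1 / y) \<le> 1 / y" using y by (intro ln_add_one_self_le_self) auto
        finally show "ln (y + 1) - ln y \<le> 1 / y" .
      qed simp
      also have "1 / y * y powr (1 - x) = y powr (- x)"
        using y by (simp add: powr_diff powr_minus field_simps)
      finally show ?thesis
        unfolding b_def y(2) y_def[symmetric] by (simp add: mult_ac)
    qed
    have "(\<lambda>n. b n - b (Suc n)) sums (b 0 - 0)"
      by (rule telescope_sums'[OF blim])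
    then have R: "(\<lambda>n. real (Suc n) powr (- x) + (b n - b (Suc n))) sums (Z + 0)"
      using Zs unfolding Z_def by (intro sums_add summable_sums) (auto simp: b_def)
    have "(\<lambda>n. (x - 1) * (ln (real (Suc n)) * real (Suc n) powr (- x))) sums ((x - 1) * Z1)"
      unfolding Z1_def by (intro sums_mult summable_sums Z1s)
    then have L: "(\<lambda>n. (x - 1) * (ln (real (Suc (Suc n))) * real (Suc (Suc n)) powr (- x))) sums ((x - 1) * Z1)"
      by (subst sums_Suc_iff) simp
    show ?thesis
      using sums_le[OF step L R] by simp
  qed
  then show ?thesis
    unfolding P_def[symmetric] RP using x Zpos by (simp add: field_simps)
qed

text \<open>Locally f = g (w - z)^n with g nonvanishing, so f'/f equals n / (w - z) plus a bounded
  term. A lower bound for the real part is all that the 3-4-1 argument uses, and for that a higher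
  multiplicity is only favourable.\<close>

lemma log_deriv_near_point:
  fixes f :: "complex \<Rightarrow> complex"
  assumes f: "f holomorphic_on S" "open S" "connected S" "z \<in> S" "w \<in> S" "f w \<noteq> 0"
  obtains r C where "r > 0"
    "\<And>e. 0 < e \<Longrightarrow> e < r \<Longrightarrow> Re (deriv f (z + of_real e) / f (z + of_real e)) \<ge> (if f z = 0 then 1 / e else 0) - C"
proof -
  define n where "n = nat (zorder f z)"
  define g where "g = zor_poly f z"
  have ex: "\<exists>w\<in>S. f w \<noteq> 0" using f by auto
  note Z = zorder_exist_zero[OF f(1-4) ex, folded n_def g_def]
  then obtain r where r: "r > 0" "cball z r \<subseteq> S" "g holomorphic_on cball z r"
      "\<And>w. w \<in> cball z r \<Longrightarrow> f w = g w * (w - z) ^ n \<and> g w \<noteq> 0"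
    by blast
  have n1: "n \<ge> 1" if "f z = 0"
  proof -
    have "zorder f z > 0" using Z that by simp
    then show ?thesis by (simp add: n_def le_nat_iff)
  qed
  have gb: "g holomorphic_on ball z r"
    using r(3) holomorphic_on_subset ball_subset_cball by blast
  have "continuous_on (cball z (r / 2)) (\<lambda>w. deriv g w / g w)"
  proof (rule holomorphic_on_imp_continuous_on, rule holomorphic_on_divide)
    show "deriv g holomorphic_on cball z (r / 2)"
      by (rule holomorphic_on_subset[OF holomorphic_deriv[OF gb open_ball]]) (use r(1) in auto)
    show "g holomorphic_on cball z (r / 2)"
      using r(1) by (intro holomorphic_on_subset[OF r(3)]) auto
    show "g w \<noteq> 0" if "w \<in> cball z (r / 2)" for w
      using r(1,4) that by auto
  qed
  then have "bounded ((\<lambda>w. deriv g w / g w) ` cball z (r / 2))"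
    by (intro compact_imp_bounded compact_continuous_image compact_cball)
  then obtain C where "\<forall>y\<in>(\<lambda>w. deriv g w / g w) ` cball z (r / 2). norm y \<le> C"
    unfolding bounded_iff by blast
  then have C: "\<And>w. w \<in> cball z (r / 2) \<Longrightarrow> norm (deriv g w / g w) \<le> C"
    by blast
  show ?thesis
  proof (rule that[of "r / 2" C])
    show "r / 2 > 0" using r by simp
    fix e :: real assume e: "0 < e" "e < r / 2"
    define w where "w = z + of_real e"
    have w: "w \<in> ball z r" "w \<in> cball z (r / 2)" "w - z = of_real e"
      using e by (auto simp: w_def dist_norm)
    have g0: "g w \<noteq> 0" using r(4)[of w] w by auto
    have "((\<lambda>w. g w * (w - z) ^ n) has_field_derivative deriv g w * (w - z) ^ n + of_nat n * (w - z) ^ (n - 1) * g w) (at w)"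
    proof -
      have "(g has_field_derivative deriv g w) (at w)"
        using holomorphic_derivI[OF gb open_ball w(1)] .
      then show ?thesis
        by (auto intro!: derivative_eq_intros)
    qed
    then have "(f has_field_derivative deriv g w * (w - z) ^ n + of_nat n * (w - z) ^ (n - 1) * g w) (at w)"
      by (rule has_field_derivative_transform_within_open[of _ _ _ "ball z r"]) (use r(4) w in auto)
    then have d: "deriv f w = deriv g w * (w - z) ^ n + of_nat n * (w - z) ^ (n - 1) * g w"
      by (rule DERIV_imp_deriv)
    have fw: "f w = g w * (w - z) ^ n" using r(4)[of w] w by auto
    have "deriv f w / f w = deriv g w / g w + of_nat n / of_real e"
    proof (cases n)
      case (Suc k)
      then show ?thesis
        unfolding d fw using g0 e w(3) by (simp add: field_simps)
    qed (simp add: d fw)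
    then have "Re (deriv f w / f w) = Re (deriv g w / g w) + real n / e"
      by (simp add: Re_divide_of_real)
    moreover have "Re (deriv g w / g w) \<ge> - C"
      using C[OF w(2)] abs_Re_le_cmod[of "deriv g w / g w"] by linarith
    moreover have "real n / e \<ge> (if f z = 0 then 1 / e else 0)"
      using n1 e by (auto intro!: divide_right_mono)
    ultimately show "Re (deriv f (z + of_real e) / f (z + of_real e)) \<ge> (if f z = 0 then 1 / e else 0) - C"
      unfolding w_def by linarith
  qed
qed

text \<open>A zero at 1 + i t would contribute - 4 / e to the 3-4-1 inequality at 1 + e, against at
  most 3 / e from the trivial coefficients. The term with \<psi>^2 stays bounded above: that
  character is nontrivial, so its series has no pole at 1 + 2 i t, and a zero there has the helpful
  sign.\<close>

lemma dseries_nonzero_Re_eq_1: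
  assumes q: "prime q" and \<psi>: "\<psi> \<in> nontrivial_characters q"
    and sq: "(\<lambda>n. \<psi> n ^ 2) \<noteq> trivial_character q"
  shows "dseries \<psi> (Complex 1 t) \<noteq> 0"
proof
  assume zero: "dseries \<psi> (Complex 1 t) = 0"
  let ?\<phi> = "\<lambda>n. \<psi> n ^ 2"
  have dc: "dirichlet_character q \<psi>" using \<psi> by (simp add: nontrivial_characters_def)
  then have \<phi>: "?\<phi> \<in> nontrivial_characters q"
    using dirichlet_character_square[OF dc] sq by (simp add: nontrivial_characters_def)
  have op: "open {s::complex. Re s > 0}" "connected {s::complex. Re s > 0}"
    by (simp_all add: open_halfspace_Re_gt convex_halfspace_Re_gt convex_connected)
  have nz: "dseries \<theta> 3 \<noteq> 0" if "\<theta> \<in> nontrivial_characters q" for \<theta>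
    using norm_dseries_ge_half[of \<theta> 3] norm_char_le_1[OF q that] char_Suc_0[OF q that] by auto
  obtain r1 C1 where 1: "r1 > 0"
    "\<And>e. 0 < e \<Longrightarrow> e < r1 \<Longrightarrow> Re (deriv (dseries \<psi>) (Complex 1 t + of_real e) / dseries \<psi> (Complex 1 t + of_real e)) \<ge> 1 / e - C1"
    by (rule log_deriv_near_point[OF holomorphic_dseries[OF norm_sum_char_le[OF q \<psi>]] op, of "Complex 1 t" 3])
      (use nz[OF \<psi>] zero in auto)
  obtain r2 C2 where 2: "r2 > 0"
    "\<And>e. 0 < e \<Longrightarrow> e < r2 \<Longrightarrow> Re (deriv (dseries ?\<phi>) (Complex 1 (2 * t) + of_real e) / dseries ?\<phi> (Complex 1 (2 * t) + of_real e))
       \<ge> (if dseries ?\<phi> (Complex 1 (2 * t)) = 0 then 1 / e else 0) - C2"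
    by (rule log_deriv_near_point[OF holomorphic_dseries[OF norm_sum_char_le[OF q \<phi>]] op, of "Complex 1 (2 * t)" 3])
      (use nz[OF \<phi>] in auto)
  have ld: "deriv (dseries \<theta>) s / dseries \<theta> s = - dseries (\<lambda>n. \<theta> n * mangoldt n) s"
    if \<theta>: "\<theta> \<in> nontrivial_characters q" and s: "Re s > 1" for \<theta> s
  proof -
    have mult: "\<theta> (m * n) = \<theta> m * \<theta> n" for m n
      using \<theta> dirichlet_character_mult by (auto simp: nontrivial_characters_def)
    have "dseries \<theta> s \<noteq> 0"
      using dseries_nonzero_Re_gt_1[of \<theta> s 3] mult norm_char_le_1[OF q \<theta>] s nz[OF \<theta>] by auto
    moreover have "deriv (dseries \<theta>) s = - (dseries \<theta> s * dseries (\<lambda>n. \<theta> n * mangoldt n) s)"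
      by (rule DERIV_imp_deriv, rule dseries_log_deriv) (use mult norm_char_le_1[OF q \<theta>] s in auto)
    ultimately show ?thesis by simp
  qed
  \<comment> \<open>The inequality will give 1 / e \<le> 4 C1 + C2, so any \<open>e\<close> below
    \<open>1 / K\<close> is contradictory.\<close>
  define K where "K = 4 * \<bar>C1\<bar> + \<bar>C2\<bar> + 1"
  define m where "m = min (min r1 r2) (1 / K)"
  define e where "e = m / 2"
  have K: "K > 0" by (simp add: K_def add_nonneg_pos)
  then have "m > 0" "m \<le> r1" "m \<le> r2" "m \<le> 1 / K"
    using 1(1) 2(1) by (auto simp: m_def)
  then have e: "e > 0" "e < r1" "e < r2" "e < 1 / K"
    unfolding e_def by linarith+
  have c1: "Complex 1 t + of_real e = Complex (1 + e) t" and c2: "Complex 1 (2 * t) + of_real e = Complex (1 + e) (2 * t)"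
    by (auto simp: complex_eq_iff)
  have "Re (dseries (\<lambda>n. \<psi> n * mangoldt n) (Complex (1 + e) t)) \<le> C1 - 1 / e"
    using 1(2)[OF e(1,2)] ld[OF \<psi>, of "Complex (1 + e) t"] e(1) unfolding c1 by simp
  moreover have "Re (dseries (\<lambda>n. ?\<phi> n * mangoldt n) (Complex (1 + e) (2 * t))) \<le> C2"
  proof -
    have "Re (deriv (dseries ?\<phi>) (Complex (1 + e) (2 * t)) / dseries ?\<phi> (Complex (1 + e) (2 * t))) \<ge> 0 - C2"
    proof -
      have "0 \<le> (if dseries ?\<phi> (Complex 1 (2 * t)) = 0 then 1 / e else 0)" using e(1) by simp
      then show ?thesis using 2(2)[OF e(1,3)] unfolding c2 by linarith
    qed
    then show ?thesis
      using ld[OF \<phi>, of "Complex (1 + e) (2 * t)"] e(1) by simp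
  qed
  moreover have "Re (dseries (\<lambda>n. mangoldt n) (of_real (1 + e))) \<le> 1 / e"
    using dseries_mangoldt_real_le[of "1 + e"] e(1) by simp
  moreover have "3 * Re (dseries (\<lambda>n. mangoldt n) (of_real (1 + e)))
     + 4 * Re (dseries (\<lambda>n. \<psi> n * mangoldt n) (Complex (1 + e) t))
     + Re (dseries (\<lambda>n. \<psi> n ^ 2 * mangoldt n) (Complex (1 + e) (2 * t))) \<ge> 0"
  proof (rule dseries_mangoldt_three_four_one)
    show "norm (\<psi> n) = 0 \<or> norm (\<psi> n) = 1" for n
      using norm_dirichlet_character[OF dc, of n] q prime_gt_0_nat by auto
  qed (use e dirichlet_character_mult[OF dc] in auto)
  ultimately have "1 / e \<le> 4 * C1 + C2" by linarith
  also have "\<dots> < K" unfolding K_def by linarith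
  also have "\<dots> < 1 / e"
    using e K by (simp add: field_simps)
  finally have "1 / e < 1 / e" .
  then show False by simp
qed

section \<open>Growth of holomorphic functions\<close>

text \<open>Borel-Caratheodory: h / (2 A - h) maps the disc into the unit disc and fixes the origin,
  so the Schwarz lemma applies to it.\<close>

lemma borel_caratheodory:
  fixes h :: "complex \<Rightarrow> complex"
  assumes h: "h holomorphic_on ball s R" "h s = 0" "\<And>z. z \<in> ball s R \<Longrightarrow> Re (h z) < A"
    and z: "norm (z - s) \<le> r" "r < R" and A: "A > 0"
  shows "norm (h z) \<le> 2 * A * r / (R - r)"
proof -
  have r: "0 \<le> r" "0 < R" using z norm_ge_zero[of "z - s"] by linarith+
  define \<phi> where "\<phi> = (\<lambda>w. h (s + of_real R * w) / (2 * of_real A - h (s + of_real R * w)))"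
  have mem: "s + of_real R * w \<in> ball s R" if "norm w < 1" for w
    using that r by (simp add: dist_norm norm_mult)
  have less: "norm (h x) < norm (2 * of_real A - h x)" if "x \<in> ball s R" for x
  proof (rule power2_less_imp_less)
    have "norm (2 * of_real A - h x) ^ 2 - norm (h x) ^ 2 = 4 * A * (A - Re (h x))"
      unfolding cmod_power2 by (simp add: power2_eq_square algebra_simps)
    also have "\<dots> > 0" using h(3)[OF that] A by simp
    finally show "norm (h x) ^ 2 < norm (2 * of_real A - h x) ^ 2" by simp
  qed simp
  then have nz: "2 * of_real A - h x \<noteq> 0" if "x \<in> ball s R" for x
    using that by fastforce
  have comp: "(\<lambda>w. h (s + of_real R * w)) holomorphic_on ball 0 1"
    by (rule holomorphic_on_compose_gen[OF _ h(1), unfolded o_def]) (use mem in \<open>auto intro!: holomorphic_intros\<close>)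
  define w where "w = (z - s) / of_real R"
  have w: "norm w < 1" "s + of_real R * w = z" "norm w \<le> r / R"
    using z r by (auto simp: w_def norm_divide field_simps)
  have "norm (\<phi> w) \<le> norm w"
  proof (rule Schwarz_Lemma(1))
    show "\<phi> holomorphic_on ball 0 1"
      unfolding \<phi>_def using nz mem by (intro holomorphic_intros comp) auto
    show "\<phi> 0 = 0" using h(2) by (simp add: \<phi>_def)
    show "norm (\<phi> x) < 1" if "norm x < 1" for x
      using less[OF mem[OF that]] by (simp add: \<phi>_def norm_divide divide_simps)
  qed (use w in auto)
  also note w(3)
  finally have \<phi>w: "norm (\<phi> w) \<le> r / R" .
  have rR: "r / R < 1" using z r by simp
  have zb: "z \<in> ball s R" using z by (simp add: dist_norm norm_minus_commute)
  have "h z = \<phi> w * (2 * of_real A - h z)"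
    using nz[OF zb] unfolding \<phi>_def w(2) by simp
  then have "norm (h z) \<le> r / R * (2 * A + norm (h z))"
  proof -
    have "norm (h z) = norm (\<phi> w) * norm (2 * of_real A - h z)"
      using \<open>h z = \<phi> w * _\<close> by (metis norm_mult)
    also have "\<dots> \<le> r / R * (norm (2 * complex_of_real A) + norm (h z))"
      using \<phi>w r by (intro mult_mono norm_triangle_ineq4) auto
    finally show ?thesis using A by (simp add: norm_mult)
  qed
  then show ?thesis
    using z r by (simp add: field_simps)
qed

text \<open>Borel-Caratheodory for a holomorphic logarithm of \<open>f\<close>, followed by Cauchy's
  inequality on a slightly smaller disc. The constant \<open>K\<close> precedes \<open>f\<close>,
  \<open>s\<close> and \<open>A\<close> because it is used for discs that move along the
  strip.\<close>

lemma log_deriv_bound: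
  assumes "0 < r" "r < (R::real)"
  obtains K where "K > 0"
    "\<And>(f::complex \<Rightarrow> complex) s A z. f holomorphic_on ball s R \<Longrightarrow> (\<And>z. z \<in> ball s R \<Longrightarrow> f z \<noteq> 0) \<Longrightarrow>
       (\<And>z. z \<in> ball s R \<Longrightarrow> norm (f z) < exp A * norm (f s)) \<Longrightarrow> A > 0 \<Longrightarrow> norm (z - s) \<le> r \<Longrightarrow>
       norm (deriv f z / f z) \<le> K * A"
proof -
  define d where "d = (R - r) / 2"
  have d: "d > 0" "r + d < R" using assms by (auto simp: d_def field_simps)
  define K where "K = 2 * (r + d) / (R - (r + d)) / d"
  show ?thesis
  proof (rule that[of K])
    show "K > 0" using d assms by (simp add: K_def)
    fix f :: "complex \<Rightarrow> complex" and s A z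
    assume f: "f holomorphic_on ball s R" "\<And>z. z \<in> ball s R \<Longrightarrow> f z \<noteq> 0"
      "\<And>z. z \<in> ball s R \<Longrightarrow> norm (f z) < exp A * norm (f s)" and A: "A > 0" and z: "norm (z - s) \<le> r"
    have sb: "s \<in> ball s R" using assms by simp
    obtain g where g: "g holomorphic_on ball s R" "\<And>x. x \<in> ball s R \<Longrightarrow> exp (g x) = f x"
      by (rule holomorphic_logarithm_exists[OF convex_ball open_ball f(1,2) sb]) auto
    define h where "h = (\<lambda>x. g x - g s)"
    have h: "h holomorphic_on ball s R"
      unfolding h_def by (intro holomorphic_intros g)
    have Re_h: "Re (h x) < A" if "x \<in> ball s R" for x
    proof -
      have "exp (Re (g x)) < exp A * exp (Re (g s))"
        using f(3)[OF that] g(2)[OF that] g(2)[OF sb] by (metis norm_exp_eq_Re)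
      then have "exp (Re (g x)) < exp (A + Re (g s))" by (simp only: exp_add)
      then show ?thesis by (simp add: h_def)
    qed
    have hb: "norm (h x) \<le> 2 * A * (r + d) / (R - (r + d))" if "norm (x - s) \<le> r + d" for x
      by (rule borel_caratheodory[OF h _ Re_h]) (use that d A in \<open>auto simp: h_def\<close>)
    have sub: "cball z d \<subseteq> ball s R"
    proof
      fix x assume "x \<in> cball z d"
      then have "norm (x - s) \<le> d + r"
        using z norm_triangle_ineq[of "x - z" "z - s"] by (simp add: dist_norm norm_minus_commute)
      then show "x \<in> ball s R" using d by (simp add: dist_norm norm_minus_commute)
    qed
    have "norm ((deriv ^^ 1) h z) \<le> fact 1 * (2 * A * (r + d) / (R - (r + d))) / d ^ 1"
    proof (rule Cauchy_inequality)
      show "h holomorphic_on ball z d"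
        using h sub holomorphic_on_subset ball_subset_cball by (metis subset_trans)
      show "continuous_on (cball z d) h"
        using h sub holomorphic_on_imp_continuous_on holomorphic_on_subset by blast
      show "norm (h x) \<le> 2 * A * (r + d) / (R - (r + d))" if "norm (z - x) = d" for x
      proof (rule hb)
        show "norm (x - s) \<le> r + d"
          using z that norm_triangle_ineq[of "x - z" "z - s"] by (simp add: norm_minus_commute)
      qed
    qed (use d in auto)
    then have "norm (deriv h z) \<le> K * A"
      by (simp add: K_def mult_ac)
    moreover have zb: "z \<in> ball s R" using subsetD[OF sub] d by (metis centre_in_cball less_imp_le)
    have "deriv f z = f z * deriv h z"
    proof -
      have "(h has_field_derivative deriv h z) (at z)"
        using h zb by (intro holomorphic_derivI) auto
      then have "(g has_field_derivative deriv h z) (at z)"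
        using DERIV_add[OF \<open>(h has_field_derivative deriv h z) (at z)\<close> DERIV_const[of "g s"]] by (simp add: h_def)
      then have "((\<lambda>x. exp (g x)) has_field_derivative exp (g z) * deriv h z) (at z)"
        by (rule DERIV_fun_exp)
      then have "(f has_field_derivative exp (g z) * deriv h z) (at z)"
        by (rule has_field_derivative_transform_within_open[of _ _ _ "ball s R"]) (use g zb in auto)
      then show ?thesis using g(2)[OF zb] by (simp add: DERIV_imp_deriv)
    qed
    ultimately show "norm (deriv f z / f z) \<le> K * A"
      using f(2)[OF zb] by simp
  qed
qed

text \<open>Integrates the logarithmic derivative along a segment. It carries bounds from one point
  to another, both for the L-series and for the Gamma function.\<close>

lemma norm_le_exp_log_deriv:
  fixes g :: "complex \<Rightarrow> complex"
  assumes S: "convex S" "open S" "g holomorphic_on S" "\<And>x. x \<in> S \<Longrightarrow> g x \<noteq> 0"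
    and wz: "w \<in> S" "z \<in> S" and b: "\<And>x. x \<in> closed_segment w z \<Longrightarrow> norm (deriv g x / g x) \<le> \<beta>"
  shows "norm (g z) \<le> norm (g w) * exp (\<beta> * norm (z - w))"
proof -
  obtain G where G: "G holomorphic_on S" "\<And>x. x \<in> S \<Longrightarrow> exp (G x) = g x"
    by (rule holomorphic_logarithm_exists[OF S wz(1)]) auto
  have seg: "closed_segment w z \<subseteq> S" using wz S by (simp add: closed_segment_subset)
  have dG: "(G has_field_derivative deriv g x / g x) (at x)" if "x \<in> S" for x
  proof -
    have G': "(G has_field_derivative deriv G x) (at x)"
      using G S that by (intro holomorphic_derivI) auto
    then have "((\<lambda>x. exp (G x)) has_field_derivative exp (G x) * deriv G x) (at x)"
      by (rule DERIV_fun_exp)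
    then have "(g has_field_derivative exp (G x) * deriv G x) (at x)"
      by (rule has_field_derivative_transform_within_open[of _ _ _ S]) (use G S that in auto)
    then have "deriv g x = g x * deriv G x"
      using G(2)[OF that] by (simp add: DERIV_imp_deriv)
    then show ?thesis using G' S(4)[OF that] by simp
  qed
  have "norm (G z - G w) \<le> \<beta> * norm (z - w)"
  proof (rule field_differentiable_bound[of "closed_segment w z" G])
    show "(G has_field_derivative deriv g x / g x) (at x within closed_segment w z)" if "x \<in> closed_segment w z" for x
      using dG seg that by (auto intro: has_field_derivative_at_within)
  qed (use b in auto)
  then have "Re (G z) \<le> Re (G w) + \<beta> * norm (z - w)"
    using complex_Re_le_cmod[of "G z - G w"] by simp
  then have "exp (Re (G z)) \<le> exp (Re (G w)) * exp (\<beta> * norm (z - w))"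
    by (simp flip: exp_add)
  then show ?thesis
    using G(2)[OF wz(1)] G(2)[OF wz(2)] by (metis norm_exp_eq_Re)
qed

text \<open>Multiplication by \<open>exp (- \<epsilon> s\<^sup>3\<^sup>/\<^sup>4)\<close> beats the assumed growth on the half-plane.\<close>

lemma phragmen_lindelof_half_plane:
  fixes g :: "complex \<Rightarrow> complex"
  assumes g: "g holomorphic_on {s. Re s > a'}" "a' < a" "0 < a"
    and bd: "\<And>s. Re s = a \<Longrightarrow> norm (g s) \<le> 1"
    and gr: "\<And>s. Re s \<ge> a \<Longrightarrow> norm (g s) \<le> exp (C * sqrt (1 + norm s))"
    and z: "Re z \<ge> a"
  shows "norm (g z) \<le> 1"
proof (cases "Re z = a")
  case False
  then have z: "Re z > a" using z by simp
  \<comment> \<open>For Re s > 0 the argument of s^(3/4) is at most 3 \<pi> / 8 in modulus, so its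
    real part is at least \<open>c\<close> times its modulus. The exponent 3/4 exceeds the growth
    order 1/2 and stays below 1.\<close>
  define c where "c = cos (3 / 8 * pi)"
  have c: "c > 0" unfolding c_def by (rule cos_gt_zero_pi) auto
  have main: "norm (g z) \<le> exp (\<epsilon> * norm z powr (3/4))" if \<epsilon>: "\<epsilon> > 0" for \<epsilon>
  proof -
    define k where "k = (\<lambda>s. g s * exp (- of_real \<epsilon> * s powr (3/4)))"
    have re_powr: "c * norm s powr (3/4) \<le> Re (s powr (3/4))" "Re (s powr (3/4)) \<le> norm s powr (3/4)" if "Re s > 0" for s :: complex
    proof -
      have s0: "s \<noteq> 0" using that by auto
      have "s powr (3/4) = of_real (norm s powr (3/4)) * cis (3/4 * Im (Ln s))"
      proof -
        have "(3/4) * Ln s = of_real (3/4 * ln (norm s)) + \<i> * of_real (3/4 * Im (Ln s))"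
          using s0 by (auto simp: complex_eq_iff)
        then have "s powr (3/4) = exp (of_real (3/4 * ln (norm s)) + \<i> * of_real (3/4 * Im (Ln s)))"
          unfolding powr_def using s0 by presburger
        also have "\<dots> = of_real (exp (3/4 * ln (norm s))) * cis (3/4 * Im (Ln s))"
          by (simp only: exp_add cis_conv_exp exp_of_real)
        also have "exp (3/4 * ln (norm s)) = norm s powr (3/4)"
          using s0 by (simp add: powr_def)
        finally show ?thesis .
      qed
      then have Re_eq: "Re (s powr (3/4)) = norm s powr (3/4) * cos (3/4 * Im (Ln s))"
        by simp
      have "\<bar>Im (Ln s)\<bar> < pi / 2"
        using that Re_Ln_pos_lt[OF s0] by simp
      then have "\<bar>3/4 * Im (Ln s)\<bar> \<le> 3/8 * pi" by (simp add: abs_mult)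
      then have "cos (3/8 * pi) \<le> cos \<bar>3/4 * Im (Ln s)\<bar>"
        by (intro cos_monotone_0_pi_le) auto
      then have "c \<le> cos (3/4 * Im (Ln s))"
        unfolding c_def cos_abs_real .
      then have "norm s powr (3/4) * c \<le> norm s powr (3/4) * cos (3/4 * Im (Ln s))"
        by (rule mult_left_mono) simp
      then show "c * norm s powr (3/4) \<le> Re (s powr (3/4))"
        unfolding Re_eq by (simp only: mult.commute)
      show "Re (s powr (3/4)) \<le> norm s powr (3/4)"
        unfolding Re_eq by (simp add: mult_left_le)
    qed
    have "eventually (\<lambda>r::real. C * sqrt (1 + r) - \<epsilon> * (c * r powr (3/4)) \<le> 0) at_top"
      using \<epsilon> c by real_asymp
    moreover have "eventually (\<lambda>r::real. r > norm z) at_top"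
      by (rule eventually_gt_at_top)
    ultimately have "eventually (\<lambda>r::real. C * sqrt (1 + r) - \<epsilon> * (c * r powr (3/4)) \<le> 0 \<and> r > norm z) at_top"
      by eventually_elim auto
    then obtain r where r: "C * sqrt (1 + r) - \<epsilon> * (c * r powr (3/4)) \<le> 0" "r > norm z"
      by (rule eventually_happens'[rotated, THEN exE]) auto
    define S where "S = {s. Re s > a} \<inter> ball 0 r"
    have opS: "open S" unfolding S_def by (intro open_Int open_halfspace_Re_gt open_ball)
    have clS: "closure S \<subseteq> {s. Re s \<ge> a} \<inter> cball 0 r"
    proof (rule closure_minimal)
      show "closed ({s. Re s \<ge> a} \<inter> cball 0 r)"
        by (intro closed_Int closed_halfspace_Re_ge closed_cball)
    qed (auto simp: S_def)
    have holk: "k holomorphic_on {s. Re s > max a' 0}"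
      unfolding k_def by (intro holomorphic_intros holomorphic_on_subset[OF g(1)]) (auto simp: complex_nonpos_Reals_iff)
    have "norm (k z) \<le> 1"
    proof (rule maximum_modulus_frontier[of k S])
      show "k holomorphic_on interior S"
        unfolding interior_open[OF opS] by (rule holomorphic_on_subset[OF holk]) (use g in \<open>auto simp: S_def\<close>)
      show "continuous_on (closure S) k"
        by (intro holomorphic_on_imp_continuous_on holomorphic_on_subset[OF holk]) (use clS g in force)
      show "bounded S" unfolding S_def by (intro bounded_Int) auto
      show "z \<in> S" using z r by (simp add: S_def)
      fix s assume "s \<in> frontier S"
      then have s: "s \<in> closure S" "s \<notin> S" using opS by (auto simp: frontier_def interior_open)
      then have s1: "Re s \<ge> a" "norm s \<le> r" using clS by auto
      have s2: "Re s = a \<or> norm s = r" using s(2) s1 by (auto simp: S_def)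
      have pos: "Re s > 0" using s1 g by simp
      have nk: "norm (k s) = norm (g s) * exp (- \<epsilon> * Re (s powr (3/4)))"
        by (simp add: k_def norm_mult)
      from s2 show "norm (k s) \<le> 1"
      proof
        assume "Re s = a"
        then have "norm (g s) \<le> 1" by (rule bd)
        moreover have "exp (- \<epsilon> * Re (s powr (3/4))) \<le> 1"
          using \<epsilon> c re_powr(1)[OF pos] by (auto intro!: mult_nonneg_nonneg order_trans[OF _ re_powr(1)[OF pos]])
        ultimately show ?thesis unfolding nk by (simp add: mult_le_one)
      next
        assume nr: "norm s = r"
        have "norm (k s) \<le> exp (C * sqrt (1 + norm s)) * exp (- \<epsilon> * (c * norm s powr (3/4)))"
          unfolding nk using gr[OF s1(1)] re_powr(1)[OF pos] \<epsilon> by (intro mult_mono) auto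
        also have "\<dots> = exp (C * sqrt (1 + r) - \<epsilon> * (c * r powr (3/4)))"
          unfolding nr by (simp flip: exp_add)
        also have "\<dots> \<le> 1" using r(1) by simp
        finally show ?thesis .
      qed
    qed
    then have "norm (g z) * exp (- \<epsilon> * Re (z powr (3/4))) \<le> 1"
      by (simp add: k_def norm_mult)
    then have "norm (g z) \<le> exp (\<epsilon> * Re (z powr (3/4)))"
      by (simp add: exp_minus field_simps)
    also have "\<dots> \<le> exp (\<epsilon> * norm z powr (3/4))"
      using \<epsilon> re_powr(2)[of z] z g by simp
    finally show ?thesis .
  qed
  have "((\<lambda>\<epsilon>. exp (\<epsilon> * norm z powr (3/4))) \<longlongrightarrow> exp (0 * norm z powr (3/4))) (at_right 0)"
    by (intro tendsto_intros)
  then have lim: "((\<lambda>\<epsilon>. exp (\<epsilon> * norm z powr (3/4))) \<longlongrightarrow> 1) (at_right 0)"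
    by simp
  show ?thesis
  proof (rule tendsto_lowerbound[OF lim])
    show "\<forall>\<^sub>F x in at_right 0. norm (g z) \<le> exp (x * norm z powr (3/4))"
      using eventually_at_right_less[of 0] by eventually_elim (rule main)
  qed simp
qed (rule bd)

text \<open>The order sqrt |z| exceeds the true logarithmic one, but it is admissible for
  Phragmen-Lindelof and integrable against the test function. It results from bounding the
  denominators |z + k| by a geometric mean, which leaves a series in k^(-3/2).\<close>

lemma Digamma_bound:
  assumes "x0 > 0"
  obtains C where "C > 0" "\<And>z::complex. Re z \<ge> x0 \<Longrightarrow> norm (Digamma z) \<le> C * sqrt (1 + norm z)"
proof -
  define h where "h = (\<lambda>k. (real k + x0) powr (- (3/2)))"
  define m where "m = max 1 x0"
  have m: "m \<ge> 1" "m \<ge> x0" by (auto simp: m_def)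
  have sh: "summable h"
  proof (rule summable_comparison_test_bigo)
    show "summable (\<lambda>k. norm (real k powr (- (3/2))))"
      by (simp add: summable_real_powr_iff)
    show "h \<in> O(\<lambda>k. real k powr (- (3/2)))"
      unfolding h_def using assms by real_asymp
  qed
  define M where "M = (1 + 1 / x0) * (1 + m)"
  have bound: "norm (Digamma z) \<le> (2 * M * suminf h + norm (euler_mascheroni :: complex)) * sqrt (1 + norm z)"
    if z: "Re z \<ge> x0" for z :: complex
  proof -
    have z0: "norm z > 0" "norm z \<ge> x0" using z assms complex_Re_le_cmod[of z] by linarith+
    let ?t = "\<lambda>k. inverse (of_nat (Suc k)) - inverse (z + of_nat k)"
    have t: "norm (?t k) \<le> (2 * M * sqrt (1 + norm z)) * h k" for k
    proof -
      define y where "y = real k + x0"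
      have y: "y > 0" using assms by (simp add: y_def)
      have n1: "norm (z + of_nat k) \<ge> y"
        using complex_Re_le_cmod[of "z + of_nat k"] z by (simp add: y_def)
      have n2: "norm (z + of_nat k) \<ge> norm z"
      proof (rule power2_le_imp_le)
        have "(Re z)\<^sup>2 \<le> (Re z + real k)\<^sup>2" using z assms by (intro power_mono) auto
        then show "(norm z)\<^sup>2 \<le> (norm (z + of_nat k))\<^sup>2" by (simp add: cmod_power2)
      qed simp
      have zk: "z + of_nat k \<noteq> 0" using n1 y by auto
      have "?t k = (z - 1) / (of_nat (Suc k) * (z + of_nat k))"
        using zk of_nat_neq_0[of k, where ?'a = complex] by (simp add: field_simps)
      then have "norm (?t k) = norm (z - 1) / (real (Suc k) * norm (z + of_nat k))"
        by (simp add: norm_divide norm_mult del: of_nat_Suc)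
      also have "\<dots> \<le> (norm z + 1) / ((y / (1 + m)) * (sqrt (norm z) * sqrt y))"
      proof (rule frac_le)
        show "norm (z - 1) \<le> norm z + 1" using norm_triangle_ineq4[of z 1] by simp
        \<comment> \<open>|z + k| dominates both |z| and \<open>y\<close>, hence also their
          geometric mean.\<close>
        have "sqrt (norm z) * sqrt y \<le> sqrt (norm (z + of_nat k)) * sqrt (norm (z + of_nat k))"
          using n1 n2 y by (intro mult_mono real_sqrt_le_mono) auto
        then have a: "sqrt (norm z) * sqrt y \<le> norm (z + of_nat k)" by simp
        have "0 \<le> m * real k" using m by (intro mult_nonneg_nonneg) auto
        moreover have "real (Suc k) * (1 + m) = real k + 1 + m * real k + m"
          by (simp add: algebra_simps)
        ultimately have "y \<le> real (Suc k) * (1 + m)"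
          unfolding y_def using m by linarith
        then have b: "y / (1 + m) \<le> real (Suc k)" using m by (simp add: field_simps)
        show "y / (1 + m) * (sqrt (norm z) * sqrt y) \<le> real (Suc k) * norm (z + of_nat k)"
          using a b y by (intro mult_mono) auto
        show "0 < y / (1 + m) * (sqrt (norm z) * sqrt y)" using y z0 m by simp
      qed simp
      also have "\<dots> = (norm z + 1) * (1 + m) / sqrt (norm z) * (1 / (y * sqrt y))"
        using y z0 m by (simp add: field_simps)
      also have "1 / (y * sqrt y) = h k"
      proof -
        have "y powr (3/2) = y powr 1 * y powr (1/2)" by (simp only: powr_add[symmetric]) simp
        then show ?thesis using y by (simp add: h_def y_def powr_minus_divide powr_half_sqrt)
      qed
      also have "(norm z + 1) * (1 + m) / sqrt (norm z) * h k \<le> (2 * M * sqrt (1 + norm z)) * h k"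
      proof (rule mult_right_mono)
        have "norm z + 1 \<le> norm z * (1 + 1 / x0)"
          using z0 assms by (simp add: field_simps)
        then have "(norm z + 1) * (1 + m) / sqrt (norm z) \<le> norm z * (1 + 1 / x0) * (1 + m) / sqrt (norm z)"
          using m by (intro divide_right_mono mult_right_mono) auto
        also have "\<dots> = M * (norm z / sqrt (norm z))"
          by (simp add: M_def)
        also have "norm z / sqrt (norm z) = sqrt (norm z)"
          by (rule real_div_sqrt) simp
        also have "M * sqrt (norm z) \<le> 2 * M * sqrt (1 + norm z)"
        proof -
          have "M \<ge> 0" using m assms by (simp add: M_def)
          then have "M * sqrt (norm z) \<le> M * sqrt (1 + norm z)" "0 \<le> M * sqrt (1 + norm z)"
            by (auto intro: mult_left_mono)
          then show ?thesis by linarith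
        qed
        finally show "(norm z + 1) * (1 + m) / sqrt (norm z) \<le> 2 * M * sqrt (1 + norm z)" .
      qed (simp add: h_def)
      finally show ?thesis .
    qed
    have "norm (\<Sum>k. ?t k) \<le> (\<Sum>k. (2 * M * sqrt (1 + norm z)) * h k)"
      by (rule norm_suminf_le[OF t]) (intro summable_mult sh)
    also have "\<dots> = 2 * M * sqrt (1 + norm z) * suminf h"
      by (rule suminf_mult[OF sh])
    finally have "norm (Digamma z) \<le> 2 * M * sqrt (1 + norm z) * suminf h + norm (euler_mascheroni :: complex) * 1"
      unfolding Digamma_def using norm_triangle_ineq4[of "suminf ?t" euler_mascheroni] by simp
    also have "\<dots> \<le> 2 * M * sqrt (1 + norm z) * suminf h + norm (euler_mascheroni :: complex) * sqrt (1 + norm z)"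
      by (intro add_left_mono mult_left_mono) auto
    finally show ?thesis by (simp add: algebra_simps)
  qed
  define C where "C = max 1 (2 * M * suminf h + norm (euler_mascheroni :: complex))"
  show ?thesis
  proof (rule that[of C])
    show "C > 0" by (simp add: C_def)
    fix z :: complex assume "Re z \<ge> x0"
    from bound[OF this] show "norm (Digamma z) \<le> C * sqrt (1 + norm z)"
      by (rule order_trans) (auto simp: C_def intro!: mult_right_mono)
  qed
qed

section \<open>Positivity of the logarithmic derivative to the right of the critical line\<close>

text \<open>Converts polynomial bounds into the growth type exp(C sqrt(1 + |s|)), in which all
  estimates for Phragmen-Lindelof are expressed.\<close>

lemma poly_le_exp_sqrt:
  fixes x :: real
  assumes "x \<ge> 0" "c \<ge> 1"
  shows "c * (1 + x) < exp ((ln c + 2) * sqrt (1 + x))"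
proof -
  define u where "u = sqrt (1 + x)"
  have u: "u \<ge> 1" "u\<^sup>2 = 1 + x" using assms by (auto simp: u_def)
  have "u < exp u" using exp_ge_add_one_self[of u] by linarith
  then have "u\<^sup>2 < (exp u)\<^sup>2" using u by (intro power_strict_mono) auto
  then have "u\<^sup>2 < exp (2 * u)" by (simp add: exp_double)
  then have "c * u\<^sup>2 < exp (ln c) * exp (2 * u)" using assms by simp
  also have "\<dots> = exp (ln c + 2 * u)" by (simp add: exp_add)
  also have "\<dots> \<le> exp ((ln c + 2) * u)"
    using u assms mult_left_mono[of 1 u "ln c"] by (simp add: algebra_simps)
  finally show ?thesis unfolding u(2) u_def[symmetric] .
qed

lemma sqrt_shift_le: "x \<ge> 0 \<Longrightarrow> k \<ge> 0 \<Longrightarrow> sqrt (1 + (x + k)) \<le> (1 + k) * sqrt (1 + (x::real))"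
proof -
  assume "x \<ge> 0" "k \<ge> 0"
  then have "1 + (x + k) \<le> (1 + k) * (1 + x)" by (simp add: algebra_simps)
  also have "\<dots> \<le> (1 + k)\<^sup>2 * (1 + x)"
    using \<open>x \<ge> 0\<close> \<open>k \<ge> 0\<close> self_le_power[of "1 + k" 2] by (intro mult_right_mono) auto
  finally show ?thesis
    using real_sqrt_le_mono[of "1 + (x + k)" "(1 + k)\<^sup>2 * (1 + x)"] \<open>k \<ge> 0\<close> by (simp add: real_sqrt_mult)
qed

lemma has_real_derivative_norm_square:
  fixes f :: "complex \<Rightarrow> complex"
  assumes "(f has_field_derivative D) (at s)"
  shows "((\<lambda>x. (norm (f (s + of_real x)))\<^sup>2) has_real_derivative 2 * Re (D * cnj (f s))) (at 0)"
proof -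
  have "((\<lambda>x. s + of_real x) has_vector_derivative 1) (at 0)"
    by (auto intro!: derivative_eq_intros)
  moreover have "(f has_field_derivative D) (at (s + of_real 0))"
    using assms by simp
  ultimately have "(f \<circ> (\<lambda>x. s + of_real x) has_vector_derivative (1 * D)) (at 0)"
    by (rule field_vector_diff_chain_at)
  then have 1: "((\<lambda>x. f (s + of_real x)) has_vector_derivative D) (at 0)"
    by (simp add: o_def)
  then have 2: "((\<lambda>x. cnj (f (s + of_real x))) has_vector_derivative cnj D) (at 0)"
    by (rule has_vector_derivative_cnj)
  have 3: "((\<lambda>x. f (s + of_real x) * cnj (f (s + of_real x))) has_vector_derivative
      (f s * cnj D + D * cnj (f s))) (at 0)"
    using has_vector_derivative_mult[OF 1 2] by simp
  have "((\<lambda>x. Re (f (s + of_real x) * cnj (f (s + of_real x)))) has_vector_derivative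
      Re (f s * cnj D + D * cnj (f s))) (at 0)"
    by (rule bounded_linear.has_vector_derivative[OF bounded_linear_Re 3])
  moreover have "Re (w * cnj w) = (norm w)\<^sup>2" for w
    by (simp add: complex_mult_cnj cmod_power2)
  moreover have "Re (f s * cnj D + D * cnj (f s)) = 2 * Re (D * cnj (f s))"
    by (simp add: algebra_simps)
  ultimately show ?thesis
    by (simp add: has_real_derivative_iff_has_vector_derivative)
qed

section \<open>Growth of the logarithmic derivative under the Riemann hypothesis for one
  character\<close>

context
  fixes q :: nat and \<psi> :: "nat \<Rightarrow> complex"
  assumes q: "prime q" and \<psi>: "\<psi> \<in> nontrivial_characters q"
    and nz: "\<And>s. Re s > 1/2 \<Longrightarrow> dseries \<psi> s \<noteq> 0"
begin

lemma char_multiplicative: "\<psi> (m * n) = \<psi> m * \<psi> n"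
  using \<psi> dirichlet_character_mult by (auto simp: nontrivial_characters_def)

lemma log_deriv_eq_mangoldt:
  assumes "Re s > 1"
  shows "deriv (dseries \<psi>) s / dseries \<psi> s = - dseries (\<lambda>n. \<psi> n * mangoldt n) s"
proof -
  have "deriv (dseries \<psi>) s = - (dseries \<psi> s * dseries (\<lambda>n. \<psi> n * mangoldt n) s)"
    by (rule DERIV_imp_deriv, rule dseries_log_deriv[OF char_multiplicative norm_char_le_1[OF q \<psi>] assms])
  then show ?thesis
    using nz[of s] assms by simp
qed

text \<open>For Re s \<le> 3 apply \<open>log_deriv_bound\<close> on a disc about 3 + i Im s, where
  the series is at least 1/2 in modulus; further to the right the series of L'/L is bounded.\<close>

lemma log_deriv_growth:
  assumes \<delta>: "0 < \<delta>" "\<delta> < 1/2"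
  obtains C where "C > 0"
    "\<And>s. Re s \<ge> 1/2 + \<delta> \<Longrightarrow> norm (deriv (dseries \<psi>) s / dseries \<psi> s) \<le> C * sqrt (1 + norm s)"
proof -
  have qp: "real q \<ge> 1" using q prime_ge_1_nat by simp
  \<comment> \<open>The radii are chosen so that the open disc stays in Re z > 1/2, where there are
    no zeros, while the inner one reaches the line Re s = 1/2 + \<delta>.\<close>
  obtain K where K: "K > 0"
    "\<And>(f::complex \<Rightarrow> complex) s A z. f holomorphic_on ball s (5/2 - \<delta>/2) \<Longrightarrow> (\<And>z. z \<in> ball s (5/2 - \<delta>/2) \<Longrightarrow> f z \<noteq> 0) \<Longrightarrow>
       (\<And>z. z \<in> ball s (5/2 - \<delta>/2) \<Longrightarrow> norm (f z) < exp A * norm (f s)) \<Longrightarrow> A > 0 \<Longrightarrow> norm (z - s) \<le> 5/2 - \<delta> \<Longrightarrow>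
       norm (deriv f z / f z) \<le> K * A"
    by (rule log_deriv_bound[of "5/2 - \<delta>" "5/2 - \<delta>/2"]) (use \<delta> in auto)
  define B where "B = ln (24 * real q) + 2"
  have B: "B > 0" using qp by (simp add: B_def add_nonneg_pos)
  define C3 where "C3 = (\<Sum>n. norm (\<psi> (Suc n) * mangoldt (Suc n)) * real (Suc n) powr (- 3))"
  have sub: "subpolynomial (\<lambda>n. \<psi> n * mangoldt n)"
    by (rule subpolynomial_mangoldt[OF char_multiplicative norm_char_le_1[OF q \<psi>]])
  have sum3: "summable (\<lambda>n. norm (\<psi> (Suc n) * mangoldt (Suc n)) * real (Suc n) powr (- 3))"
    by (rule subpolynomial_summable[OF sub]) simp
  have C3: "C3 \<ge> 0" unfolding C3_def by (rule suminf_nonneg[OF sum3]) simp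
  show ?thesis
  proof (rule that[of "K * B + C3"])
    show "K * B + C3 > 0" using K B C3 by (simp add: add_pos_nonneg)
    fix s :: complex assume s: "Re s \<ge> 1/2 + \<delta>"
    show "norm (deriv (dseries \<psi>) s / dseries \<psi> s) \<le> (K * B + C3) * sqrt (1 + norm s)"
    proof (cases "Re s \<le> 3")
      case True
      define s0 where "s0 = Complex 3 (Im s)"
      define A where "A = B * sqrt (1 + norm s)"
      have diff: "norm (s - s0) = 3 - Re s"
        using True by (simp add: s0_def norm_complex_def)
      have s0: "norm s0 \<le> norm s + 3"
        using norm_triangle_ineq[of s "s0 - s"] diff s \<delta> by (simp add: norm_minus_commute)
      have Re_ball: "Re z > 1/2" if "z \<in> ball s0 (5/2 - \<delta>/2)" for z
      proof -
        have "3 - Re z \<le> norm (s0 - z)" using complex_Re_le_cmod[of "s0 - z"] by (simp add: s0_def)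
        also have "\<dots> < 5/2 - \<delta>/2" using that by (simp add: dist_norm)
        finally show ?thesis using \<delta> by simp
      qed
      have "norm (deriv (dseries \<psi>) s / dseries \<psi> s) \<le> K * A"
      proof (rule K(2))
        show "dseries \<psi> holomorphic_on ball s0 (5/2 - \<delta>/2)"
          using Re_ball by (intro holomorphic_on_subset[OF holomorphic_dseries[OF norm_sum_char_le[OF q \<psi>]]]) fastforce
        show "dseries \<psi> z \<noteq> 0" if "z \<in> ball s0 (5/2 - \<delta>/2)" for z
          using nz Re_ball that by auto
        show "norm (dseries \<psi> z) < exp A * norm (dseries \<psi> s0)" if z: "z \<in> ball s0 (5/2 - \<delta>/2)" for z
        proof -
          have Rz: "Re z > 1/2" using Re_ball[OF z] .
          have "norm z \<le> norm s0 + 5/2"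
            using z norm_triangle_ineq2[of z s0] \<delta> by (simp add: dist_norm norm_minus_commute)
          then have nz6: "norm z \<le> 6 * (1 + norm s)"
            using s0 by (simp add: algebra_simps) (use norm_ge_zero[of s] in linarith)
          have "norm (dseries \<psi> z) \<le> real q * norm z / Re z"
            by (rule norm_dseries_le[OF norm_sum_char_le[OF q \<psi>]]) (use Rz in auto)
          also have "\<dots> \<le> real q * norm z / (1/2)"
            using Rz by (intro divide_left_mono) auto
          also have "\<dots> \<le> 2 * real q * (6 * (1 + norm s))"
            using nz6 qp by (simp add: mult_left_mono)
          also have "\<dots> = (24 * real q * (1 + norm s)) * (1/2)" by simp
          also have "\<dots> < exp ((ln (24 * real q) + 2) * sqrt (1 + norm s)) * (1/2)"
            using poly_le_exp_sqrt[of "norm s" "24 * real q"] qp by simp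
          also have "\<dots> \<le> exp A * norm (dseries \<psi> s0)"
            unfolding A_def B_def
            using norm_dseries_ge_half[of \<psi> s0, OF norm_char_le_1[OF q \<psi>] char_Suc_0[OF q \<psi>]]
            by (intro mult_mono) (auto simp: s0_def)
          finally show ?thesis .
        qed
        show "A > 0" using B by (simp add: A_def add_pos_nonneg)
        show "norm (s - s0) \<le> 5/2 - \<delta>" using diff s by simp
      qed
      also have "\<dots> \<le> (K * B + C3) * sqrt (1 + norm s)"
        using C3 by (simp add: A_def distrib_right)
      finally show ?thesis .
    next
      case False
      then have Rs: "Re s > 1" by simp
      have "norm (deriv (dseries \<psi>) s / dseries \<psi> s) = norm (dseries (\<lambda>n. \<psi> n * mangoldt n) s)"
        unfolding log_deriv_eq_mangoldt[OF Rs] by simp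
      also have "\<dots> \<le> (\<Sum>n. norm (\<psi> (Suc n) * mangoldt (Suc n)) * real (Suc n) powr (- Re s))"
        by (rule subpolynomial_sums(3)[OF sub Rs])
      also have "\<dots> \<le> C3"
        unfolding C3_def
        using False by (intro suminf_le mult_left_mono powr_mono subpolynomial_summable[OF sub Rs] sum3) auto
      also have "\<dots> \<le> C3 * sqrt (1 + norm s)"
        using C3 mult_left_mono[of 1 "sqrt (1 + norm s)" C3] by simp
      also have "\<dots> \<le> (K * B + C3) * sqrt (1 + norm s)"
        using K B by (intro mult_right_mono) auto
      finally show ?thesis .
    qed
  qed
qed

text \<open>Integration of L'/L from \<open>s\<close> to \<open>s + 3\<close>, where the modulus is
  at least 1/2. It controls the denominator of the quotient to which Phragmen-Lindelof is applied.
  The factor 12 is the length 3 times the constant 4 from \<open>sqrt_shift_le\<close>.\<close>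

lemma dseries_lower_bound:
  assumes \<delta>: "0 < \<delta>" "\<delta> < 1/2"
  obtains C where "C > 0" "\<And>s. Re s \<ge> 1/2 + \<delta> \<Longrightarrow> 1 / norm (dseries \<psi> s) \<le> 2 * exp (C * sqrt (1 + norm s))"
proof -
  obtain C where C: "C > 0"
    "\<And>s. Re s \<ge> 1/2 + \<delta> \<Longrightarrow> norm (deriv (dseries \<psi>) s / dseries \<psi> s) \<le> C * sqrt (1 + norm s)"
    using log_deriv_growth[OF \<delta>] by blast
  show ?thesis
  proof (rule that[of "12 * C"])
    show "12 * C > 0" using C by simp
    fix s :: complex assume s: "Re s \<ge> 1/2 + \<delta>"
    have half: "1/2 \<le> norm (dseries \<psi> (s + 3))"
      using s \<delta> by (intro norm_dseries_ge_half norm_char_le_1[OF q \<psi>] char_Suc_0[OF q \<psi>]) auto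
    also have "\<dots> \<le> norm (dseries \<psi> s) * exp (4 * C * sqrt (1 + norm s) * norm ((s + 3) - s))"
    proof (rule norm_le_exp_log_deriv[of "{s. Re s > 1/2}"])
      show "convex {s. 1/2 < Re s}" "open {s. 1/2 < Re s}"
        by (rule convex_halfspace_Re_gt, rule open_halfspace_Re_gt)
      show "dseries \<psi> holomorphic_on {s. 1/2 < Re s}"
        by (rule holomorphic_on_subset[OF holomorphic_dseries[OF norm_sum_char_le[OF q \<psi>]]]) auto
      fix x assume "x \<in> closed_segment s (s + 3)"
      then obtain v where v: "0 \<le> v" "v \<le> 1" "x = s + of_real (3 * v)"
        by (auto simp: closed_segment_def scaleR_conv_of_real algebra_simps)
      have "norm x \<le> norm s + 3"
        unfolding v(3) using v norm_triangle_ineq[of s "of_real (3 * v)"] by simp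
      have "norm (deriv (dseries \<psi>) x / dseries \<psi> x) \<le> C * sqrt (1 + norm x)"
        using s v by (intro C) auto
      also have "\<dots> \<le> C * sqrt (1 + (norm s + 3))"
        using C \<open>norm x \<le> _\<close> by (intro mult_left_mono) auto
      also have "\<dots> \<le> C * ((1 + 3) * sqrt (1 + norm s))"
        using C by (intro mult_left_mono sqrt_shift_le) auto
      finally show "norm (deriv (dseries \<psi>) x / dseries \<psi> x) \<le> 4 * C * sqrt (1 + norm s)" by simp
    qed (use nz s \<delta> in auto)
    finally have "1/2 \<le> norm (dseries \<psi> s) * exp (12 * C * sqrt (1 + norm s))"
      by (simp add: mult_ac)
    moreover have "norm (dseries \<psi> s) > 0" using nz s \<delta> by auto
    ultimately show "1 / norm (dseries \<psi> s) \<le> 2 * exp (12 * C * sqrt (1 + norm s))"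
      by (simp add: field_simps)
  qed
qed

end

text \<open>The logarithmic derivative of \<open>completed_L\<close>, kept as a sum: the first term
  yields the main term of size log q, the second is estimated, and the third is integrated
  exactly.\<close>

definition xi_log_deriv :: "nat \<Rightarrow> (nat \<Rightarrow> complex) \<Rightarrow> complex \<Rightarrow> complex" where
  "xi_log_deriv q \<psi> s = of_real (ln (real q / pi) / 2) + Digamma (s / 2) / 2 + deriv (dseries \<psi>) s / dseries \<psi> s"

section \<open>The completed L-function near the critical line\<close>

context
  fixes q :: nat and \<psi> :: "nat \<Rightarrow> complex"
  assumes q: "prime q" and \<psi>: "\<psi> \<in> nontrivial_characters q" and even: "\<psi> (q - 1) = 1"
    and nz: "\<And>s. Re s > 1/2 \<Longrightarrow> dseries \<psi> s \<noteq> 0"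
begin

lemma q_over_pi_pos: "real q / pi > 0"
  using q prime_gt_0_nat by auto

lemma completed_L_has_field_derivative:
  assumes "Re s > 0" "dseries \<psi> s \<noteq> 0"
  shows "(completed_L q \<psi> has_field_derivative completed_L q \<psi> s * xi_log_deriv q \<psi> s) (at s)"
proof -
  define c where "c = complex_of_real (real q / pi)"
  have c0: "c \<noteq> 0" unfolding c_def of_real_eq_0_iff using q_over_pi_pos by linarith
  have Lnc: "Ln c = of_real (ln (real q / pi))"
    using q_over_pi_pos Ln_of_real[of "real q / pi"] by (simp add: c_def)
  have half: "((\<lambda>s. s / 2) has_field_derivative 1 / 2) (at s)"
    by (auto intro!: derivative_eq_intros)
  have 1: "((\<lambda>s. c powr (s / 2)) has_field_derivative Ln c * c powr (s / 2) * (1 / 2)) (at s)"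
    by (rule DERIV_chain2[OF has_field_derivative_powr_right[OF c0] half])
  have 2: "((\<lambda>s. Gamma (s / 2)) has_field_derivative Gamma (s / 2) * Digamma (s / 2) * (1 / 2)) (at s)"
    by (rule DERIV_chain2[OF has_field_derivative_Gamma half]) (rule half_not_nonpos_Ints[OF assms(1)])
  have 3: "(dseries \<psi> has_field_derivative deriv (dseries \<psi>) s) (at s)"
    using holomorphic_derivI[OF holomorphic_dseries[OF norm_sum_char_le[OF q \<psi>]] open_halfspace_Re_gt] assms(1) by simp
  have "((\<lambda>s. c powr (s / 2) * Gamma (s / 2) * dseries \<psi> s) has_field_derivative
     (Ln c * c powr (s / 2) * (1 / 2) * Gamma (s / 2) + Gamma (s / 2) * Digamma (s / 2) * (1 / 2) * c powr (s / 2)) * dseries \<psi> s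
      + deriv (dseries \<psi>) s * (c powr (s / 2) * Gamma (s / 2))) (at s)"
    by (rule DERIV_mult[OF DERIV_mult[OF 1 2] 3])
  moreover have "(Ln c * c powr (s / 2) * (1 / 2) * Gamma (s / 2) + Gamma (s / 2) * Digamma (s / 2) * (1 / 2) * c powr (s / 2)) * dseries \<psi> s
      + deriv (dseries \<psi>) s * (c powr (s / 2) * Gamma (s / 2)) = completed_L q \<psi> s * xi_log_deriv q \<psi> s"
  proof -
    have l: "complex_of_real (ln (real q / pi) / 2) = Ln c / 2"
      by (simp add: Lnc)
    have "(l * B * (1 / 2) * Gm + Gm * P * (1 / 2) * B) * L + D * (B * Gm) = B * Gm * L * (l / 2 + P / 2 + D / L)"
      if "L \<noteq> 0" for l B Gm P L D :: complex
      using that by (simp add: field_simps)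
    from this[OF assms(2)] show ?thesis
      unfolding completed_L_def xi_log_deriv_def c_def[symmetric] l .
  qed
  ultimately show ?thesis
    by (simp add: completed_L_def[abs_def] c_def)
qed

text \<open>On the line \<open>Re z = 1/2 + \<delta>\<close> the points \<open>z - 2 \<delta>\<close> and \<open>1 - cnj z\<close> agree, so by the functional
  equation the quotient of the two sides has modulus 1 there; Phragmen-Lindelof extends the bound
  to the half-plane.\<close>

lemma norm_completed_L_shift_le:
  assumes \<delta>: "0 < \<delta>" "\<delta> < 1/4" and z: "Re z \<ge> 1/2 + \<delta>"
  shows "norm (completed_L q \<psi> (z - of_real (2 * \<delta>))) \<le> norm (completed_L q \<psi> z)"
proof -
  define G where "G = (\<lambda>s. completed_L q \<psi> (s - of_real (2 * \<delta>)) / completed_L q \<psi> s)"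
  have \<xi>0: "completed_L q \<psi> s \<noteq> 0" if "Re s > 1/2" for s
    using completed_L_eq_0_iff[OF q \<psi>, of s] nz[OF that] that by auto
  obtain C1 where C1: "C1 > 0" "\<And>s. Re s \<ge> 1/2 + \<delta> \<Longrightarrow> 1 / norm (dseries \<psi> s) \<le> 2 * exp (C1 * sqrt (1 + norm s))"
    using dseries_lower_bound[OF q \<psi> nz \<delta>(1)] \<delta> by auto
  obtain C2 where C2: "C2 > 0" "\<And>z::complex. Re z \<ge> 1/8 \<Longrightarrow> norm (Digamma z) \<le> C2 * sqrt (1 + norm z)"
    by (rule Digamma_bound[of "1/8"]) auto
  define K where "K = (real q / pi) powr (- \<delta>) * (8 * real q)"
  have K: "K > 0" using q_over_pi_pos q prime_gt_0_nat[of q] by (simp add: K_def)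
  define C where "C = 2 * C2 + (ln (max 1 K) + 2) + C1"
  have "norm (G z) \<le> 1"
  proof (rule phragmen_lindelof_half_plane[of G "1/2" "1/2 + \<delta>" C])
    have "(\<lambda>s. completed_L q \<psi> (s - of_real (2 * \<delta>))) holomorphic_on {s. 1/2 < Re s}"
      by (rule holomorphic_on_compose_gen[OF _ holomorphic_completed_L[OF q \<psi>], unfolded o_def])
        (use \<delta> in \<open>auto intro!: holomorphic_intros\<close>)
    moreover have "completed_L q \<psi> holomorphic_on {s. 1/2 < Re s}"
      by (rule holomorphic_on_subset[OF holomorphic_completed_L[OF q \<psi>]]) auto
    ultimately show "G holomorphic_on {s. 1/2 < Re s}"
      unfolding G_def using \<xi>0 by (intro holomorphic_on_divide) auto
    show "norm (G s) \<le> 1" if "Re s = 1/2 + \<delta>" for s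
    proof -
      have "1 - cnj s = s - of_real (2 * \<delta>)"
        using that by (simp add: complex_eq_iff)
      then have "norm (completed_L q \<psi> (s - of_real (2 * \<delta>))) = norm (completed_L q \<psi> s)"
        using norm_completed_L_reflect[OF q \<psi> even, of s] that \<delta> by simp
      then show ?thesis by (simp add: G_def norm_divide)
    qed
    fix s assume s: "1/2 + \<delta> \<le> Re s"
    \<comment> \<open>The two Gamma values are compared by integrating Digamma over a segment of
      length \<delta>, along which the real part stays at least 1/8.\<close>
    have Gam: "norm (Gamma ((s - of_real (2 * \<delta>)) / 2)) \<le> norm (Gamma (s / 2)) * exp (2 * C2 * sqrt (1 + norm s))"
    proof -
      have "norm (Gamma ((s - of_real (2 * \<delta>)) / 2)) \<le> norm (Gamma (s / 2)) *
          exp (2 * C2 * sqrt (1 + norm s) * norm ((s - of_real (2 * \<delta>)) / 2 - s / 2))"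
      proof (rule norm_le_exp_log_deriv[of "{s. Re s > 0}"])
        have pos: "x \<notin> \<int>\<^sub>\<le>\<^sub>0" if "Re x > 0" for x :: complex
          using half_not_nonpos_Ints[of "2 * x"] that by simp
        then show "Gamma holomorphic_on {s::complex. 0 < Re s}"
          by (intro holomorphic_intros) auto
        show "Gamma x \<noteq> 0" if "x \<in> {s::complex. 0 < Re s}" for x
          using pos[of x] that by (simp add: Gamma_eq_zero_iff)
        fix x assume "x \<in> closed_segment (s / 2) ((s - of_real (2 * \<delta>)) / 2)"
        then obtain v where v: "0 \<le> v" "v \<le> 1" "x = s / 2 - of_real (v * \<delta>)"
          by (auto simp: closed_segment_def scaleR_conv_of_real algebra_simps diff_divide_distrib add_divide_distrib)
        have "v * \<delta> \<le> \<delta>" using v \<delta> by (simp add: mult_left_le_one_le)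
        moreover have "Re x = Re s / 2 - v * \<delta>" unfolding v(3) by simp
        ultimately have Rx: "Re x \<ge> 1/8" using s \<delta> by linarith
        have "norm x \<le> norm s / 2 + v * \<delta>"
          unfolding v(3) using norm_triangle_ineq4[of "s / 2" "of_real (v * \<delta>)"] v \<delta> by (simp add: norm_divide norm_mult)
        also have "\<dots> \<le> norm s + 1" using \<open>v * \<delta> \<le> \<delta>\<close> \<delta> norm_ge_zero[of s] by linarith
        finally have nx: "norm x \<le> norm s + 1" .
        have "deriv Gamma x / Gamma x = Digamma x"
        proof -
          have "(Gamma has_field_derivative Gamma x * Digamma x) (at x)"
            using pos[of x] Rx by (intro has_field_derivative_Gamma) auto
          then show ?thesis
            using pos[of x] Rx by (simp add: DERIV_imp_deriv Gamma_eq_zero_iff)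
        qed
        then have "norm (deriv Gamma x / Gamma x) \<le> C2 * sqrt (1 + norm x)"
          using C2(2)[OF Rx] by simp
        also have "\<dots> \<le> C2 * sqrt (1 + (norm s + 1))"
          using C2 nx by (intro mult_left_mono) auto
        also have "\<dots> \<le> C2 * ((1 + 1) * sqrt (1 + norm s))"
          using C2 by (intro mult_left_mono sqrt_shift_le) auto
        finally show "norm (deriv Gamma x / Gamma x) \<le> 2 * C2 * sqrt (1 + norm s)" by simp
      qed (use s \<delta> in \<open>auto simp: convex_halfspace_Re_gt open_halfspace_Re_gt\<close>)
      also have "norm ((s - of_real (2 * \<delta>)) / 2 - s / 2) \<le> 1"
        using \<delta> by (simp add: diff_divide_distrib)
      finally show ?thesis
        using C2 by (simp add: mult_left_le mult_left_mono)
    qed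
    have Lb: "norm (dseries \<psi> (s - of_real (2 * \<delta>))) \<le> 4 * real q * (1 + norm s)"
    proof -
      have "norm (dseries \<psi> (s - of_real (2 * \<delta>))) \<le> real q * norm (s - of_real (2 * \<delta>)) / Re (s - of_real (2 * \<delta>))"
        by (rule norm_dseries_le[OF norm_sum_char_le[OF q \<psi>]]) (use s \<delta> in auto)
      also have "\<dots> \<le> real q * (norm s + 1) / (1/4)"
        using s \<delta> norm_triangle_ineq4[of s "of_real (2 * \<delta>)"] by (intro frac_le mult_left_mono mult_nonneg_nonneg) auto
      finally show ?thesis by (simp add: algebra_simps)
    qed
    have Rs: "Re s > 0" using s \<delta> by simp
    have pw: "norm (complex_of_real (real q / pi) powr ((s - of_real (2 * \<delta>)) / 2)) = (real q / pi) powr (- \<delta>) * norm (complex_of_real (real q / pi) powr (s / 2))"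
    proof -
      have np: "norm (complex_of_real r powr w) = r powr Re w" if "r > 0" for r w
        using that by (simp add: norm_powr_real_powr)
      show ?thesis
        unfolding np[OF q_over_pi_pos] powr_add[symmetric] by (simp add: diff_divide_distrib)
    qed
    define X where "X = norm (complex_of_real (real q / pi) powr (s / 2)) * norm (Gamma (s / 2))"
    have X: "X > 0"
    proof -
      have "complex_of_real (real q / pi) \<noteq> 0"
        unfolding of_real_eq_0_iff using q_over_pi_pos by linarith
      then show ?thesis
        using half_not_nonpos_Ints[OF Rs] by (simp add: X_def Gamma_eq_zero_iff del: of_real_divide)
    qed
    have "norm (completed_L q \<psi> (s - of_real (2 * \<delta>))) \<le>
       (real q / pi) powr (- \<delta>) * norm (complex_of_real (real q / pi) powr (s / 2)) * (norm (Gamma (s / 2)) * exp (2 * C2 * sqrt (1 + norm s))) * (4 * real q * (1 + norm s))"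
      unfolding completed_L_def norm_mult pw using Gam Lb by (intro mult_mono) auto
    also have "\<dots> = X * ((real q / pi) powr (- \<delta>) * (4 * real q) * (1 + norm s) * exp (2 * C2 * sqrt (1 + norm s)))"
      by (simp add: X_def)
    finally have num: "norm (completed_L q \<psi> (s - of_real (2 * \<delta>))) \<le> X * ((real q / pi) powr (- \<delta>) * (4 * real q) * (1 + norm s) * exp (2 * C2 * sqrt (1 + norm s)))" .
    have "norm (G s) = norm (completed_L q \<psi> (s - of_real (2 * \<delta>))) * (1 / norm (dseries \<psi> s)) / X"
      by (simp add: G_def completed_L_def norm_divide norm_mult X_def)
    also have "\<dots> \<le> X * ((real q / pi) powr (- \<delta>) * (4 * real q) * (1 + norm s) * exp (2 * C2 * sqrt (1 + norm s))) * (2 * exp (C1 * sqrt (1 + norm s))) / X"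
      using num C1(2)[OF s] X by (intro divide_right_mono mult_mono) auto
    also have "\<dots> = K * (1 + norm s) * exp (2 * C2 * sqrt (1 + norm s)) * exp (C1 * sqrt (1 + norm s))"
      using X by (simp add: K_def)
    also have "K * (1 + norm s) \<le> max 1 K * (1 + norm s)"
      by (intro mult_right_mono) auto
    also have "\<dots> \<le> exp ((ln (max 1 K) + 2) * sqrt (1 + norm s))"
      using poly_le_exp_sqrt[of "norm s" "max 1 K"] by simp
    finally have "norm (G s) \<le> exp ((ln (max 1 K) + 2) * sqrt (1 + norm s)) * exp (2 * C2 * sqrt (1 + norm s)) * exp (C1 * sqrt (1 + norm s))"
      by (simp add: mult_right_mono)
    also have "\<dots> = exp (C * sqrt (1 + norm s))"
      by (simp add: C_def algebra_simps flip: exp_add)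
    finally show "norm (G s) \<le> exp (C * sqrt (1 + norm s))" .
  qed (use \<delta> z in auto)
  then show ?thesis
    using \<xi>0[of z] z \<delta> by (simp add: G_def norm_divide divide_le_eq_1)
qed

text \<open>Reflection in the critical line sends s - h to s + h - 2 \<delta>, so the shift
  inequality at s + h says that |\<xi>(s - h)| \<le> |\<xi>(s + h)|. Hence |\<xi>|^2 has nonnegative
  horizontal derivative at \<open>s\<close>, and this derivative is 2 |\<xi>|^2
  Re(\<xi>'/\<xi>).\<close>

lemma Re_xi_log_deriv_nonneg:
  assumes \<delta>: "0 < \<delta>" "\<delta> < 1/4" and s: "Re s = 1/2 + \<delta>"
  shows "Re (xi_log_deriv q \<psi> s) \<ge> 0"
proof (rule ccontr)
  assume neg: "\<not> ?thesis"
  define \<xi> where "\<xi> = completed_L q \<psi>"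
  define N where "N = (\<lambda>x. (norm (\<xi> (s + of_real x)))\<^sup>2)"
  define M where "M = (norm (\<xi> s))\<^sup>2"
  define D where "D = 2 * Re (\<xi> s * xi_log_deriv q \<psi> s * cnj (\<xi> s))"
  have L0: "dseries \<psi> s \<noteq> 0" using nz[of s] s \<delta> by simp
  have \<xi>0: "\<xi> s \<noteq> 0" using completed_L_eq_0_iff[OF q \<psi>, of s] L0 s \<delta> by (simp add: \<xi>_def)
  have "(N has_real_derivative D) (at 0)"
    unfolding N_def D_def \<xi>_def
    by (intro has_real_derivative_norm_square completed_L_has_field_derivative) (use L0 s \<delta> in auto)
  moreover have "((\<lambda>x. N (- x)) has_real_derivative D * (- 1)) (at 0)"
    by (rule DERIV_chain2[of N]) (use calculation in \<open>auto intro!: derivative_eq_intros\<close>)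
  ultimately have "((\<lambda>x. N x - N (- x)) has_real_derivative D - D * (- 1)) (at 0)"
    by (rule DERIV_diff)
  moreover have "D - D * (- 1) < 0"
  proof -
    have "\<xi> s * xi_log_deriv q \<psi> s * cnj (\<xi> s) = (\<xi> s * cnj (\<xi> s)) * xi_log_deriv q \<psi> s"
      by (simp only: mult_ac)
    also have "\<xi> s * cnj (\<xi> s) = of_real M"
      unfolding M_def by (rule complex_norm_square[symmetric])
    finally have e: "\<xi> s * xi_log_deriv q \<psi> s * cnj (\<xi> s) = of_real M * xi_log_deriv q \<psi> s" .
    have D_eq: "D = 2 * M * Re (xi_log_deriv q \<psi> s)"
      unfolding D_def e by simp
    moreover have "M * Re (xi_log_deriv q \<psi> s) < 0"
      using neg \<xi>0 by (intro mult_pos_neg) (auto simp: M_def)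
    ultimately show ?thesis by simp
  qed
  ultimately obtain d where d: "d > 0" "\<And>h. 0 < h \<Longrightarrow> h < d \<Longrightarrow> N (0 + h) - N (- (0 + h)) < N 0 - N (- 0)"
    using DERIV_neg_dec_right[of "\<lambda>x. N x - N (- x)" _ 0] by blast
  define h where "h = min (d / 2) (1/8)"
  have h: "0 < h" "h < d" "h \<le> 1/8" using d(1) by (auto simp: h_def)
  have less: "N h < N (- h)" using d(2)[OF h(1,2)] by simp
  have e: "1 - cnj (s - of_real h) = (s + of_real h) - of_real (2 * \<delta>)"
    using s by (simp add: complex_eq_iff)
  have "norm (\<xi> (s - of_real h)) = norm (\<xi> ((s + of_real h) - of_real (2 * \<delta>)))"
    using norm_completed_L_reflect[OF q \<psi> even, of "s - of_real h", unfolded e] s \<delta> h unfolding \<xi>_def by simp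
  also have "\<dots> \<le> norm (\<xi> (s + of_real h))"
    unfolding \<xi>_def using s \<delta> h by (intro norm_completed_L_shift_le) auto
  finally have "N (- h) \<le> N h"
    unfolding N_def by (intro power_mono) auto
  with less show False by simp
qed

text \<open>On the critical line |\<xi>|^2 is an even function of the horizontal displacement, so
  its derivative vanishes.\<close>

lemma Re_xi_log_deriv_critical:
  assumes s: "Re s = 1/2" and L0: "dseries \<psi> s \<noteq> 0"
  shows "Re (xi_log_deriv q \<psi> s) = 0"
proof -
  define \<xi> where "\<xi> = completed_L q \<psi>"
  define N where "N = (\<lambda>x. (norm (\<xi> (s + of_real x)))\<^sup>2)"
  define M where "M = (norm (\<xi> s))\<^sup>2"
  define D where "D = 2 * Re (\<xi> s * xi_log_deriv q \<psi> s * cnj (\<xi> s))"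
  have \<xi>0: "\<xi> s \<noteq> 0" using completed_L_eq_0_iff[OF q \<psi>, of s] L0 s by (simp add: \<xi>_def)
  have 1: "(N has_real_derivative D) (at 0)"
    unfolding N_def D_def \<xi>_def
    by (intro has_real_derivative_norm_square completed_L_has_field_derivative) (use L0 s in auto)
  have 2: "((\<lambda>x. N (- x)) has_real_derivative D * (- 1)) (at 0)"
    by (rule DERIV_chain2[of N]) (use 1 in \<open>auto intro!: derivative_eq_intros\<close>)
  have eq: "N (- x) = N x" if "x \<in> {-1/4<..<1/4}" for x
  proof -
    have e: "1 - cnj (s + of_real x) = s - of_real x"
      using s by (simp add: complex_eq_iff)
    have "norm (\<xi> (s - of_real x)) = norm (\<xi> (s + of_real x))"
      using norm_completed_L_reflect[OF q \<psi> even, of "s + of_real x", unfolded e] s that unfolding \<xi>_def by simp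
    then show ?thesis by (simp add: N_def)
  qed
  have "(N has_real_derivative D * (- 1)) (at 0)"
    by (rule has_field_derivative_transform_within_open[OF 2, of "{-1/4<..<1/4}"]) (use eq in auto)
  then have "D = D * (- 1)"
    using 1 DERIV_unique by blast
  then have "D = 0" by simp
  have "\<xi> s * xi_log_deriv q \<psi> s * cnj (\<xi> s) = (\<xi> s * cnj (\<xi> s)) * xi_log_deriv q \<psi> s"
    by (simp only: mult_ac)
  also have "\<xi> s * cnj (\<xi> s) = of_real M"
    unfolding M_def by (rule complex_norm_square[symmetric])
  finally have e: "\<xi> s * xi_log_deriv q \<psi> s * cnj (\<xi> s) = of_real M * xi_log_deriv q \<psi> s" .
  have D_eq: "D = 2 * M * Re (xi_log_deriv q \<psi> s)"
    unfolding D_def e by simp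
  moreover have "M \<noteq> 0" using \<xi>0 by (simp add: M_def)
  ultimately show ?thesis using \<open>D = 0\<close> by simp
qed

text \<open>The real part vanishes on the zero-free segment of the critical line and is uniformly
  continuous on a compact rectangle to its right. The width \<open>d\<close> depends on the
  character, so \<delta> has to be chosen after it.\<close>

lemma xi_log_deriv_small:
  assumes b: "b \<ge> 0" and nzb: "\<And>t. \<bar>t\<bar> \<le> b \<Longrightarrow> dseries \<psi> (Complex (1/2) t) \<noteq> 0"
  obtains d where "d > 0" "\<And>\<delta> t. 0 < \<delta> \<Longrightarrow> \<delta> < d \<Longrightarrow> \<bar>t\<bar> \<le> b \<Longrightarrow> \<bar>Re (xi_log_deriv q \<psi> (Complex (1/2 + \<delta>) t))\<bar> \<le> 1"
proof -
  define K where "K = cbox (Complex (1/2) (- b)) (Complex 1 b)"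
  have K: "s \<in> K \<longleftrightarrow> 1/2 \<le> Re s \<and> Re s \<le> 1 \<and> \<bar>Im s\<bar> \<le> b" for s
    by (auto simp: K_def in_cbox_complex_iff)
  have LK: "dseries \<psi> s \<noteq> 0" if "s \<in> K" for s
  proof (cases "Re s = 1/2")
    case True
    then have "s = Complex (1/2) (Im s)" by (simp add: complex_eq_iff)
    then show ?thesis using nzb[of "Im s"] that K by metis
  qed (use nz[of s] that K in auto)
  have sub: "K \<subseteq> {s. Re s > 0}" using K by auto
  have hol: "dseries \<psi> holomorphic_on {s. Re s > 0}"
    by (rule holomorphic_dseries[OF norm_sum_char_le[OF q \<psi>]])
  have "continuous_on K (\<lambda>s. deriv (dseries \<psi>) s / dseries \<psi> s)"
    using LK by (intro continuous_on_divide holomorphic_on_imp_continuous_on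
        holomorphic_on_subset[OF holomorphic_deriv[OF hol open_halfspace_Re_gt] sub]
        holomorphic_on_subset[OF hol sub]) auto
  moreover have "continuous_on K (\<lambda>s. Digamma (s / 2))"
  proof (rule holomorphic_on_imp_continuous_on, rule holomorphic_on_subset[OF _ sub])
    show "(\<lambda>s. Digamma (s / 2)) holomorphic_on {s::complex. Re s > 0}"
    proof (rule holomorphic_on_compose_gen[OF _ holomorphic_on_Polygamma[of "{z. Re z > 0}"], unfolded o_def])
      have "z \<notin> \<int>\<^sub>\<le>\<^sub>0" if "Re z > 0" for z :: complex
        using half_not_nonpos_Ints[of "2 * z"] that by simp
      then show "{z::complex. Re z > 0} \<inter> \<int>\<^sub>\<le>\<^sub>0 = {}" by auto
    qed (auto intro!: holomorphic_intros)
  qed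
  then have "continuous_on K (\<lambda>s. Digamma (s / 2) / 2)"
    by (intro continuous_on_divide continuous_on_const) auto
  ultimately have "continuous_on K (\<lambda>s. Re (xi_log_deriv q \<psi> s))"
    unfolding xi_log_deriv_def by (intro continuous_on_Re continuous_on_add continuous_on_const)
  moreover have "compact K" by (simp add: K_def)
  ultimately have "uniformly_continuous_on K (\<lambda>s. Re (xi_log_deriv q \<psi> s))"
    by (rule compact_uniformly_continuous)
  then obtain d where d: "d > 0" "\<And>x y. x \<in> K \<Longrightarrow> y \<in> K \<Longrightarrow> dist y x < d \<Longrightarrow>
      dist (Re (xi_log_deriv q \<psi> y)) (Re (xi_log_deriv q \<psi> x)) < 1"
    unfolding uniformly_continuous_on_def by (metis zero_less_one)
  show ?thesis
  proof (rule that[of "min d (1/2)"])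
    show "min d (1/2) > 0" using d by simp
    fix \<delta> t :: real assume *: "0 < \<delta>" "\<delta> < min d (1/2)" "\<bar>t\<bar> \<le> b"
    have "dist (Complex (1/2 + \<delta>) t) (Complex (1/2) t) = \<delta>"
      using * by (simp add: dist_norm norm_complex_def)
    moreover have "Complex (1/2 + \<delta>) t \<in> K" "Complex (1/2) t \<in> K"
      using * by (auto simp: K)
    ultimately have "dist (Re (xi_log_deriv q \<psi> (Complex (1/2 + \<delta>) t))) (Re (xi_log_deriv q \<psi> (Complex (1/2) t))) < 1"
      using * by (intro d) auto
    moreover have "Re (xi_log_deriv q \<psi> (Complex (1/2) t)) = 0"
      using * by (intro Re_xi_log_deriv_critical nzb) auto
    ultimately show "\<bar>Re (xi_log_deriv q \<psi> (Complex (1/2 + \<delta>) t))\<bar> \<le> 1"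
      by (simp add: dist_real_def)
  qed
qed

end

section \<open>Integrals over vertical lines\<close>

text \<open>The exponent -3/2 combines the decay t^(-2) of the test function with the growth t^(1/2)
  allowed for the logarithmic derivatives.\<close>

lemma integrable_one_plus_abs_powr:
  "integrable lborel (\<lambda>t::real. (1 + \<bar>t\<bar>) powr (- (3/2)))"
proof -
  define W where "W = (\<lambda>t::real. indicator {0..} t * (1 + \<bar>t\<bar>) powr (- (3/2)))"
  have meas: "W \<in> borel_measurable borel"
    unfolding W_def by measurable
  have "(\<integral>\<^sup>+ t. ennreal ((1 + \<bar>t\<bar>) powr (- (3/2))) * indicator {0..} t \<partial>lborel) = ennreal (0 - (- 2 * (1 + 0) powr (- (1/2))))"
  proof (rule nn_integral_FTC_atLeast[where F = "\<lambda>t. - 2 * (1 + t) powr (- (1/2))" and T = 0 and a = 0])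
    show "(\<lambda>t::real. (1 + \<bar>t\<bar>) powr (- (3/2))) \<in> borel_measurable borel"
      by measurable
    show "((\<lambda>t. - 2 * (1 + t) powr (- (1/2))) has_real_derivative (1 + \<bar>x\<bar>) powr (- (3/2))) (at x)" if "0 \<le> x" for x
    proof -
      have "((\<lambda>t. (1 + t) powr (- (1/2))) has_real_derivative (- (1/2)) * (1 + x) powr (- (1/2) - 1) * (0 + 1)) (at x)"
        using that by (intro DERIV_chain2[OF has_real_derivative_powr] DERIV_add DERIV_const DERIV_ident) auto
      from DERIV_cmult[OF this, of "- 2"] show ?thesis
        using that by simp
    qed
    show "((\<lambda>t::real. - 2 * (1 + t) powr (- (1/2))) \<longlongrightarrow> 0) at_top"
      by real_asymp
  qed simp
  moreover have "ennreal (W t) = ennreal ((1 + \<bar>t\<bar>) powr (- (3/2))) * indicator {0..} t" for t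
    by (simp add: W_def indicator_def)
  ultimately have "(\<integral>\<^sup>+ t. ennreal (W t) \<partial>lborel) < \<infinity>"
    by simp
  then have int: "integrable lborel W"
    using meas by (intro integrableI_nonneg) (auto simp: W_def)
  have "integrable lborel (\<lambda>t. W (0 + (-1) * t))"
    by (rule lborel_integrable_real_affine[OF int]) simp
  then have "integrable lborel (\<lambda>t. W t + W (- t))"
    using int by simp
  then show ?thesis
    by (rule Bochner_Integration.integrable_bound) (auto simp: W_def indicator_def)
qed

lemma integrable_of_decay:
  fixes f :: "real \<Rightarrow> complex"
  assumes "continuous_on UNIV f" "\<And>t. norm (f t) \<le> C * (1 + \<bar>t\<bar>) powr (- (3/2))"
  shows "integrable lborel f"
proof (rule Bochner_Integration.integrable_bound)
  show "integrable lborel (\<lambda>t. C * (1 + \<bar>t\<bar>) powr (- (3/2)))"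
    by (intro integrable_mult_right integrable_one_plus_abs_powr)
  show "f \<in> borel_measurable lborel"
    using borel_measurable_continuous_onI[OF assms(1)] by simp
  show "AE t in lborel. norm (f t) \<le> norm (C * (1 + \<bar>t\<bar>) powr (- (3/2)))"
  proof (rule AE_I2)
    show "norm (f t) \<le> norm (C * (1 + \<bar>t\<bar>) powr (- (3/2)))" for t
      using assms(2)[of t] by simp
  qed
qed

text \<open>Cauchy's theorem, phrased with a primitive: the segment of the line up to height T is
  replaced by the three other sides of a rectangle. They have total length 4 T, and \<open>P\<close>
  is O(T^(-3/2)) on them.\<close>

lemma half_plane_integral_zero:
  fixes P :: "complex \<Rightarrow> complex"
  assumes P: "P holomorphic_on {s. Re s > a'}" "a' < a" "0 \<le> a"
    and bd: "\<And>s. Re s \<ge> a \<Longrightarrow> norm (P s) \<le> C * (1 + norm s) powr (- (3/2))"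
  shows "integrable lborel (\<lambda>t. P (Complex a t))" and "(\<integral>t. P (Complex a t) \<partial>lborel) = 0"
proof -
  have path: "continuous_on UNIV (\<lambda>t. Complex a t)"
    unfolding Complex_eq by (intro continuous_intros)
  have contP: "continuous_on {s. Re s > a'} P"
    using P(1) by (rule holomorphic_on_imp_continuous_on)
  have cont: "continuous_on UNIV (\<lambda>t. P (Complex a t))"
    by (rule continuous_on_compose2[OF contP path]) (use P in auto)
  have C: "C \<ge> 0"
  proof -
    have "0 \<le> C * (1 + norm (of_real a :: complex)) powr (- (3/2))"
      by (rule order_trans[OF norm_ge_zero bd]) simp
    moreover have "(1 + norm (of_real a :: complex)) powr (- (3/2)) > 0"
      using P(3) by simp
    ultimately show ?thesis by (simp add: zero_le_mult_iff)
  qed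
  have le: "norm (P (Complex a t)) \<le> C * (1 + \<bar>t\<bar>) powr (- (3/2))" for t
  proof -
    have "norm (P (Complex a t)) \<le> C * (1 + norm (Complex a t)) powr (- (3/2))"
      by (rule bd) simp
    also have "\<dots> \<le> C * (1 + \<bar>t\<bar>) powr (- (3/2))"
      using C abs_Im_le_cmod[of "Complex a t"] by (intro mult_left_mono powr_mono2') auto
    finally show ?thesis .
  qed
  show int: "integrable lborel (\<lambda>t. P (Complex a t))"
    by (rule integrable_of_decay[OF cont le])
  obtain Q where Q: "\<And>s. s \<in> {s. Re s > a'} \<Longrightarrow> (Q has_field_derivative P s) (at s within {s. Re s > a'})"
    using holomorphic_convex_primitive'[OF convex_halfspace_Re_gt open_halfspace_Re_gt P(1)] by blast
  have Qd: "(Q has_field_derivative P s) (at s)" if "Re s > a'" for s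
    using Q[of s] at_within_open[of s "{s. Re s > a'}"] that by (simp add: open_halfspace_Re_gt)
  have seg: "norm (Q z - Q w) \<le> C * (1 + T) powr (- (3/2)) * norm (z - w)"
    if T: "T \<ge> 0" and s: "\<And>s. s \<in> closed_segment w z \<Longrightarrow> Re s \<ge> a \<and> norm s \<ge> T" for w z T
  proof (rule field_differentiable_bound[of "closed_segment w z" Q P])
    fix s assume ss: "s \<in> closed_segment w z"
    show "(Q has_field_derivative P s) (at s within closed_segment w z)"
      using s[OF ss] P(2) by (intro has_field_derivative_at_within[OF Qd]) auto
    have "norm (P s) \<le> C * (1 + norm s) powr (- (3/2))" using s[OF ss] by (intro bd) auto
    also have "\<dots> \<le> C * (1 + T) powr (- (3/2))"
      using C s[OF ss] T by (intro mult_left_mono powr_mono2') auto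
    finally show "norm (P s) \<le> C * (1 + T) powr (- (3/2))" .
  qed auto
  have FTC: "(\<integral>t. indicator {- T..T} t *\<^sub>R P (Complex a t) \<partial>lborel) = - \<i> * Q (Complex a T) - - \<i> * Q (Complex a (- T))"
    if T: "T \<ge> 0" for T
  proof (rule integral_FTC_Icc)
    fix t
    have "((\<lambda>t. Complex a t) has_vector_derivative \<i>) (at t within {- T..T})"
      unfolding Complex_eq by (auto intro!: derivative_eq_intros simp: scaleR_conv_of_real)
    moreover have "(Q has_field_derivative P (Complex a t)) (at (Complex a t))"
      using P by (intro Qd) auto
    ultimately have "(Q \<circ> (\<lambda>t. Complex a t) has_vector_derivative (\<i> * P (Complex a t))) (at t within {- T..T})"
      by (rule field_vector_diff_chain_within[OF _ has_field_derivative_at_within])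
    then have "((\<lambda>t. - \<i> * (Q \<circ> (\<lambda>t. Complex a t)) t) has_vector_derivative - \<i> * (\<i> * P (Complex a t))) (at t within {- T..T})"
      by (rule has_vector_derivative_mult_right)
    then show "((\<lambda>t. - \<i> * Q (Complex a t)) has_vector_derivative P (Complex a t)) (at t within {- T..T})"
      by (simp add: o_def mult.assoc[symmetric])
  next
    show "continuous_on {- T..T} (\<lambda>t. P (Complex a t))"
      using cont continuous_on_subset by blast
  qed (use T in auto)
  have small: "norm (\<integral>t. indicator {- T..T} t *\<^sub>R P (Complex a t) \<partial>lborel) \<le> 4 * C * T * (1 + T) powr (- (3/2))"
    if T: "T \<ge> 0" for T
  proof -
    let ?B = "C * (1 + T) powr (- (3/2))"
    have 1: "norm (Q (Complex a T) - Q (Complex (a + T) T)) \<le> ?B * norm (Complex a T - Complex (a + T) T)"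
    proof (rule seg[OF T])
      fix s assume "s \<in> closed_segment (Complex (a + T) T) (Complex a T)"
      moreover have "closed_segment (Complex (a + T) T) (Complex a T) \<subseteq> {s. Re s \<ge> a} \<inter> {s. Im s \<ge> T}"
        using T by (intro closed_segment_subset convex_Int convex_halfspace_Re_ge convex_halfspace_Im_ge) auto
      ultimately have "Re s \<ge> a" "Im s \<ge> T" by auto
      then show "Re s \<ge> a \<and> norm s \<ge> T" using abs_Im_le_cmod[of s] by auto
    qed
    have 2: "norm (Q (Complex (a + T) T) - Q (Complex (a + T) (- T))) \<le> ?B * norm (Complex (a + T) T - Complex (a + T) (- T))"
    proof (rule seg[OF T])
      fix s assume "s \<in> closed_segment (Complex (a + T) (- T)) (Complex (a + T) T)"
      moreover have "closed_segment (Complex (a + T) (- T)) (Complex (a + T) T) \<subseteq> {s. Re s \<ge> a + T}"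
        using T by (intro closed_segment_subset convex_halfspace_Re_ge) auto
      ultimately have "Re s \<ge> a + T" by auto
      then show "Re s \<ge> a \<and> norm s \<ge> T" using complex_Re_le_cmod[of s] T P(3) by auto
    qed
    have 3: "norm (Q (Complex (a + T) (- T)) - Q (Complex a (- T))) \<le> ?B * norm (Complex (a + T) (- T) - Complex a (- T))"
    proof (rule seg[OF T])
      fix s assume "s \<in> closed_segment (Complex a (- T)) (Complex (a + T) (- T))"
      moreover have "closed_segment (Complex a (- T)) (Complex (a + T) (- T)) \<subseteq> {s. Re s \<ge> a} \<inter> {s. Im s \<le> - T}"
        using T by (intro closed_segment_subset convex_Int convex_halfspace_Re_ge convex_halfspace_Im_le) auto
      ultimately have "Re s \<ge> a" "Im s \<le> - T" by auto
      then show "Re s \<ge> a \<and> norm s \<ge> T" using abs_Im_le_cmod[of s] by auto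
    qed
    have d: "norm (Complex a T - Complex (a + T) T) = T" "norm (Complex (a + T) T - Complex (a + T) (- T)) = 2 * T"
       "norm (Complex (a + T) (- T) - Complex a (- T)) = T"
      using T by (auto simp: norm_complex_def real_sqrt_mult)
    have "norm (Q (Complex a T) - Q (Complex a (- T))) \<le> norm (Q (Complex a T) - Q (Complex (a + T) T))
        + norm (Q (Complex (a + T) T) - Q (Complex (a + T) (- T))) + norm (Q (Complex (a + T) (- T)) - Q (Complex a (- T)))"
      using norm_triangle_ineq[of "Q (Complex a T) - Q (Complex (a + T) T)" "Q (Complex (a + T) T) - Q (Complex (a + T) (- T))"]
        norm_triangle_ineq[of "Q (Complex a T) - Q (Complex (a + T) (- T))" "Q (Complex (a + T) (- T)) - Q (Complex a (- T))"]
      by simp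
    also have "\<dots> \<le> ?B * T + ?B * (2 * T) + ?B * T"
      using 1 2 3 unfolding d by (intro add_mono)
    finally have "norm (Q (Complex a T) - Q (Complex a (- T))) \<le> 4 * C * T * (1 + T) powr (- (3/2))"
      by (simp add: algebra_simps)
    moreover have "- \<i> * Q (Complex a T) - - \<i> * Q (Complex a (- T)) = - \<i> * (Q (Complex a T) - Q (Complex a (- T)))"
      by (simp add: algebra_simps)
    ultimately show ?thesis unfolding FTC[OF T] by (simp add: norm_mult)
  qed
  have "(\<lambda>n. \<integral>t. indicator {- real n..real n} t *\<^sub>R P (Complex a t) \<partial>lborel) \<longlonglongrightarrow> (\<integral>t. P (Complex a t) \<partial>lborel)"
  proof (rule integral_dominated_convergence)
    show "(\<lambda>t. P (Complex a t)) \<in> borel_measurable lborel"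
      using int by (rule borel_measurable_integrable)
    show "(\<lambda>t. indicator {- real n..real n} t *\<^sub>R P (Complex a t)) \<in> borel_measurable lborel" for n
      using borel_measurable_integrable[OF int] by measurable
    show "integrable lborel (\<lambda>t. norm (P (Complex a t)))"
      using int by (rule integrable_norm)
    show "AE t in lborel. (\<lambda>n. indicator {- real n..real n} t *\<^sub>R P (Complex a t)) \<longlonglongrightarrow> P (Complex a t)"
    proof (rule AE_I2, rule tendsto_eventually)
      fix t :: real
      obtain N :: nat where N: "\<bar>t\<bar> \<le> real N" using real_arch_simple by blast
      show "\<forall>\<^sub>F n in sequentially. indicator {- real n..real n} t *\<^sub>R P (Complex a t) = P (Complex a t)"
        using eventually_ge_at_top[of N]
      proof eventually_elim
        case (elim n)
        then have "\<bar>t\<bar> \<le> real n" using N by linarith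
        then show ?case by (auto simp: indicator_def abs_le_iff)
      qed
    qed
    show "AE t in lborel. norm (indicator {- real n..real n} t *\<^sub>R P (Complex a t)) \<le> norm (P (Complex a t))" for n
      by (auto simp: indicator_def)
  qed
  moreover have "(\<lambda>n. \<integral>t. indicator {- real n..real n} t *\<^sub>R P (Complex a t) \<partial>lborel) \<longlonglongrightarrow> 0"
  proof (rule Lim_null_comparison)
    show "\<forall>\<^sub>F n in sequentially. norm (\<integral>t. indicator {- real n..real n} t *\<^sub>R P (Complex a t) \<partial>lborel) \<le> 4 * C * real n * (1 + real n) powr (- (3/2))"
      using small by auto
    show "(\<lambda>n. 4 * C * real n * (1 + real n) powr (- (3/2))) \<longlonglongrightarrow> 0"
      by real_asymp
  qed
  ultimately show "(\<integral>t. P (Complex a t) \<partial>lborel) = 0"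
    using LIMSEQ_unique by blast
qed

section \<open>The test function\<close>

definition entire_sinc :: "complex \<Rightarrow> complex" where
  "entire_sinc v = (if v = 0 then of_real (pi / 2) else sin (of_real (pi / 2) * v) / v)"

text \<open>The entire function \<open>cos (\<pi> w / 2) / (1 - w\<^sup>2)\<close>, written so that its values at \<open>1\<close> and \<open>-1\<close>
  are the right ones.\<close>

definition cos_kernel :: "complex \<Rightarrow> complex" where
  "cos_kernel w = (entire_sinc (1 - w) + entire_sinc (1 + w)) / 2"

lemma holomorphic_entire_sinc: "entire_sinc holomorphic_on UNIV"
proof -
  have "deriv (\<lambda>v. sin (of_real (pi / 2) * v)) 0 = complex_of_real (pi / 2)"
    by (rule DERIV_imp_deriv) (auto intro!: derivative_eq_intros)
  then have "entire_sinc = (\<lambda>v. if v = 0 then deriv (\<lambda>v. sin (of_real (pi / 2) * v)) 0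
      else (sin (of_real (pi / 2) * v) - sin (of_real (pi / 2) * 0)) / (v - 0))"
    by (auto simp: entire_sinc_def fun_eq_iff)
  moreover have "(\<lambda>v. if v = 0 then deriv (\<lambda>v. sin (of_real (pi / 2) * v)) 0
      else (sin (of_real (pi / 2) * v) - sin (of_real (pi / 2) * 0)) / (v - 0)) holomorphic_on (UNIV :: complex set)"
    by (rule pole_lemma_open) (auto intro!: holomorphic_intros)
  ultimately show ?thesis by simp
qed

lemma holomorphic_cos_kernel: "cos_kernel holomorphic_on S"
proof -
  have "cos_kernel holomorphic_on UNIV"
    unfolding cos_kernel_def[abs_def]
    by (intro holomorphic_intros holomorphic_on_compose_gen[OF _ holomorphic_entire_sinc, unfolded o_def]) auto
  then show ?thesis by (rule holomorphic_on_subset) simp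
qed

lemma cos_kernel_eq:
  assumes "w\<^sup>2 \<noteq> 1"
  shows "cos_kernel w = cos (of_real (pi / 2) * w) / (1 - w\<^sup>2)"
proof -
  have nz: "1 - w \<noteq> 0" "1 + w \<noteq> 0"
    using assms by (auto simp: power2_eq_square add_eq_0_iff)
  have "sin (of_real (pi / 2) * (1 - w)) = cos (of_real (pi / 2) * w)" "sin (of_real (pi / 2) * (1 + w)) = cos (of_real (pi / 2) * w)"
    using sin_of_real[of "pi / 2", where ?'a = complex] cos_of_real[of "pi / 2", where ?'a = complex]
    by (simp_all add: right_diff_distrib distrib_left sin_diff sin_add)
  then have "cos_kernel w = (cos (of_real (pi / 2) * w) / (1 - w) + cos (of_real (pi / 2) * w) / (1 + w)) / 2"
    using nz by (simp add: cos_kernel_def entire_sinc_def)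
  also have "\<dots> = cos (of_real (pi / 2) * w) / ((1 - w) * (1 + w))"
  proof -
    define A where "A = cos (of_real (pi / 2) * w)"
    have "A * (1 + w) + A * (1 - w) = 2 * A" by (simp add: algebra_simps)
    then show ?thesis
      using nz unfolding A_def[symmetric] by (simp add: add_frac_eq)
  qed
  also have "(1 - w) * (1 + w) = 1 - w\<^sup>2"
    by (simp add: algebra_simps power2_eq_square)
  finally show ?thesis .
qed

lemma entire_sinc_real: "entire_sinc (of_real x) \<in> \<real>"
proof -
  have "sin (complex_of_real (pi / 2) * of_real x) = of_real (sin (pi / 2 * x))"
    by (simp flip: sin_of_real)
  then show ?thesis
    unfolding entire_sinc_def by (auto simp del: of_real_divide simp flip: of_real_divide)
qed

lemma cos_kernel_real: "cos_kernel (of_real x) \<in> \<real>"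
  using entire_sinc_real[of "1 - x"] entire_sinc_real[of "1 + x"] by (auto simp: cos_kernel_def)

lemma cos_kernel_0: "cos_kernel 0 = 1"
  using cos_kernel_eq[of 0] by simp

lemma norm_cos_le: "norm (cos z) \<le> exp \<bar>Im z\<bar>" for z :: complex
proof -
  have "norm (cos z) = norm (exp (\<i> * z) + exp (- (\<i> * z))) / 2"
    by (simp add: cos_exp_eq norm_divide)
  also have "\<dots> \<le> (exp (- Im z) + exp (Im z)) / 2"
    using norm_triangle_ineq[of "exp (\<i> * z)" "exp (- (\<i> * z))"] by simp
  also have "\<dots> \<le> exp \<bar>Im z\<bar>"
    by (cases "Im z \<ge> 0") auto
  finally show ?thesis .
qed

text \<open>The disc of radius 2 contains the removable singularities and is treated by compactness;
  outside it |1 - w^2| is at least (1 + |w|^2) / 2.\<close>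

lemma cos_kernel_bound:
  obtains C where "C > 0" "\<And>w. norm (cos_kernel w) \<le> C * exp (pi / 2 * \<bar>Im w\<bar>) / (1 + (norm w)\<^sup>2)"
proof -
  have "continuous_on (cball 0 2) cos_kernel"
    by (intro holomorphic_on_imp_continuous_on holomorphic_cos_kernel)
  then have "bounded (cos_kernel ` cball 0 2)"
    by (intro compact_imp_bounded compact_continuous_image compact_cball)
  then obtain M where "\<forall>y\<in>cos_kernel ` cball 0 2. norm y \<le> M"
    unfolding bounded_iff by blast
  then have M: "\<And>w. norm w \<le> 2 \<Longrightarrow> norm (cos_kernel w) \<le> M"
    by auto
  have M0: "M \<ge> 0" using M[of 0] norm_ge_zero[of "cos_kernel 0"] by (simp del: norm_ge_zero)
  define C where "C = 5 * M + 2"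
  show ?thesis
  proof (rule that[of C])
    show "C > 0" using M0 by (simp add: C_def)
    fix w :: complex
    have p: "1 + (norm w)\<^sup>2 > 0" by (simp add: add_pos_nonneg)
    show "norm (cos_kernel w) \<le> C * exp (pi / 2 * \<bar>Im w\<bar>) / (1 + (norm w)\<^sup>2)"
    proof (cases "norm w \<le> 2")
      case True
      then have "(norm w)\<^sup>2 \<le> 2\<^sup>2" by (intro power_mono) auto
      then have "norm (cos_kernel w) * (1 + (norm w)\<^sup>2) \<le> M * 5"
        using M[OF True] M0 by (intro mult_mono) auto
      also have "\<dots> \<le> C * 1" using M0 by (simp add: C_def)
      also have "\<dots> \<le> C * exp (pi / 2 * \<bar>Im w\<bar>)" using M0 by (intro mult_left_mono) (auto simp: C_def)
      finally show ?thesis using p by (simp add: field_simps)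
    next
      case False
      then have n4: "(norm w)\<^sup>2 > 4" using power_strict_mono[of 2 "norm w" 2] by simp
      then have w1: "w\<^sup>2 \<noteq> 1" by (metis norm_one norm_power not_less one_le_numeral)
      define N where "N = (norm w)\<^sup>2"
      have "norm (1 - w\<^sup>2) \<ge> N - 1"
        using norm_triangle_ineq2[of "w\<^sup>2" 1] by (simp add: N_def norm_power norm_minus_commute)
      moreover have "(1 + N) / 2 \<le> N - 1" using n4 by (simp add: N_def)
      ultimately have d: "norm (1 - w\<^sup>2) \<ge> (1 + (norm w)\<^sup>2) / 2" unfolding N_def by (rule order_trans[rotated])
      have "norm (cos_kernel w) = norm (cos (of_real (pi / 2) * w)) / norm (1 - w\<^sup>2)"
        unfolding cos_kernel_eq[OF w1] by (simp add: norm_divide)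
      also have "\<dots> \<le> exp \<bar>Im (of_real (pi / 2) * w)\<bar> / ((1 + (norm w)\<^sup>2) / 2)"
        using d p by (intro frac_le norm_cos_le) auto
      also have "\<dots> = 2 * exp (pi / 2 * \<bar>Im w\<bar>) / (1 + (norm w)\<^sup>2)"
        by (simp add: abs_mult)
      also have "\<dots> \<le> C * exp (pi / 2 * \<bar>Im w\<bar>) / (1 + (norm w)\<^sup>2)"
        using M0 p by (intro divide_right_mono mult_right_mono) (auto simp: C_def)
      finally show ?thesis .
    qed
  qed
qed

text \<open>The factor \<open>1 + \<kappa> - w\<^sup>2\<close> changes sign at \<open>\<plusminus> sqrt (1 + \<kappa>)\<close>. The integral over the real line vanishes
  for \<open>\<kappa> = 0\<close> and hence is positive for \<open>\<kappa> > 0\<close>; this is where the constant \<open>1/4\<close> comes from.\<close>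

definition test_fun :: "real \<Rightarrow> complex \<Rightarrow> complex" where
  "test_fun \<kappa> w = (of_real (1 + \<kappa>) - w\<^sup>2) * (cos_kernel w)\<^sup>2"

lemma holomorphic_test_fun: "test_fun \<kappa> holomorphic_on S"
  unfolding test_fun_def[abs_def] by (intro holomorphic_intros holomorphic_cos_kernel)

lemma test_fun_real: "test_fun \<kappa> (of_real x) \<in> \<real>"
  using cos_kernel_real[of x] by (auto simp: test_fun_def intro!: Reals_mult Reals_diff)

lemma test_fun_nonpos:
  assumes "x\<^sup>2 \<ge> 1 + \<kappa>"
  shows "Re (test_fun \<kappa> (of_real x)) \<le> 0"
proof -
  obtain c where c: "cos_kernel (of_real x) = of_real c"
    using cos_kernel_real[of x] by (auto elim: Reals_cases)
  have "test_fun \<kappa> (of_real x) = of_real ((1 + \<kappa> - x\<^sup>2) * c\<^sup>2)"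
    by (simp add: test_fun_def c)
  then show ?thesis using assms by (simp add: mult_nonpos_nonneg)
qed

text \<open>Squaring the kernel doubles its exponential type to \<pi> and gives decay of order 4, of
  which the quadratic factor consumes half. The type fixes the cut-off exp(\<pi> \<Lambda>) of the
  Dirichlet series.\<close>

lemma test_fun_bound:
  assumes "\<kappa> \<ge> 0"
  obtains C where "C > 0" "\<And>w. norm (test_fun \<kappa> w) \<le> C * exp (pi * \<bar>Im w\<bar>) / (1 + (norm w)\<^sup>2)"
proof -
  obtain K where K: "K > 0" "\<And>w. norm (cos_kernel w) \<le> K * exp (pi / 2 * \<bar>Im w\<bar>) / (1 + (norm w)\<^sup>2)"
    using cos_kernel_bound by blast
  show ?thesis
  proof (rule that[of "(1 + \<kappa>) * K\<^sup>2"])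
    show "(1 + \<kappa>) * K\<^sup>2 > 0" using K assms by simp
    fix w :: complex
    define D where "D = 1 + (norm w)\<^sup>2"
    have D: "D > 0" unfolding D_def by (simp add: add_pos_nonneg)
    have "norm (of_real (1 + \<kappa>) - w\<^sup>2) \<le> (1 + \<kappa>) + (norm w)\<^sup>2"
      using norm_triangle_ineq4[of "of_real (1 + \<kappa>)" "w\<^sup>2"] assms by (simp add: norm_power del: of_real_add)
    also have "\<dots> \<le> (1 + \<kappa>) * D" using assms by (simp add: D_def algebra_simps)
    finally have 1: "norm (of_real (1 + \<kappa>) - w\<^sup>2) \<le> (1 + \<kappa>) * D" .
    have "(norm (cos_kernel w))\<^sup>2 \<le> (K * exp (pi / 2 * \<bar>Im w\<bar>) / D)\<^sup>2"
      unfolding D_def by (intro power_mono K) auto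
    also have "\<dots> = K\<^sup>2 * exp (pi * \<bar>Im w\<bar>) / D\<^sup>2"
      by (simp add: power_mult_distrib power_divide flip: exp_double)
    finally have 2: "(norm (cos_kernel w))\<^sup>2 \<le> K\<^sup>2 * exp (pi * \<bar>Im w\<bar>) / D\<^sup>2" .
    have "norm (test_fun \<kappa> w) \<le> ((1 + \<kappa>) * D) * (K\<^sup>2 * exp (pi * \<bar>Im w\<bar>) / D\<^sup>2)"
      unfolding test_fun_def norm_mult norm_power using 1 2 D assms by (intro mult_mono) auto
    also have "\<dots> = (1 + \<kappa>) * K\<^sup>2 * exp (pi * \<bar>Im w\<bar>) / D"
      using D by (simp add: field_simps power2_eq_square)
    finally show "norm (test_fun \<kappa> w) \<le> (1 + \<kappa>) * K\<^sup>2 * exp (pi * \<bar>Im w\<bar>) / (1 + (norm w)\<^sup>2)"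
      unfolding D_def .
  qed
qed

lemma inverse_square_le_powr: "1 / (1 + x\<^sup>2) \<le> 2 * (1 + x) powr (- 2)" if "x \<ge> 0" for x :: real
proof -
  define Y where "Y = 1 + x\<^sup>2"
  have pw: "(1 + x) powr (- 2) = 1 / (1 + x)\<^sup>2"
    using that by (simp add: powr_minus_divide)
  have "(1 + x)\<^sup>2 \<le> 2 * Y"
    unfolding Y_def
    using sum_squares_ge_zero[of "1 - x" 0] by (simp add: power2_eq_square algebra_simps)
  moreover have "0 < (1 + x)\<^sup>2 * (2 * Y)"
    using that by (intro mult_pos_pos) (auto simp: Y_def add_pos_nonneg)
  ultimately have "2 / (2 * Y) \<le> 2 / (1 + x)\<^sup>2"
    by (intro divide_left_mono) (auto simp: mult.commute)
  then show ?thesis unfolding pw Y_def[symmetric] by simp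
qed

lemma integrable_test_fun_sqrt:
  assumes "\<kappa> \<ge> 0"
  shows "integrable lborel (\<lambda>t. of_real (sqrt (1 + \<bar>t\<bar>)) * test_fun \<kappa> (of_real t))"
    and "integrable lborel (\<lambda>t. test_fun \<kappa> (of_real t))"
proof -
  obtain C where C: "C > 0" "\<And>w. norm (test_fun \<kappa> w) \<le> C * exp (pi * \<bar>Im w\<bar>) / (1 + (norm w)\<^sup>2)"
    using test_fun_bound[OF assms] by blast
  have ct: "continuous_on UNIV (\<lambda>t::real. test_fun \<kappa> (of_real t))"
    by (rule continuous_on_compose2[OF holomorphic_on_imp_continuous_on[OF holomorphic_test_fun[of \<kappa> UNIV]]])
      (auto intro!: continuous_intros)
  have b: "norm (test_fun \<kappa> (of_real t)) \<le> 2 * C * (1 + \<bar>t\<bar>) powr (- 2)" for t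
  proof -
    have "norm (test_fun \<kappa> (of_real t)) \<le> C * (1 / (1 + \<bar>t\<bar>\<^sup>2))"
      using C(2)[of "of_real t"] by simp
    also have "\<dots> \<le> C * (2 * (1 + \<bar>t\<bar>) powr (- 2))"
      using C by (intro mult_left_mono inverse_square_le_powr) auto
    finally show ?thesis by simp
  qed
  show "integrable lborel (\<lambda>t. of_real (sqrt (1 + \<bar>t\<bar>)) * test_fun \<kappa> (of_real t))"
  proof (rule integrable_of_decay[where C = "2 * C"])
    show "continuous_on UNIV (\<lambda>t. of_real (sqrt (1 + \<bar>t\<bar>)) * test_fun \<kappa> (of_real t))"
      by (intro continuous_intros ct)
    fix t :: real
    have "norm (of_real (sqrt (1 + \<bar>t\<bar>)) * test_fun \<kappa> (of_real t)) \<le> sqrt (1 + \<bar>t\<bar>) * (2 * C * (1 + \<bar>t\<bar>) powr (- 2))"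
      using b[of t] by (simp add: norm_mult mult_left_mono)
    also have "\<dots> = 2 * C * ((1 + \<bar>t\<bar>) powr (1/2) * (1 + \<bar>t\<bar>) powr (- 2))"
      by (simp add: powr_half_sqrt)
    also have "(1 + \<bar>t\<bar>) powr (1/2) * (1 + \<bar>t\<bar>) powr (- 2) = (1 + \<bar>t\<bar>) powr (- (3/2))"
      by (simp flip: powr_add)
    finally show "norm (of_real (sqrt (1 + \<bar>t\<bar>)) * test_fun \<kappa> (of_real t)) \<le> 2 * C * (1 + \<bar>t\<bar>) powr (- (3/2))" .
  qed
  show "integrable lborel (\<lambda>t. test_fun \<kappa> (of_real t))"
  proof (rule integrable_of_decay[where C = "2 * C"])
    fix t :: real
    have "2 * C * (1 + \<bar>t\<bar>) powr (- 2) \<le> 2 * C * (1 + \<bar>t\<bar>) powr (- (3/2))"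
      using C by (intro mult_left_mono powr_mono) auto
    with b[of t] show "norm (test_fun \<kappa> (of_real t)) \<le> 2 * C * (1 + \<bar>t\<bar>) powr (- (3/2))"
      by (rule order_trans)
  qed (rule ct)
qed

text \<open>For \<open>\<kappa> = 0\<close> the test function is the real part of \<open>(1 + exp (\<pi> i t)) / (2 (1 - t\<^sup>2))\<close>, which is entire and
  small in a half-plane.\<close>

lemma integral_test_fun_0: "(\<integral>t. Re (test_fun 0 (of_real t)) \<partial>lborel) = 0"
proof -
  define P where "P = (\<lambda>s. exp (- of_real (pi / 2) * s) * cos_kernel (\<i> * s))"
  have holP: "P holomorphic_on {s. Re s > -1}"
    unfolding P_def
    by (intro holomorphic_intros holomorphic_on_compose_gen[OF _ holomorphic_cos_kernel[of UNIV], unfolded o_def]) auto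
  obtain K where K: "K > 0" "\<And>w. norm (cos_kernel w) \<le> K * exp (pi / 2 * \<bar>Im w\<bar>) / (1 + (norm w)\<^sup>2)"
    using cos_kernel_bound by blast
  have bd: "norm (P s) \<le> 2 * K * (1 + norm s) powr (- (3/2))" if "Re s \<ge> 0" for s
  proof -
    have "norm (P s) \<le> exp (- (pi / 2 * Re s)) * (K * exp (pi / 2 * \<bar>Im (\<i> * s)\<bar>) / (1 + (norm (\<i> * s))\<^sup>2))"
    proof -
      have "norm (exp (- complex_of_real (pi / 2) * s)) = exp (- (pi / 2 * Re s))" by simp
      then show ?thesis
        unfolding P_def norm_mult[of "exp _"] using mult_left_mono[OF K(2)[of "\<i> * s"]] by simp
    qed
    also have "\<dots> = K * (1 / (1 + (norm s)\<^sup>2))"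
      using that by (simp add: norm_mult exp_minus)
    also have "\<dots> \<le> K * (2 * (1 + norm s) powr (- 2))"
      using K by (intro mult_left_mono inverse_square_le_powr) auto
    also have "\<dots> \<le> K * (2 * (1 + norm s) powr (- (3/2)))"
      using K by (intro mult_left_mono powr_mono) auto
    finally show ?thesis by simp
  qed
  note Z = half_plane_integral_zero[OF holP _ _ bd, of 0, simplified]
  have "(\<integral>t. Re (P (Complex 0 (- t))) \<partial>lborel) = 0"
  proof -
    have "(\<integral>t. Re (P (Complex 0 t)) \<partial>lborel) = 0"
      using Z integral_Re[of lborel "\<lambda>t. P (Complex 0 t)"] by simp
    then show ?thesis
      using lborel_integral_real_affine[of "-1" "\<lambda>t. Re (P (Complex 0 t))" 0] by simp
  qed
  moreover have "Re (P (Complex 0 (- t))) = Re (test_fun 0 (of_real t))" if "t\<^sup>2 \<noteq> 1" for t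
  proof -
    have t: "complex_of_real t ^ 2 \<noteq> 1"
      using that by (metis of_real_eq_1_iff of_real_power)
    have e: "\<i> * Complex 0 (- t) = of_real t" by (simp add: complex_eq_iff)
    define c where "c = cos (pi / 2 * t)"
    have cc: "cos (of_real (pi / 2) * complex_of_real t) = of_real c"
      unfolding c_def by (simp flip: cos_of_real)
    have ck: "cos_kernel (of_real t) = of_real (c / (1 - t\<^sup>2))"
      unfolding cos_kernel_eq[OF t] cc by simp
    have x: "- of_real (pi / 2) * Complex 0 (- t) = \<i> * of_real (pi / 2 * t)"
      by (simp add: complex_eq_iff)
    have "P (Complex 0 (- t)) = cis (pi / 2 * t) * of_real (c / (1 - t\<^sup>2))"
      unfolding P_def e ck x by (simp only: cis_conv_exp)
    then have r1: "Re (P (Complex 0 (- t))) = c\<^sup>2 / (1 - t\<^sup>2)"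
      by (simp add: c_def power2_eq_square)
    have r2: "Re (test_fun 0 (of_real t)) = (1 - t\<^sup>2) * (c / (1 - t\<^sup>2))\<^sup>2"
    proof -
      have "test_fun 0 (of_real t) = of_real ((1 - t\<^sup>2) * (c / (1 - t\<^sup>2))\<^sup>2)"
        by (simp add: test_fun_def ck)
      then show ?thesis by (simp only: Re_complex_of_real)
    qed
    have "1 - t\<^sup>2 \<noteq> 0" using that by simp
    then show ?thesis unfolding r1 r2 by (simp add: power_divide power2_eq_square[of "1 - t\<^sup>2"])
  qed
  moreover have "{t::real. \<not> t\<^sup>2 \<noteq> 1} \<in> null_sets lborel"
  proof -
    have "{t::real. \<not> t\<^sup>2 \<noteq> 1} = {1, -1}" by (auto simp: power2_eq_1_iff)
    then show ?thesis by (simp add: finite_imp_null_set_lborel)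
  qed
  ultimately have "AE t in lborel. Re (P (Complex 0 (- t))) = Re (test_fun 0 (of_real t))"
    by (intro AE_I'[of "{t::real. \<not> t\<^sup>2 \<noteq> 1}"]) auto
  then have "(\<integral>t. Re (P (Complex 0 (- t))) \<partial>lborel) = (\<integral>t. Re (test_fun 0 (of_real t)) \<partial>lborel)"
  proof (rule integral_cong_AE[rotated 2])
    have "continuous_on UNIV P"
      unfolding P_def by (intro continuous_intros continuous_on_compose2[OF holomorphic_on_imp_continuous_on[OF holomorphic_cos_kernel[of UNIV]]]) auto
    then have "continuous_on UNIV (\<lambda>t. P (Complex 0 (- t)))"
      by (rule continuous_on_compose2) (auto simp: Complex_eq intro!: continuous_intros)
    then show "(\<lambda>t. Re (P (Complex 0 (- t)))) \<in> borel_measurable lborel"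
      by (auto intro!: borel_measurable_continuous_onI continuous_intros)
    show "(\<lambda>t. Re (test_fun 0 (of_real t))) \<in> borel_measurable lborel"
      using borel_measurable_integrable[OF integrable_test_fun_sqrt(2)[of 0]] by measurable
  qed
  then show ?thesis
    using \<open>(\<integral>t. Re (P (Complex 0 (- t))) \<partial>lborel) = 0\<close> by simp
qed

text \<open>The test functions for \<kappa> and for 0 differ by \<kappa> times the square of the
  kernel, which is nonnegative on the real line and equals 1 at the origin.\<close>

lemma integral_test_fun_pos:
  assumes "\<kappa> > 0"
  shows "(\<integral>t. Re (test_fun \<kappa> (of_real t)) \<partial>lborel) > 0"
proof -
  define G where "G = (\<lambda>t::real. (Re (cos_kernel (of_real t)))\<^sup>2)"
  have split: "Re (test_fun \<kappa> (of_real t)) = Re (test_fun 0 (of_real t)) + \<kappa> * G t" for t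
  proof -
    obtain c where c: "cos_kernel (of_real t) = of_real c"
      using cos_kernel_real[of t] by (auto elim: Reals_cases)
    have "test_fun k (of_real t) = of_real ((1 + k - t\<^sup>2) * c\<^sup>2)" for k
      by (simp add: test_fun_def c)
    then have R: "Re (test_fun k (of_real t)) = (1 + k - t\<^sup>2) * c\<^sup>2" for k
      by (simp only: Re_complex_of_real)
    show ?thesis unfolding R[of \<kappa>] R[of 0] by (simp add: G_def c algebra_simps)
  qed
  have i0: "integrable lborel (\<lambda>t. Re (test_fun k (of_real t)))" if "k \<ge> 0" for k
    using integrable_test_fun_sqrt(2)[OF that] by (rule integrable_Re)
  have "integrable lborel (\<lambda>t. Re (test_fun \<kappa> (of_real t)) - Re (test_fun 0 (of_real t)))"
    using i0 assms by (intro Bochner_Integration.integrable_diff) auto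
  then have "integrable lborel (\<lambda>t. \<kappa> * G t)"
    by (simp add: split)
  then have iG: "integrable lborel G" using assms by simp
  have contG: "continuous_on UNIV G"
    unfolding G_def
    by (intro continuous_intros continuous_on_compose2[OF holomorphic_on_imp_continuous_on[OF holomorphic_cos_kernel[of UNIV]]]) auto
  have "(\<integral>t. G t \<partial>lborel) > 0"
  proof -
    have "G 0 = 1" by (simp add: G_def cos_kernel_0)
    moreover have "isCont G 0" using contG by (simp add: continuous_on_eq_continuous_at)
    ultimately obtain d where d: "d > 0" "\<And>t. \<bar>t\<bar> < d \<Longrightarrow> \<bar>G t - 1\<bar> < 1/2"
      unfolding isCont_def LIM_eq by (metis (no_types, opaque_lifting) abs_zero diff_zero diff_self half_gt_zero_iff real_norm_def zero_less_one)
    have "d = (\<integral>t. 1/2 * indicator {- d<..<d} t \<partial>lborel)"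
      using d by simp
    also have "\<dots> \<le> (\<integral>t. G t \<partial>lborel)"
    proof (rule integral_mono[OF _ iG])
      show "1/2 * indicator {- d<..<d} t \<le> G t" for t
      proof (cases "t \<in> {- d<..<d}")
        case True
        then have "\<bar>G t - 1\<bar> < 1/2" by (intro d) auto
        then have "1/2 \<le> G t" unfolding abs_less_iff by linarith
        then show ?thesis using True by simp
      qed (simp add: G_def)
    qed (use d in auto)
    finally show ?thesis using d by simp
  qed
  moreover have "(\<integral>t. Re (test_fun \<kappa> (of_real t)) \<partial>lborel) = 0 + \<kappa> * (\<integral>t. G t \<partial>lborel)"
    unfolding split using i0[of 0] iG integral_test_fun_0 by simp
  ultimately show ?thesis using assms by simp
qed

section \<open>The one-sided explicit formula\<close>

text \<open>The weight of the \<open>n\<close>-th Dirichlet coefficient after integration along the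
  line: a Fourier transform of the test function at ln n. It is left unevaluated, since only its
  modulus is estimated, uniformly in \<delta>.\<close>

definition line_coeff :: "real \<Rightarrow> real \<Rightarrow> real \<Rightarrow> nat \<Rightarrow> complex" where
  "line_coeff \<kappa> \<Lambda> \<delta> n = (\<integral>t. test_fun \<kappa> (of_real (\<Lambda> * t)) / of_nat n powr Complex (1/2 + \<delta>) t \<partial>lborel)"

text \<open>A norm of the test function in which the square root accommodates the bound for Digamma.
  It depends on \<kappa> alone, in particular not on the character or on \<open>q\<close>.\<close>

definition test_weight :: "real \<Rightarrow> real" where
  "test_weight \<kappa> = (\<integral>t. sqrt (1 + \<bar>t\<bar>) * norm (test_fun \<kappa> (of_real t)) \<partial>lborel)"

lemma integrable_scaled:
  fixes f :: "real \<Rightarrow> 'a :: {banach, second_countable_topology}"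
  assumes "integrable lborel f" "\<Lambda> > 0"
  shows "integrable lborel (\<lambda>t. f (\<Lambda> * t))" and "(\<integral>t. f (\<Lambda> * t) \<partial>lborel) = (1 / \<Lambda>) *\<^sub>R (\<integral>t. f t \<partial>lborel)"
  using lborel_integrable_real_affine[OF assms(1), of \<Lambda> 0] lborel_integral_real_affine[of \<Lambda> f 0] assms(2)
  by auto

lemma integrable_test_weight:
  assumes "\<kappa> \<ge> 0"
  shows "integrable lborel (\<lambda>t. sqrt (1 + \<bar>t\<bar>) * norm (test_fun \<kappa> (of_real t)))"
  using integrable_norm[OF integrable_test_fun_sqrt(1)[OF assms]] by (simp add: norm_mult)

lemma continuous_line: "continuous_on UNIV (\<lambda>t. Complex a t)"
  unfolding Complex_eq by (intro continuous_intros)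

lemma continuous_test_fun_line: "continuous_on UNIV (\<lambda>t. test_fun \<kappa> (of_real (\<Lambda> * t)))"
  by (rule continuous_on_compose2[OF holomorphic_on_imp_continuous_on[OF holomorphic_test_fun[of \<kappa> UNIV]]])
    (auto intro!: continuous_intros)

lemma integrable_test_fun_line:
  assumes "\<kappa> \<ge> 0" "\<Lambda> > 0"
  shows "integrable lborel (\<lambda>t. test_fun \<kappa> (of_real (\<Lambda> * t)))"
  by (rule integrable_scaled(1)[OF integrable_test_fun_sqrt(2)]) fact+

lemma integral_norm_test_fun_line_le:
  assumes "\<kappa> \<ge> 0" "\<Lambda> > 0"
  shows "(\<integral>t. norm (test_fun \<kappa> (of_real (\<Lambda> * t))) \<partial>lborel) \<le> test_weight \<kappa> / \<Lambda>"
proof -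
  have "(\<integral>t. norm (test_fun \<kappa> (of_real (\<Lambda> * t))) \<partial>lborel) = (1 / \<Lambda>) * (\<integral>t. norm (test_fun \<kappa> (of_real t)) \<partial>lborel)"
    using integrable_scaled(2)[OF integrable_norm[OF integrable_test_fun_sqrt(2)[OF assms(1)]] assms(2)] by simp
  also have "(\<integral>t. norm (test_fun \<kappa> (of_real t)) \<partial>lborel) \<le> test_weight \<kappa>"
    unfolding test_weight_def
  proof (rule integral_mono[OF integrable_norm[OF integrable_test_fun_sqrt(2)[OF assms(1)]] integrable_test_weight[OF assms(1)]])
    show "norm (test_fun \<kappa> (of_real t)) \<le> sqrt (1 + \<bar>t\<bar>) * norm (test_fun \<kappa> (of_real t))" for t
      using mult_right_mono[of 1 "sqrt (1 + \<bar>t\<bar>)" "norm (test_fun \<kappa> (of_real t))"] by simp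
  qed
  finally show ?thesis using assms by (simp add: field_simps)
qed

lemma integrable_line_coeff:
  assumes "\<kappa> \<ge> 0" "\<Lambda> > 0" "n \<ge> 1" "\<delta> > 0"
  shows "integrable lborel (\<lambda>t. test_fun \<kappa> (of_real (\<Lambda> * t)) / of_nat n powr Complex (1/2 + \<delta>) t)"
    and "norm (line_coeff \<kappa> \<Lambda> \<delta> n) \<le> real n powr (- (1/2)) * (test_weight \<kappa> / \<Lambda>)"
proof -
  let ?f = "\<lambda>t. test_fun \<kappa> (of_real (\<Lambda> * t)) / of_nat n powr Complex (1/2 + \<delta>) t"
  have nf: "norm (?f t) = norm (test_fun \<kappa> (of_real (\<Lambda> * t))) * real n powr (- (1/2 + \<delta>))" for t
    using assms by (simp add: norm_divide norm_powr_real_powr powr_minus_divide del: minus_add_distrib)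
  have le: "norm (?f t) \<le> real n powr (- (1/2)) * norm (test_fun \<kappa> (of_real (\<Lambda> * t)))" for t
    unfolding nf using assms by (subst mult.commute) (intro mult_right_mono powr_mono, auto)
  have cont: "continuous_on UNIV ?f"
    using assms by (intro continuous_on_divide continuous_test_fun_line continuous_on_powr_complex continuous_on_const continuous_line) auto
  have int: "integrable lborel (\<lambda>t. real n powr (- (1/2)) * norm (test_fun \<kappa> (of_real (\<Lambda> * t))))"
    using integrable_test_fun_line[OF assms(1,2)] by (intro integrable_mult_right integrable_norm)
  show "integrable lborel ?f"
  proof (rule Bochner_Integration.integrable_bound[OF int])
    show "?f \<in> borel_measurable lborel"
      using borel_measurable_continuous_onI[OF cont] by simp
    show "AE t in lborel. norm (?f t) \<le> norm (real n powr (- (1/2)) * norm (test_fun \<kappa> (of_real (\<Lambda> * t))))"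
      using le by (auto intro!: AE_I2 order_trans[OF le])
  qed
  then have "norm (line_coeff \<kappa> \<Lambda> \<delta> n) \<le> (\<integral>t. real n powr (- (1/2)) * norm (test_fun \<kappa> (of_real (\<Lambda> * t))) \<partial>lborel)"
    unfolding line_coeff_def by (rule Bochner_Integration.integral_norm_bound_integral[OF _ int le])
  also have "\<dots> = real n powr (- (1/2)) * (\<integral>t. norm (test_fun \<kappa> (of_real (\<Lambda> * t))) \<partial>lborel)"
    by simp
  also have "\<dots> \<le> real n powr (- (1/2)) * (test_weight \<kappa> / \<Lambda>)"
    using integral_norm_test_fun_line_le[OF assms(1,2)] by (intro mult_left_mono) auto
  finally show "norm (line_coeff \<kappa> \<Lambda> \<delta> n) \<le> real n powr (- (1/2)) * (test_weight \<kappa> / \<Lambda>)" .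
qed

context
  fixes q :: nat and \<psi> :: "nat \<Rightarrow> complex"
  assumes q: "prime q" and \<psi>: "\<psi> \<in> nontrivial_characters q"
    and nz: "\<And>s. Re s > 1/2 \<Longrightarrow> dseries \<psi> s \<noteq> 0"
begin

text \<open>As L'/L has coefficients - \<psi>(n) \<Lambda>(n), adding the sum removes its first
  \<open>N\<close> terms. The rest decays to the right like (N + 1)^(- Re s).\<close>

definition truncated_log_deriv :: "nat \<Rightarrow> complex \<Rightarrow> complex" where
  "truncated_log_deriv N s = deriv (dseries \<psi>) s / dseries \<psi> s + (\<Sum>n=1..N. \<psi> n * mangoldt n / of_nat n powr s)"

lemma norm_truncated_log_deriv_le:
  assumes s: "Re s \<ge> 3"
  shows "norm (truncated_log_deriv N s) \<le>
    (\<Sum>n. norm (\<psi> (Suc n) * mangoldt (Suc n)) * real (Suc n) powr (- 3)) * real (Suc N) powr (3 - Re s)"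
proof -
  define c where "c = (\<lambda>n. \<psi> n * mangoldt n :: complex)"
  have sub: "subpolynomial c"
    unfolding c_def by (rule subpolynomial_mangoldt[OF char_multiplicative[OF q \<psi> nz] norm_char_le_1[OF q \<psi>]])
  have Rs: "Re s > 1" using s by simp
  have sm: "summable (\<lambda>n. c (Suc n) / of_nat (Suc n) powr s)"
    using subpolynomial_sums(2)[OF sub Rs] sums_summable by blast
  have sm3: "summable (\<lambda>n. norm (c (Suc n)) * real (Suc n) powr (- 3))"
    by (rule subpolynomial_summable[OF sub]) simp
  have "dseries c s = (\<Sum>n. c (Suc (n + N)) / of_nat (Suc (n + N)) powr s) + (\<Sum>n<N. c (Suc n) / of_nat (Suc n) powr s)"
    unfolding dseries_def by (rule suminf_split_initial_segment[OF sm])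
  moreover have "(\<Sum>n=1..N. c n / of_nat n powr s) = (\<Sum>n<N. c (Suc n) / of_nat (Suc n) powr s)"
    by (simp add: sum.atLeast1_atMost_eq)
  moreover have "deriv (dseries \<psi>) s / dseries \<psi> s = - dseries c s"
    unfolding c_def by (rule log_deriv_eq_mangoldt[OF q \<psi> nz Rs])
  ultimately have eq: "truncated_log_deriv N s = - (\<Sum>n. c (Suc (n + N)) / of_nat (Suc (n + N)) powr s)"
    unfolding truncated_log_deriv_def c_def by (simp only:) simp
  have t: "norm (c (Suc (n + N)) / of_nat (Suc (n + N)) powr s)
      \<le> norm (c (Suc (n + N))) * real (Suc (n + N)) powr (- 3) * real (Suc N) powr (3 - Re s)" for n
  proof -
    have "real (Suc (n + N)) powr (- Re s) = real (Suc (n + N)) powr (- 3) * real (Suc (n + N)) powr (3 - Re s)"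
      by (simp flip: powr_add)
    also have "\<dots> \<le> real (Suc (n + N)) powr (- 3) * real (Suc N) powr (3 - Re s)"
      using s by (intro mult_left_mono powr_mono2') auto
    finally show ?thesis
      unfolding norm_dseries_term mult.assoc by (intro mult_left_mono) auto
  qed
  have sm3N: "summable (\<lambda>n. norm (c (Suc (n + N))) * real (Suc (n + N)) powr (- 3))"
    using summable_ignore_initial_segment[OF sm3, of N] by simp
  have "norm (truncated_log_deriv N s) \<le> (\<Sum>n. norm (c (Suc (n + N))) * real (Suc (n + N)) powr (- 3) * real (Suc N) powr (3 - Re s))"
    unfolding eq norm_minus_cancel by (rule norm_suminf_le[OF t summable_mult2[OF sm3N]])
  also have "\<dots> = (\<Sum>n. norm (c (Suc (n + N))) * real (Suc (n + N)) powr (- 3)) * real (Suc N) powr (3 - Re s)"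
    by (rule suminf_mult2[OF sm3N, symmetric])
  also have "(\<Sum>n. norm (c (Suc (n + N))) * real (Suc (n + N)) powr (- 3)) \<le> (\<Sum>n. norm (c (Suc n)) * real (Suc n) powr (- 3))"
    using suminf_split_initial_segment[OF sm3, of N] by (simp add: sum_nonneg)
  finally show ?thesis
    unfolding c_def by (simp add: mult_right_mono)
qed

text \<open>To the right of the line the test function grows like exp(\<pi> \<Lambda> (Re s - a)),
  and \<open>N\<close> is large enough for the decay of the truncated function to compensate this.
  The product is holomorphic there, so the line can be moved off to infinity.\<close>

lemma integral_truncated_log_deriv:
  assumes \<kappa>: "\<kappa> \<ge> 0" and \<Lambda>: "\<Lambda> \<ge> 1" and N: "exp (pi * \<Lambda>) \<le> real (Suc N)" and \<delta>: "0 < \<delta>" "\<delta> < 1/2"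
  shows "integrable lborel (\<lambda>t. truncated_log_deriv N (Complex (1/2 + \<delta>) t) * test_fun \<kappa> (of_real (\<Lambda> * t)))"
    and "(\<integral>t. truncated_log_deriv N (Complex (1/2 + \<delta>) t) * test_fun \<kappa> (of_real (\<Lambda> * t)) \<partial>lborel) = 0"
proof -
  define a where "a = 1/2 + \<delta>"
  \<comment> \<open>Rotates and scales so that a + i t goes to \<Lambda> t; the half-plane to the
    right of the line goes to the lower half-plane.\<close>
  define w where "w = (\<lambda>s. of_real \<Lambda> * (- \<i> * (s - of_real a)))"
  define P where "P = (\<lambda>s. truncated_log_deriv N s * test_fun \<kappa> (w s))"
  have a: "1/2 < a" "a < 1" using \<delta> by (auto simp: a_def)
  obtain Ct where Ct: "Ct > 0" "\<And>z. norm (test_fun \<kappa> z) \<le> Ct * exp (pi * \<bar>Im z\<bar>) / (1 + (norm z)\<^sup>2)"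
    using test_fun_bound[OF \<kappa>] by blast
  obtain C1 where C1: "C1 > 0"
    "\<And>s. Re s \<ge> 1/2 + \<delta> \<Longrightarrow> norm (deriv (dseries \<psi>) s / dseries \<psi> s) \<le> C1 * sqrt (1 + norm s)"
    using log_deriv_growth[OF q \<psi> nz \<delta>] by blast
  define C3 where "C3 = (\<Sum>n. norm (\<psi> (Suc n) * mangoldt (Suc n)) * real (Suc n) powr (- 3))"
  have C3: "C3 \<ge> 0"
    unfolding C3_def
    by (intro suminf_nonneg subpolynomial_summable subpolynomial_mangoldt[OF char_multiplicative[OF q \<psi> nz] norm_char_le_1[OF q \<psi>]]) auto
  define SN where "SN = (\<Sum>n=1..N. norm (\<psi> n * mangoldt n))"
  have SN: "SN \<ge> 0" by (simp add: SN_def sum_nonneg)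
  define E where "E = exp (3 * pi * \<Lambda>)"
  define T where "T = C3 + C1 + SN"
  have T: "T \<ge> 0" using C3 C1 SN by (simp add: T_def)
  have holP: "P holomorphic_on {s. Re s > 1/2}"
  proof -
    have "dseries \<psi> holomorphic_on {s. Re s > 1/2}"
      by (rule holomorphic_on_subset[OF holomorphic_dseries[OF norm_sum_char_le[OF q \<psi>]]]) auto
    then have "truncated_log_deriv N holomorphic_on {s. Re s > 1/2}"
      unfolding truncated_log_deriv_def[abs_def] using nz
      by (intro holomorphic_intros holomorphic_deriv[OF _ open_halfspace_Re_gt]) auto
    moreover have "(\<lambda>s. test_fun \<kappa> (w s)) holomorphic_on {s. Re s > 1/2}"
      by (rule holomorphic_on_compose_gen[OF _ holomorphic_test_fun[of \<kappa> UNIV], unfolded o_def])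
        (auto simp: w_def intro!: holomorphic_intros)
    ultimately show ?thesis unfolding P_def by (rule holomorphic_on_mult)
  qed
  have bd: "norm (P s) \<le> (8 * Ct * E * T) * (1 + norm s) powr (- (3/2))" if s: "Re s \<ge> a" for s
  proof -
    define x where "x = 1 + norm s"
    have x: "x \<ge> 1" by (simp add: x_def)
    have imw: "\<bar>Im (w s)\<bar> = \<Lambda> * (Re s - a)"
      using s \<Lambda> by (simp add: w_def abs_mult)
    have nw: "norm (w s) \<ge> norm (s - of_real a)"
      using \<Lambda> mult_right_mono[of 1 \<Lambda> "norm (s - of_real a)"] by (simp add: w_def norm_mult)
    have "x \<le> 2 * (1 + norm (w s))"
      using norm_triangle_ineq[of "s - of_real a" "of_real a"] nw a by (simp add: x_def) (use norm_ge_zero[of "w s"] in linarith)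
    then have "x\<^sup>2 \<le> (2 * (1 + norm (w s)))\<^sup>2" using x by (intro power_mono) auto
    also have "\<dots> \<le> 8 * (1 + (norm (w s))\<^sup>2)"
      using zero_le_power2[of "norm (w s) - 1"] by (simp add: power2_eq_square algebra_simps)
    finally have x2: "x\<^sup>2 \<le> 8 * (1 + (norm (w s))\<^sup>2)" .
    have "norm (test_fun \<kappa> (w s)) \<le> Ct * exp (pi * (\<Lambda> * (Re s - a))) / (1 + (norm (w s))\<^sup>2)"
      using Ct(2)[of "w s"] unfolding imw .
    also have "\<dots> \<le> Ct * exp (pi * (\<Lambda> * (Re s - a))) / (x\<^sup>2 / 8)"
      using x2 x Ct by (intro divide_left_mono mult_pos_pos add_pos_nonneg) auto
    finally have tf: "norm (test_fun \<kappa> (w s)) \<le> 8 * Ct / x\<^sup>2 * exp (pi * \<Lambda> * (Re s - a))"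
      by (simp add: mult_ac)
    \<comment> \<open>Beyond Re s = 3 the decay and the growth cancel up to a constant. In the strip
      up to 3 the exponential is bounded by \<open>E\<close>, and the growth of L'/L is of square
      root order.\<close>
    have M: "norm (truncated_log_deriv N s) * exp (pi * \<Lambda> * (Re s - a)) \<le> E * (T * sqrt x)"
    proof (cases "Re s \<ge> 3")
      case True
      have "norm (truncated_log_deriv N s) \<le> C3 * real (Suc N) powr (3 - Re s)"
        unfolding C3_def by (rule norm_truncated_log_deriv_le[OF True])
      also have "\<dots> \<le> C3 * exp (pi * \<Lambda>) powr (3 - Re s)"
        using True C3 N by (intro mult_left_mono powr_mono2') auto
      also have "exp (pi * \<Lambda>) powr (3 - Re s) = exp (pi * \<Lambda> * (3 - Re s))"
        by (simp add: powr_def mult.commute)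
      finally have "norm (truncated_log_deriv N s) * exp (pi * \<Lambda> * (Re s - a)) \<le> C3 * exp (pi * \<Lambda> * (3 - Re s)) * exp (pi * \<Lambda> * (Re s - a))"
        by (rule mult_right_mono) simp
      also have "\<dots> = C3 * exp (pi * \<Lambda> * (3 - a))"
        by (simp add: algebra_simps flip: exp_add)
      also have "\<dots> \<le> C3 * E"
        unfolding E_def using C3 \<Lambda> a by (intro mult_left_mono) (auto simp: algebra_simps)
      also have "\<dots> \<le> (T * sqrt x) * E"
      proof (rule mult_right_mono)
        have "C3 * 1 \<le> T * sqrt x"
          using C3 C1 SN x T by (intro mult_mono) (auto simp: T_def)
        then show "C3 \<le> T * sqrt x" by simp
      qed (simp add: E_def)
      finally show ?thesis by (simp add: mult.commute)
    next
      case False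
      have "norm (\<Sum>n=1..N. \<psi> n * mangoldt n / of_nat n powr s) \<le> SN"
        unfolding SN_def
      proof (rule sum_norm_le)
        fix n assume n: "n \<in> {1..N}"
        have "real n powr Re s \<ge> 1" using n s a by (intro ge_one_powr_ge_zero) auto
        then show "norm (\<psi> n * mangoldt n / of_nat n powr s) \<le> norm (\<psi> n * mangoldt n)"
          using n by (simp add: norm_divide norm_powr_real_powr divide_le_eq mult_le_cancel_left1)
      qed
      moreover have "norm (deriv (dseries \<psi>) s / dseries \<psi> s) \<le> C1 * sqrt x"
        unfolding x_def using s by (intro C1) (simp add: a_def)
      ultimately have "norm (truncated_log_deriv N s) \<le> C1 * sqrt x + SN"
        unfolding truncated_log_deriv_def by (rule norm_triangle_mono[rotated])
      also have "\<dots> \<le> C1 * sqrt x + SN * sqrt x + C3 * sqrt x"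
      proof -
        have "SN * 1 \<le> SN * sqrt x" using SN x by (intro mult_left_mono) auto
        moreover have "0 \<le> C3 * sqrt x" using C3 x by (intro mult_nonneg_nonneg) auto
        ultimately show ?thesis by linarith
      qed
      also have "\<dots> = T * sqrt x" by (simp add: T_def algebra_simps)
      finally have "norm (truncated_log_deriv N s) \<le> T * sqrt x" .
      moreover have "exp (pi * \<Lambda> * (Re s - a)) \<le> E"
        unfolding E_def using False \<Lambda> a by (simp add: mult.commute mult_left_mono)
      ultimately have "norm (truncated_log_deriv N s) * exp (pi * \<Lambda> * (Re s - a)) \<le> (T * sqrt x) * E"
        using T x by (intro mult_mono) auto
      then show ?thesis by (simp add: mult.commute)
    qed
    have "norm (P s) \<le> norm (truncated_log_deriv N s) * (8 * Ct / x\<^sup>2 * exp (pi * \<Lambda> * (Re s - a)))"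
      unfolding P_def norm_mult using tf by (intro mult_left_mono) auto
    also have "\<dots> = 8 * Ct / x\<^sup>2 * (norm (truncated_log_deriv N s) * exp (pi * \<Lambda> * (Re s - a)))"
      by (simp only: mult_ac)
    also have "\<dots> \<le> 8 * Ct / x\<^sup>2 * (E * (T * sqrt x))"
      using M Ct by (intro mult_left_mono) auto
    also have "\<dots> = 8 * Ct * E * T * (sqrt x / x\<^sup>2)" by simp
    also have "sqrt x / x\<^sup>2 = x powr (- (3/2))"
    proof -
      have "x powr (1/2 - 2) = x powr (1/2) / x powr 2" by (rule powr_diff)
      then show ?thesis using x by (simp add: powr_half_sqrt)
    qed
    finally show ?thesis by (simp add: x_def)
  qed
  have Pl: "P (Complex a t) = truncated_log_deriv N (Complex (1/2 + \<delta>) t) * test_fun \<kappa> (of_real (\<Lambda> * t))" for t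
  proof -
    have "w (Complex a t) = of_real (\<Lambda> * t)"
      by (simp add: w_def complex_eq_iff)
    then show ?thesis by (simp add: P_def a_def)
  qed
  have "integrable lborel (\<lambda>t. P (Complex a t))" "(\<integral>t. P (Complex a t) \<partial>lborel) = 0"
    using half_plane_integral_zero[OF holP a(1) _ bd] a by auto
  then show "integrable lborel (\<lambda>t. truncated_log_deriv N (Complex (1/2 + \<delta>) t) * test_fun \<kappa> (of_real (\<Lambda> * t)))"
    and "(\<integral>t. truncated_log_deriv N (Complex (1/2 + \<delta>) t) * test_fun \<kappa> (of_real (\<Lambda> * t)) \<partial>lborel) = 0"
    unfolding Pl by auto
qed

lemma integral_log_deriv_test_fun:
  assumes \<kappa>: "\<kappa> \<ge> 0" and \<Lambda>: "\<Lambda> \<ge> 1" and N: "exp (pi * \<Lambda>) \<le> real (Suc N)" and \<delta>: "0 < \<delta>" "\<delta> < 1/2"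
  shows "has_bochner_integral lborel
     (\<lambda>t. deriv (dseries \<psi>) (Complex (1/2 + \<delta>) t) / dseries \<psi> (Complex (1/2 + \<delta>) t) * test_fun \<kappa> (of_real (\<Lambda> * t)))
     (- (\<Sum>n=1..N. \<psi> n * mangoldt n * line_coeff \<kappa> \<Lambda> \<delta> n))"
proof -
  let ?s = "\<lambda>t. Complex (1/2 + \<delta>) t"
  let ?F = "\<lambda>t. test_fun \<kappa> (of_real (\<Lambda> * t))"
  have 1: "has_bochner_integral lborel (\<lambda>t. truncated_log_deriv N (?s t) * ?F t) 0"
    using integral_truncated_log_deriv[OF assms] by (simp add: has_bochner_integral_iff)
  have "has_bochner_integral lborel (\<lambda>t. \<Sum>n=1..N. (\<psi> n * mangoldt n) * (?F t / of_nat n powr ?s t))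
     (\<Sum>n=1..N. (\<psi> n * mangoldt n) * line_coeff \<kappa> \<Lambda> \<delta> n)"
  proof (intro has_bochner_integral_sum has_bochner_integral_mult_right)
    fix n assume "n \<in> {1..N}"
    then show "has_bochner_integral lborel (\<lambda>t. ?F t / of_nat n powr ?s t) (line_coeff \<kappa> \<Lambda> \<delta> n)"
      unfolding has_bochner_integral_iff line_coeff_def
      using integrable_line_coeff(1)[OF \<kappa>, of \<Lambda> n \<delta>] \<Lambda> \<delta> by simp
  qed
  from has_bochner_integral_diff[OF 1 this]
  have "has_bochner_integral lborel
     (\<lambda>t. truncated_log_deriv N (?s t) * ?F t - (\<Sum>n=1..N. (\<psi> n * mangoldt n) * (?F t / of_nat n powr ?s t)))
     (- (\<Sum>n=1..N. \<psi> n * mangoldt n * line_coeff \<kappa> \<Lambda> \<delta> n))"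
    by simp
  moreover have "truncated_log_deriv N (?s t) * ?F t - (\<Sum>n=1..N. (\<psi> n * mangoldt n) * (?F t / of_nat n powr ?s t))
     = deriv (dseries \<psi>) (?s t) / dseries \<psi> (?s t) * ?F t" for t
    by (simp add: truncated_log_deriv_def distrib_right sum_distrib_right)
  ultimately show ?thesis by simp
qed

end

context
  fixes q :: nat and \<psi> :: "nat \<Rightarrow> complex"
  assumes q: "prime q" and \<psi>: "\<psi> \<in> nontrivial_characters q" and even: "\<psi> (q - 1) = 1"
    and nz: "\<And>s. Re s > 1/2 \<Longrightarrow> dseries \<psi> s \<noteq> 0"
begin

text \<open>The integral of Re(\<xi>'/\<xi>) against the test function is bounded above by
  positivity and the gap, and it is computed term by term through \<open>xi_log_deriv\<close>.
  Multiplication by \<Lambda> makes the leading integral independent of \<open>q\<close>. Only the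
  range of \<delta>, hidden in the filter, depends on the particular character.\<close>

lemma character_inequality:
  assumes \<kappa>: "\<kappa> > 0" and \<Lambda>: "\<Lambda> \<ge> 1" and N: "exp (pi * \<Lambda>) \<le> real (Suc N)"
    and D: "D > 0" "\<And>z::complex. Re z \<ge> 1/4 \<Longrightarrow> norm (Digamma z) \<le> D * sqrt (1 + norm z)"
    and gap: "\<And>t. \<bar>t\<bar> \<le> sqrt (1 + \<kappa>) / \<Lambda> \<Longrightarrow> dseries \<psi> (Complex (1/2) t) \<noteq> 0"
  shows "\<forall>\<^sub>F \<delta> in at_right 0. ln (real q / pi) / 2 * (\<integral>t. Re (test_fun \<kappa> (of_real t)) \<partial>lborel)
     \<le> (1 + D) * test_weight \<kappa> + \<Lambda> * Re (\<Sum>n=1..N. \<psi> n * mangoldt n * line_coeff \<kappa> \<Lambda> \<delta> n)"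
proof -
  define b where "b = sqrt (1 + \<kappa>) / \<Lambda>"
  have b: "b \<ge> 0" using \<kappa> \<Lambda> by (simp add: b_def)
  obtain d where d: "d > 0" "\<And>\<delta> t. 0 < \<delta> \<Longrightarrow> \<delta> < d \<Longrightarrow> \<bar>t\<bar> \<le> b \<Longrightarrow> \<bar>Re (xi_log_deriv q \<psi> (Complex (1/2 + \<delta>) t))\<bar> \<le> 1"
    using xi_log_deriv_small[OF q \<psi> even nz b] gap unfolding b_def by blast
  have "\<forall>\<^sub>F \<delta> in at_right 0. 0 < \<delta> \<and> \<delta> < min d (1/4)"
    using d(1) by (intro eventually_conj eventually_at_right_less) (auto intro!: eventually_at_rightI[of 0 "min d (1/4)"])
  then show ?thesis
  proof eventually_elim
    case (elim \<delta>)
    then have \<delta>: "0 < \<delta>" "\<delta> < d" "\<delta> < 1/4" by auto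
    define s where "s = (\<lambda>t. Complex (1/2 + \<delta>) t)"
    define F where "F = (\<lambda>t. test_fun \<kappa> (of_real (\<Lambda> * t)))"
    define A where "A = (\<lambda>t. Re (deriv (dseries \<psi>) (s t) / dseries \<psi> (s t)))"
    define S where "S = (\<Sum>n=1..N. \<psi> n * mangoldt n * line_coeff \<kappa> \<Lambda> \<delta> n)"
    define I where "I = (\<integral>t. Re (test_fun \<kappa> (of_real t)) \<partial>lborel)"
    define l where "l = ln (real q / pi) / 2"
    have \<Lambda>0: "\<Lambda> > 0" using \<Lambda> by simp
    have F_real: "F t = of_real (Re (F t))" for t
      using test_fun_real[of \<kappa> "\<Lambda> * t"] unfolding F_def by (metis of_real_Re)
    then have F_norm: "norm (F t) = \<bar>Re (F t)\<bar>" for t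
      by (metis norm_of_real)
    have hb1: "has_bochner_integral lborel (\<lambda>t. A t * Re (F t)) (- Re S)"
    proof -
      have "has_bochner_integral lborel (\<lambda>t. Re (deriv (dseries \<psi>) (s t) / dseries \<psi> (s t) * F t)) (Re (- S))"
        unfolding s_def F_def S_def using \<delta> \<kappa>
        by (intro has_bochner_integral_Re integral_log_deriv_test_fun[OF q \<psi> nz _ \<Lambda> N]) auto
      moreover have "Re (deriv (dseries \<psi>) (s t) / dseries \<psi> (s t) * F t) = A t * Re (F t)" for t
        unfolding A_def by (subst F_real) (simp only: times_complex.sel Re_complex_of_real Im_complex_of_real mult_zero_right diff_zero)
      ultimately show ?thesis by simp
    qed
    have hb2: "has_bochner_integral lborel (\<lambda>t. l * Re (F t)) (l * (I / \<Lambda>))"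
    proof (rule has_bochner_integral_mult_right)
      have i: "integrable lborel (\<lambda>t. Re (test_fun \<kappa> (of_real t)))"
        using integrable_test_fun_sqrt(2)[of \<kappa>] \<kappa> by (intro integrable_Re) auto
      show "has_bochner_integral lborel (\<lambda>t. Re (F t)) (I / \<Lambda>)"
        unfolding has_bochner_integral_iff F_def I_def using integrable_scaled[OF i \<Lambda>0] by simp
    qed
    have hb3: "has_bochner_integral lborel (\<lambda>t. (1 + D) * (sqrt (1 + \<bar>\<Lambda> * t\<bar>) * norm (F t))) ((1 + D) * (test_weight \<kappa> / \<Lambda>))"
    proof (rule has_bochner_integral_mult_right)
      have i: "integrable lborel (\<lambda>t. sqrt (1 + \<bar>t\<bar>) * norm (test_fun \<kappa> (of_real t)))"
        using integrable_test_weight[of \<kappa>] \<kappa> by simp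
      show "has_bochner_integral lborel (\<lambda>t. sqrt (1 + \<bar>\<Lambda> * t\<bar>) * norm (F t)) (test_weight \<kappa> / \<Lambda>)"
        unfolding has_bochner_integral_iff F_def test_weight_def using integrable_scaled[OF i \<Lambda>0] by simp
    qed
    have pt: "l * Re (F t) + A t * Re (F t) \<le> (1 + D) * (sqrt (1 + \<bar>\<Lambda> * t\<bar>) * norm (F t))" for t
    proof -
      define u where "u = Re (xi_log_deriv q \<psi> (s t))"
      define G where "G = Re (Digamma (s t / 2))"
      have u_eq: "u = l + G / 2 + A t"
        unfolding u_def xi_log_deriv_def l_def G_def A_def by (simp add: Re_divide_of_real[of _ 2, simplified])
      have u0: "u \<ge> 0"
        unfolding u_def s_def using \<delta> by (intro Re_xi_log_deriv_nonneg[OF q \<psi> even nz]) auto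
      \<comment> \<open>Inside the gap \<open>u\<close> is at most 1 in modulus; outside it
        \<open>F\<close> is nonpositive while \<open>u\<close> is nonnegative.\<close>
      have u1: "u * Re (F t) \<le> norm (F t)"
      proof (cases "\<bar>t\<bar> \<le> b")
        case True
        then have "\<bar>u\<bar> \<le> 1" unfolding u_def s_def using \<delta> by (intro d) auto
        then have "\<bar>u * Re (F t)\<bar> \<le> 1 * \<bar>Re (F t)\<bar>"
          unfolding abs_mult by (intro mult_right_mono) auto
        then show ?thesis unfolding F_norm by linarith
      next
        case False
        then have "sqrt (1 + \<kappa>) \<le> \<bar>\<Lambda> * t\<bar>"
          using \<Lambda>0 by (simp add: b_def abs_mult field_simps)
        then have "(sqrt (1 + \<kappa>))\<^sup>2 \<le> \<bar>\<Lambda> * t\<bar>\<^sup>2"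
          using \<kappa> by (intro power_mono) auto
        then have "Re (F t) \<le> 0"
          unfolding F_def using \<kappa> by (intro test_fun_nonpos) simp
        then have "u * Re (F t) \<le> 0" using u0 by (simp add: mult_nonneg_nonpos)
        also have "0 \<le> norm (F t)" by simp
        finally show ?thesis .
      qed
      have w1: "sqrt (1 + \<bar>\<Lambda> * t\<bar>) \<ge> 1" by simp
      have "\<bar>G\<bar> \<le> D * sqrt (1 + norm (s t / 2))"
        unfolding G_def using \<delta> by (intro order_trans[OF abs_Re_le_cmod] D) (simp add: s_def)
      also have "sqrt (1 + norm (s t / 2)) \<le> sqrt (4 * (1 + \<bar>\<Lambda> * t\<bar>))"
      proof (rule real_sqrt_le_mono)
        have "norm (s t) \<le> \<bar>Re (s t)\<bar> + \<bar>Im (s t)\<bar>" by (rule cmod_le)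
        then have "norm (s t) \<le> 1 + \<bar>t\<bar>" using \<delta> by (simp add: s_def)
        moreover have "\<bar>t\<bar> \<le> \<bar>\<Lambda> * t\<bar>"
          using \<Lambda> mult_right_mono[of 1 \<Lambda> "\<bar>t\<bar>"] by (simp add: abs_mult)
        ultimately show "1 + norm (s t / 2) \<le> 4 * (1 + \<bar>\<Lambda> * t\<bar>)"
          by (simp add: norm_divide)
      qed
      also have "\<dots> = 2 * sqrt (1 + \<bar>\<Lambda> * t\<bar>)"
        by (simp only: real_sqrt_mult real_sqrt_four)
      finally have G: "\<bar>G\<bar> \<le> 2 * (D * sqrt (1 + \<bar>\<Lambda> * t\<bar>))"
        using D by (simp add: mult_ac mult_left_mono)
      have "l * Re (F t) + A t * Re (F t) = u * Re (F t) - G / 2 * Re (F t)"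
        by (simp add: u_eq algebra_simps)
      also have "- (G / 2 * Re (F t)) \<le> \<bar>G\<bar> / 2 * norm (F t)"
        unfolding F_norm using abs_ge_minus_self[of "G / 2 * Re (F t)"] by (simp add: abs_mult)
      then have "u * Re (F t) - G / 2 * Re (F t) \<le> norm (F t) + \<bar>G\<bar> / 2 * norm (F t)"
        using u1 by linarith
      also have "\<dots> \<le> sqrt (1 + \<bar>\<Lambda> * t\<bar>) * norm (F t) + D * sqrt (1 + \<bar>\<Lambda> * t\<bar>) * norm (F t)"
      proof (rule add_mono)
        show "norm (F t) \<le> sqrt (1 + \<bar>\<Lambda> * t\<bar>) * norm (F t)"
          using mult_right_mono[OF w1, of "norm (F t)"] by simp
        show "\<bar>G\<bar> / 2 * norm (F t) \<le> D * sqrt (1 + \<bar>\<Lambda> * t\<bar>) * norm (F t)"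
          using G by (intro mult_right_mono) auto
      qed
      finally show ?thesis by (simp add: algebra_simps)
    qed
    have hb12: "has_bochner_integral lborel (\<lambda>t. l * Re (F t) + A t * Re (F t)) (l * (I / \<Lambda>) + - Re S)"
      by (rule has_bochner_integral_add[OF hb2 hb1])
    have "l * (I / \<Lambda>) + - Re S \<le> (1 + D) * (test_weight \<kappa> / \<Lambda>)"
      using integral_mono[of lborel "\<lambda>t. l * Re (F t) + A t * Re (F t)" "\<lambda>t. (1 + D) * (sqrt (1 + \<bar>\<Lambda> * t\<bar>) * norm (F t))"]
        hb12 hb3 pt by (simp add: has_bochner_integral_iff)
    then have "(l * (I / \<Lambda>) + - Re S) * \<Lambda> \<le> ((1 + D) * (test_weight \<kappa> / \<Lambda>)) * \<Lambda>"
      using \<Lambda>0 by (intro mult_right_mono) auto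
    moreover have "(l * (I / \<Lambda>) + - Re S) * \<Lambda> = l * I - \<Lambda> * Re S"
      using \<Lambda>0 by (simp add: algebra_simps)
    moreover have "((1 + D) * (test_weight \<kappa> / \<Lambda>)) * \<Lambda> = (1 + D) * test_weight \<kappa>"
      using \<Lambda>0 by simp
    ultimately have "l * I - \<Lambda> * Re S \<le> (1 + D) * test_weight \<kappa>" by linarith
    then show ?case
      by (simp add: l_def I_def S_def)
  qed
qed

end

section \<open>The average over characters\<close>

lemma sum_inverse_sqrt_le: "(\<Sum>n=1..N. real n powr (- (1/2))) \<le> 2 * sqrt (real N)"
proof (induction N)
  case (Suc N)
  define x where "x = real (Suc N)"
  have x: "x > 0" "real N = x - 1" by (auto simp: x_def)
  have "x powr (- (1/2)) = 1 / sqrt x"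
    using x by (simp add: powr_minus_divide powr_half_sqrt)
  also have "\<dots> \<le> 2 * (sqrt x - sqrt (x - 1))"
  proof -
    have "sqrt x * sqrt (x - 1) \<le> x - 1/2"
    proof -
      have "x * (x - 1) \<le> (x - 1/2)\<^sup>2" by (simp add: power2_eq_square algebra_simps)
      moreover have "0 \<le> x - 1/2" by (simp add: x_def)
      ultimately have "sqrt (x * (x - 1)) \<le> x - 1/2"
        by (intro real_le_lsqrt) auto
      then show ?thesis by (simp add: real_sqrt_mult)
    qed
    moreover have "2 * (sqrt x - sqrt (x - 1)) * sqrt x = 2 * (sqrt x * sqrt x) - 2 * (sqrt x * sqrt (x - 1))"
      by (rule trans[OF mult.assoc]) (simp only: left_diff_distrib right_diff_distrib mult_ac)
    moreover have "sqrt x * sqrt x = x" using x by simp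
    ultimately have "1 \<le> 2 * (sqrt x - sqrt (x - 1)) * sqrt x" by linarith
    moreover have "sqrt x > 0" using x by simp
    ultimately show ?thesis using pos_divide_le_eq by blast
  qed
  finally have step: "real (Suc N) powr (- (1/2)) \<le> 2 * (sqrt (real (Suc N)) - sqrt (real N))"
    unfolding x_def by simp
  have "(\<Sum>n=1..Suc N. real n powr (- (1/2))) = (\<Sum>n=1..N. real n powr (- (1/2))) + real (Suc N) powr (- (1/2))"
    by simp
  also have "\<dots> \<le> 2 * sqrt (real N) + 2 * (sqrt (real (Suc N)) - sqrt (real N))"
    by (rule add_mono[OF Suc step])
  also have "\<dots> = 2 * sqrt (real (Suc N))" by simp
  finally show ?case .
qed simp

text \<open>Leaving out n = 1, the members of the two classes are k q + 1 and k q - 1 with k \<ge>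
  1, hence at least k q / 2. This saves a factor 1/q over the full sum, which offsets the weight
  \<open>q\<close> that these \<open>n\<close> carry in the character sum.\<close>

lemma sum_plus_minus_one_mod_le:
  assumes q: "q \<ge> 3" and N: "N \<ge> 1"
  shows "(\<Sum>n | n \<in> {2..N} \<and> ([n = 1] (mod q) \<or> [n = q - 1] (mod q)). real n powr (- (1/2))) \<le> 8 * sqrt (real N) / real q"
proof -
  define M where "M = (N + 1) div q"
  define A where "A = {n. n \<in> {2..N} \<and> ([n = 1] (mod q) \<or> [n = q - 1] (mod q))}"
  define f where "f = (\<lambda>n. real n powr (- (1/2)))"
  have sub: "A \<subseteq> (\<lambda>k. k * q + 1) ` {1..M} \<union> (\<lambda>k. k * q - 1) ` {1..M}"
  proof
    fix n assume n: "n \<in> A"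
    then have n2: "2 \<le> n" "n \<le> N" by (auto simp: A_def)
    consider "[n = 1] (mod q)" | "[n = q - 1] (mod q)" using n by (auto simp: A_def)
    then show "n \<in> (\<lambda>k. k * q + 1) ` {1..M} \<union> (\<lambda>k. k * q - 1) ` {1..M}"
    proof cases
      case 1
      then have "n mod q = 1" using q by (simp add: cong_def)
      then have eq: "n = n div q * q + 1" using div_mult_mod_eq[of n q] by simp
      then have "n div q \<noteq> 0" using n2 by (intro notI) simp
      moreover have "n div q \<le> M" unfolding M_def using n2 by (intro div_le_mono) simp
      ultimately show ?thesis using eq by (intro UnI1 image_eqI[of _ _ "n div q"]) auto
    next
      case 2
      then have "n mod q = q - 1" using q by (simp add: cong_def)
      then have eq: "n = (n div q + 1) * q - 1" using div_mult_mod_eq[of n q] q by (simp add: algebra_simps)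
      have "(n div q + 1) * q = n + 1" using eq q by (simp add: algebra_simps)
      then have "n div q + 1 = (n + 1) div q" using q by (metis nonzero_mult_div_cancel_right not_numeral_le_zero)
      moreover have "(n + 1) div q \<le> M" unfolding M_def using n2 by (intro div_le_mono) simp
      ultimately show ?thesis using eq by (intro UnI2 image_eqI[of _ _ "n div q + 1"]) auto
    qed
  qed
  have bd: "f n \<le> sqrt (2 / real q) * real k powr (- (1/2))" if "k \<ge> 1" "n \<ge> k * q - 1" for n k
  proof -
    have "k * q \<ge> 3" using that q mult_le_mono[of 1 k 3 q] by simp
    then have "real n \<ge> real k * real q / 2"
      using that by (simp add: field_simps flip: of_nat_mult)
    then have "f n \<le> (real k * real q / 2) powr (- (1/2))"
      unfolding f_def using that q by (intro powr_mono2') auto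
    also have "\<dots> = sqrt (2 / real q) * real k powr (- (1/2))"
      using that q by (simp add: powr_minus_divide powr_half_sqrt real_sqrt_divide real_sqrt_mult)
    finally show ?thesis .
  qed
  have "(\<Sum>n\<in>A. f n) \<le> (\<Sum>n\<in>(\<lambda>k. k * q + 1) ` {1..M} \<union> (\<lambda>k. k * q - 1) ` {1..M}. f n)"
    by (rule sum_mono2) (use sub in \<open>auto simp: f_def\<close>)
  also have "\<dots> \<le> (\<Sum>n\<in>(\<lambda>k. k * q + 1) ` {1..M}. f n) + (\<Sum>n\<in>(\<lambda>k. k * q - 1) ` {1..M}. f n)"
  proof -
    have "0 \<le> sum f ((\<lambda>k. k * q + 1) ` {1..M} \<inter> (\<lambda>k. k * q - 1) ` {1..M})"
      by (intro sum_nonneg) (simp add: f_def)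
    then show ?thesis by (subst sum_Un) auto
  qed
  also have "\<dots> \<le> (\<Sum>k\<in>{1..M}. f (k * q + 1)) + (\<Sum>k\<in>{1..M}. f (k * q - 1))"
    using sum_image_le[of "{1..M}" f "\<lambda>k. k * q + 1"] sum_image_le[of "{1..M}" f "\<lambda>k. k * q - 1"]
    by (intro add_mono) (simp_all add: f_def o_def)
  also have "\<dots> \<le> (\<Sum>k\<in>{1..M}. sqrt (2 / real q) * real k powr (- (1/2))) + (\<Sum>k\<in>{1..M}. sqrt (2 / real q) * real k powr (- (1/2)))"
    by (intro add_mono sum_mono bd) auto
  also have "\<dots> = 2 * sqrt (2 / real q) * (\<Sum>k\<in>{1..M}. real k powr (- (1/2)))"
    by (simp add: sum_distrib_left mult.assoc)
  also have "\<dots> \<le> 2 * sqrt (2 / real q) * (2 * sqrt (real M))"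
    by (intro mult_left_mono sum_inverse_sqrt_le) auto
  also have "\<dots> = 4 * sqrt (2 / real q * real M)"
    by (simp only: real_sqrt_mult)
  also have "\<dots> \<le> 4 * sqrt (4 * real N / (real q)\<^sup>2)"
  proof -
    have "real M \<le> real (N + 1) / real q" unfolding M_def by (rule of_nat_div_le_of_nat)
    also have "\<dots> \<le> 2 * real N / real q" using N by (intro divide_right_mono) auto
    finally have "2 / real q * real M \<le> 2 / real q * (2 * real N / real q)"
      by (intro mult_left_mono) auto
    also have "2 / real q * (2 * real N / real q) = 4 * real N / (real q)\<^sup>2"
      by (simp add: power2_eq_square)
    finally show ?thesis by (intro mult_left_mono real_sqrt_le_mono) auto
  qed
  also have "\<dots> = 8 * sqrt (real N) / real q"
    using q by (simp add: real_sqrt_mult real_sqrt_divide)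
  finally show ?thesis by (simp add: A_def f_def)
qed

text \<open>The von Mangoldt function is bounded by ln N. The resulting size q^(\<sigma>/2) log q,
  for N about q^\<sigma>, is below the main term because \<sigma> < 2. Of the constant 12, the two
  residue classes contribute 8 and the bounded part of the weights 4.\<close>

lemma mangoldt_sum_le:
  assumes q: "q \<ge> 3" and N: "N \<ge> 1"
  shows "(\<Sum>n=1..N. ((if [n = 1] (mod q) \<or> [n = q - 1] (mod q) then real q else 0) + 2) * mangoldt n * real n powr (- (1/2)))
     \<le> 12 * ln (real N) * sqrt (real N)"
proof -
  let ?P = "\<lambda>n. [n = 1] (mod q) \<or> [n = q - 1] (mod q)"
  let ?r = "\<lambda>n. real n powr (- (1/2))"
  have lnN: "ln (real N) \<ge> 0" using N by simp
  have "(\<Sum>n=1..N. ((if ?P n then real q else 0) + 2) * mangoldt n * ?r n)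
      \<le> (\<Sum>n=1..N. (if n \<in> {2..N} \<and> ?P n then real q * ln (real N) * ?r n else 0) + 2 * ln (real N) * ?r n)"
  proof (rule sum_mono)
    fix n assume n: "n \<in> {1..N}"
    have m: "mangoldt n \<le> ln (real N)"
    proof -
      have "mangoldt n \<le> ln (real n)" using n by (intro mangoldt_le) auto
      also have "\<dots> \<le> ln (real N)" using n by simp
      finally show ?thesis .
    qed
    show "((if ?P n then real q else 0) + 2) * mangoldt n * ?r n
      \<le> (if n \<in> {2..N} \<and> ?P n then real q * ln (real N) * ?r n else 0) + 2 * ln (real N) * ?r n"
    proof (cases "n = 1")
      case True
      have "0 \<le> (if n \<in> {2..N} \<and> ?P n then real q * ln (real N) * ?r n else 0) + 2 * ln (real N) * ?r n"
        using lnN by (intro add_nonneg_nonneg) (auto intro!: mult_nonneg_nonneg)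
      \<comment> \<open>At n = 1 the weight is of size \<open>q\<close> and there would be no
        saving; the vanishing of the von Mangoldt function removes this term.\<close>
      moreover have "mangoldt n = (0::real)" unfolding True by (simp add: mangoldt_def)
      ultimately show ?thesis by (simp only: mult_zero_right mult_zero_left)
    next
      case False
      have "((if ?P n then real q else 0) + 2) * mangoldt n * ?r n \<le> ((if ?P n then real q else 0) + 2) * ln (real N) * ?r n"
        using m by (intro mult_right_mono mult_left_mono) auto
      also have "\<dots> = (if n \<in> {2..N} \<and> ?P n then real q * ln (real N) * ?r n else 0) + 2 * ln (real N) * ?r n"
      proof (cases "?P n")
        case True
        moreover have "n \<in> {2..N}" using False n by auto
        ultimately show ?thesis by (simp only: if_True simp_thms distrib_right)
      next
        case False
        then show ?thesis by (simp only: if_False simp_thms add_0_left)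
      qed
      finally show ?thesis .
    qed
  qed
  also have "\<dots> = (\<Sum>n=1..N. (if n \<in> {2..N} \<and> ?P n then real q * ln (real N) * ?r n else 0)) + (\<Sum>n=1..N. 2 * ln (real N) * ?r n)"
    by (rule sum.distrib)
  also have "(\<Sum>n=1..N. (if n \<in> {2..N} \<and> ?P n then real q * ln (real N) * ?r n else 0))
      = (\<Sum>n\<in>{n. n \<in> {2..N} \<and> ?P n}. real q * ln (real N) * ?r n)"
    by (rule sum.mono_neutral_cong_right) auto
  also have "\<dots> = real q * ln (real N) * (\<Sum>n\<in>{n. n \<in> {2..N} \<and> ?P n}. ?r n)"
    by (simp add: sum_distrib_left)
  also have "\<dots> \<le> real q * ln (real N) * (8 * sqrt (real N) / real q)"
    using lnN by (intro mult_left_mono sum_plus_minus_one_mod_le q N) auto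
  also have "\<dots> = 8 * ln (real N) * sqrt (real N)"
    using q by simp
  also have "(\<Sum>n=1..N. 2 * ln (real N) * ?r n) = 2 * ln (real N) * (\<Sum>n=1..N. ?r n)"
    by (simp add: sum_distrib_left)
  also have "\<dots> \<le> 2 * ln (real N) * (2 * sqrt (real N))"
    using lnN by (intro mult_left_mono sum_inverse_sqrt_le) auto
  finally show ?thesis by (simp add: mult_ac)
qed

text \<open>Divided by x ln x, the left side tends to I / 4 and the right side to 0;
  \<open>I / 8\<close> separates them. The factor \<open>(x - 5) / 2\<close> is the lower bound for
  the number of characters.\<close>

lemma eventually_main_term_dominates:
  assumes "\<sigma> < 2" "I > 0"
  shows "\<forall>\<^sub>F x in at_top. (x - 5) / 2 * (ln (x / pi) / 2 * I - C) > D * ln x * x powr (\<sigma> / 2)"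
proof -
  have "((\<lambda>x. D * ln x * x powr (\<sigma> / 2) / (x * ln x)) \<longlongrightarrow> 0) at_top"
  proof -
    have "((\<lambda>x::real. x powr (\<sigma> / 2 - 1)) \<longlongrightarrow> 0) at_top"
      by (rule tendsto_neg_powr[OF _ filterlim_ident]) (use assms in simp)
    then have lim: "((\<lambda>x. D * x powr (\<sigma> / 2 - 1)) \<longlongrightarrow> D * 0) at_top"
      by (rule tendsto_mult_left)
    have eq: "\<forall>\<^sub>F x in at_top. D * x powr (\<sigma> / 2 - 1) = D * ln x * x powr (\<sigma> / 2) / (x * ln x)"
      using eventually_gt_at_top[of 1] by eventually_elim (simp add: powr_diff)
    from Lim_transform_eventually[OF lim eq] show ?thesis by simp
  qed
  moreover have "((\<lambda>x. (x - 5) / 2 * (ln (x / pi) / 2 * I - C) / (x * ln x)) \<longlongrightarrow> I / 4) at_top"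
  proof -
    have "((\<lambda>x::real. (1 - 5 / x) / 2) \<longlongrightarrow> 1 / 2) at_top" "((\<lambda>x::real. ln (x / pi) / ln x) \<longlongrightarrow> 1) at_top"
      "((\<lambda>x::real. 1 / ln x) \<longlongrightarrow> 0) at_top"
      by real_asymp+
    then have lim: "((\<lambda>x. (1 - 5 / x) / 2 * (ln (x / pi) / ln x * (I / 2) - C * (1 / ln x))) \<longlongrightarrow> 1 / 2 * (1 * (I / 2) - C * 0)) at_top"
      by (intro tendsto_mult tendsto_diff tendsto_const)
    have aux: "a / y / 2 * (c / z) = a / 2 * c / (y * z)" for a c y z :: real
      by simp
    have eq: "\<forall>\<^sub>F x in at_top. (1 - 5 / x) / 2 * (ln (x / pi) / ln x * (I / 2) - C * (1 / ln x))
        = (x - 5) / 2 * (ln (x / pi) / 2 * I - C) / (x * ln x)"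
      using eventually_gt_at_top[of 1] 
    proof eventually_elim
      case (elim x)
      have "1 - 5 / x = (x - 5) / x" using elim by (simp add: diff_divide_distrib)
      moreover have "ln (x / pi) / ln x * (I / 2) - C * (1 / ln x) = (ln (x / pi) / 2 * I - C) / ln x"
        by (simp add: diff_divide_distrib)
      ultimately have "(1 - 5 / x) / 2 * (ln (x / pi) / ln x * (I / 2) - C * (1 / ln x))
          = (x - 5) / x / 2 * ((ln (x / pi) / 2 * I - C) / ln x)"
        by (simp only:)
      also have "\<dots> = (x - 5) / 2 * (ln (x / pi) / 2 * I - C) / (x * ln x)" by (rule aux)
      finally show ?case .
    qed
    from Lim_transform_eventually[OF lim eq] show ?thesis by simp
  qed
  ultimately have "\<forall>\<^sub>F x in at_top. D * ln x * x powr (\<sigma> / 2) / (x * ln x) < I / 8 \<and>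
      (x - 5) / 2 * (ln (x / pi) / 2 * I - C) / (x * ln x) > I / 8"
    using assms by (intro eventually_conj order_tendstoD) auto
  with eventually_gt_at_top[of 1] show ?thesis
  proof eventually_elim
    case (elim x)
    then have "D * ln x * x powr (\<sigma> / 2) / (x * ln x) < (x - 5) / 2 * (ln (x / pi) / 2 * I - C) / (x * ln x)"
      by linarith
    moreover have "x * ln x > 0" using elim by simp
    ultimately show ?case unfolding divide_less_cancel by linarith
  qed
qed

section \<open>Low-lying zeros\<close>

text \<open>The hypothesis covers the open strip only; the line Re s = 1 and the half-plane beyond
  it are supplied by the unconditional nonvanishing results.\<close>

lemma dseries_nonzero_of_GRH:
  assumes grh: generalised_riemann_hypothesis and q: "q \<in> odd_primes" and \<psi>: "\<psi> \<in> nontrivial_characters q"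
    and even: "\<psi> (q - 1) = 1" and sq: "(\<lambda>n. \<psi> n ^ 2) \<noteq> trivial_character q" and s: "Re s > 1/2"
  shows "dseries \<psi> s \<noteq> 0"
proof -
  have p: "prime q" using q by (simp add: odd_primes_def)
  consider "Re s > 1" | "Re s = 1" | "Re s < 1" by linarith
  then show ?thesis
  proof cases
    case 1
    have "norm (dseries \<psi> 3) \<ge> 1/2"
      by (rule norm_dseries_ge_half[of \<psi> 3, OF norm_char_le_1[OF p \<psi>] char_Suc_0[OF p \<psi>]]) simp
    then have w: "dseries \<psi> 3 \<noteq> 0" by auto
    have "\<psi> (m * n) = \<psi> m * \<psi> n" for m n
      using \<psi> dirichlet_character_mult by (auto simp: nontrivial_characters_def)
    from dseries_nonzero_Re_gt_1[of \<psi> s 3, OF this norm_char_le_1[OF p \<psi>] 1 _ w] show ?thesis by simp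
  next
    case 2
    then have "s = Complex 1 (Im s)" by (simp add: complex_eq_iff)
    then show ?thesis using dseries_nonzero_Re_eq_1[OF p \<psi> sq] by metis
  next
    case 3
    show ?thesis
    proof
      assume 0: "dseries \<psi> s = 0"
      then have "dirichlet_L \<psi> s = 0"
        using dirichlet_L_continuation(2)[OF p \<psi> even, of s] s by simp
      then have "(s - 1/2) / \<i> \<in> zero_ordinates \<psi>"
        using s 3 by (simp add: zero_ordinates_def nontrivial_zeros_def)
      then have "(s - 1/2) / \<i> \<in> \<real>"
        using grh q \<psi> by (auto simp only: generalised_riemann_hypothesis_def)
      then have "Im ((s - 1/2) / \<i>) = 0" by (simp add: complex_is_Real_iff)
      moreover have "Im ((s - 1/2) / \<i>) = 1/2 - Re s"
        by simp
      ultimately show False using s by simp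
    qed
  qed
qed

text \<open>If no such zero existed, \<open>character_inequality\<close> could be summed over the
  whole even family. Its left side grows like q log q, whereas the summed Dirichlet terms are
  O(q^(\<sigma>/2) log q).\<close>

lemma low_zero_exists:
  assumes grh: generalised_riemann_hypothesis and \<beta>: "\<beta> > 1/4"
  shows "\<exists>Q. \<forall>q\<in>odd_primes. q \<ge> Q \<longrightarrow> (\<exists>\<psi>\<in>nontrivial_characters q. \<psi> (q - 1) = 1 \<and>
     (\<exists>t::real. of_real t \<in> zero_ordinates \<psi> \<and> \<bar>t\<bar> * ln (real q) / (2 * pi) \<le> \<beta>))"
proof -
  \<comment> \<open>As \<beta> > 1/4, this lies strictly between 1 and 2 and 2 \<sigma> \<beta> = 2
    \<beta> + 1/2 exceeds 1. The parameter \<kappa> is then fixed by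
    \<open>sqrt (1 + \<kappa>) = 2 * \<sigma> * \<beta>\<close>, so that the required gap
    \<open>sqrt (1 + \<kappa>) / \<Lambda>\<close> is exactly 2 \<pi> \<beta> / ln q.\<close>
  define \<sigma> where "\<sigma> = 1 + 1 / (4 * \<beta>)"
  define \<kappa> where "\<kappa> = (2 * \<beta> + 1/2)\<^sup>2 - 1"
  define I where "I = (\<integral>t. Re (test_fun \<kappa> (of_real t)) \<partial>lborel)"
  define W where "W = test_weight \<kappa>"
  have \<sigma>: "\<sigma> < 2" "\<sigma> > 1" "2 * \<sigma> * \<beta> = 2 * \<beta> + 1/2"
    using \<beta> by (auto simp: \<sigma>_def field_simps)
  have "1\<^sup>2 < (2 * \<beta> + 1/2)\<^sup>2"
    using \<beta> by (intro power_strict_mono) auto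
  then have \<kappa>: "\<kappa> > 0" by (simp add: \<kappa>_def)
  have sqrt_\<kappa>: "sqrt (1 + \<kappa>) = 2 * \<sigma> * \<beta>"
    using \<beta> \<sigma>(3) by (simp add: \<kappa>_def)
  have I: "I > 0" unfolding I_def by (rule integral_test_fun_pos[OF \<kappa>])
  have W: "W \<ge> 0" unfolding W_def test_weight_def by (intro integral_nonneg_AE) auto
  obtain D where D: "D > 0" "\<And>z::complex. Re z \<ge> 1/4 \<Longrightarrow> norm (Digamma z) \<le> D * sqrt (1 + norm z)"
    by (rule Digamma_bound[of "1/4"]) auto
  define X where "X = (\<lambda>x. ln (x / pi) / 2 * I - (1 + D) * W)"
  have "\<forall>\<^sub>F x in at_top. (x - 5) / 2 * X x > 12 * W * \<sigma> * ln x * x powr (\<sigma> / 2)"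
    unfolding X_def by (rule eventually_main_term_dominates[OF \<sigma>(1) I])
  moreover have "\<forall>\<^sub>F x::real in at_top. ln x \<ge> pi"
    by real_asymp
  ultimately have "\<forall>\<^sub>F x in at_top. (x - 5) / 2 * X x > 12 * W * \<sigma> * ln x * x powr (\<sigma> / 2) \<and> ln x \<ge> pi \<and> x > 5"
    by (intro eventually_conj eventually_gt_at_top)
  then obtain x0 where x0: "\<And>x. x \<ge> x0 \<Longrightarrow> (x - 5) / 2 * X x > 12 * W * \<sigma> * ln x * x powr (\<sigma> / 2) \<and> ln x \<ge> pi \<and> x > 5"
    unfolding eventually_at_top_linorder by blast
  show ?thesis
  proof (intro exI[of _ "nat \<lceil>x0\<rceil>"] ballI impI, rule ccontr)
    fix q assume q: "q \<in> odd_primes" and qQ: "q \<ge> nat \<lceil>x0\<rceil>"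
      and neg: "\<not> (\<exists>\<psi>\<in>nontrivial_characters q. \<psi> (q - 1) = 1 \<and>
         (\<exists>t::real. of_real t \<in> zero_ordinates \<psi> \<and> \<bar>t\<bar> * ln (real q) / (2 * pi) \<le> \<beta>))"
    have p: "prime q" "odd q" using q by (auto simp: odd_primes_def)
    have "real q \<ge> x0" using qQ by linarith
    then have big: "(real q - 5) / 2 * X (real q) > 12 * W * \<sigma> * ln (real q) * real q powr (\<sigma> / 2)"
      and lnq: "ln (real q) \<ge> pi" and q5: "real q > 5"
      using x0 by blast+
    have lnq0: "ln (real q) > 0" using lnq pi_gt_zero by linarith
    define \<Lambda> where "\<Lambda> = \<sigma> * ln (real q) / pi"
    \<comment> \<open>\<Lambda> is chosen so that exp(\<pi> \<Lambda>) = q^\<sigma>; the floor gives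
      both this number below \<open>Suc N\<close> and \<open>N\<close> below it.\<close>
    define N where "N = nat \<lfloor>real q powr \<sigma>\<rfloor>"
    have \<Lambda>: "\<Lambda> \<ge> 1"
    proof -
      have "pi \<le> \<sigma> * ln (real q)" using \<sigma> lnq lnq0 mult_right_mono[of 1 \<sigma> "ln (real q)"] by linarith
      then show ?thesis by (simp add: \<Lambda>_def)
    qed
    have q\<sigma>: "real q powr \<sigma> \<ge> 1" using q5 \<sigma> by (intro ge_one_powr_ge_zero) auto
    have "exp (pi * \<Lambda>) = real q powr \<sigma>"
      using q5 by (simp add: \<Lambda>_def powr_def)
    then have N: "exp (pi * \<Lambda>) \<le> real (Suc N)"
      unfolding N_def by linarith
    have N_le: "real N \<le> real q powr \<sigma>" and N1: "N \<ge> 1"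
      unfolding N_def using q\<sigma> by linarith+
    obtain \<theta> :: "nat \<Rightarrow> nat \<Rightarrow> complex" and J :: "nat set" where J:
      "finite J" "real (card J) \<ge> (real q - 5) / 2"
      "\<And>j. j \<in> J \<Longrightarrow> dirichlet_character q (\<theta> j)"
      "\<And>j. j \<in> J \<Longrightarrow> \<theta> j (q - 1) = 1"
      "\<And>j. j \<in> J \<Longrightarrow> (\<lambda>n. \<theta> j n ^ 2) \<noteq> trivial_character q"
      "\<And>n. norm (\<Sum>j\<in>J. \<theta> j n) \<le> (if [n = 1] (mod q) \<or> [n = q - 1] (mod q) then real q else 0) + 2"
      using even_character_family[OF p] by metis
    have nt: "\<theta> j \<in> nontrivial_characters q" if "j \<in> J" for j
    proof -
      have "\<theta> j \<noteq> trivial_character q"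
      proof
        assume "\<theta> j = trivial_character q"
        then have "(\<lambda>n. \<theta> j n ^ 2) = trivial_character q"
          by (auto simp: trivial_character_def fun_eq_iff)
        then show False using J(5)[OF that] by blast
      qed
      then show ?thesis using J(3)[OF that] by (simp add: nontrivial_characters_def)
    qed
    define S where "S = (\<lambda>\<delta> j. \<Sum>n=1..N. \<theta> j n * mangoldt n * line_coeff \<kappa> \<Lambda> \<delta> n)"
    have "\<forall>\<^sub>F \<delta> in at_right 0. ln (real q / pi) / 2 * I \<le> (1 + D) * W + \<Lambda> * Re (S \<delta> j)" if j: "j \<in> J" for j
      unfolding I_def W_def S_def
    proof (rule character_inequality[OF p(1) nt[OF j] J(4)[OF j] _ \<kappa> \<Lambda> N D])
      show "dseries (\<theta> j) s \<noteq> 0" if "1/2 < Re s" for s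
        by (rule dseries_nonzero_of_GRH[OF grh q nt[OF j] J(4)[OF j] J(5)[OF j] that])
      fix t assume t: "\<bar>t\<bar> \<le> sqrt (1 + \<kappa>) / \<Lambda>"
      show "dseries (\<theta> j) (Complex (1/2) t) \<noteq> 0"
      proof
        assume 0: "dseries (\<theta> j) (Complex (1/2) t) = 0"
        have "1/2 + \<i> * complex_of_real t = Complex (1/2) t" by (simp add: complex_eq_iff)
        then have "complex_of_real t \<in> zero_ordinates (\<theta> j)"
          using 0 dirichlet_L_continuation(2)[OF p(1) nt[OF j] J(4)[OF j], of "Complex (1/2) t"]
          by (simp add: zero_ordinates_def nontrivial_zeros_def)
        moreover have "\<bar>t\<bar> * ln (real q) / (2 * pi) \<le> \<beta>"
        proof -
          have "\<bar>t\<bar> \<le> 2 * \<beta> * pi / ln (real q)"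
            using t \<sigma> lnq0 unfolding sqrt_\<kappa> \<Lambda>_def by (simp add: field_simps)
          then show ?thesis using lnq0 by (simp add: field_simps)
        qed
        ultimately show False using neg nt[OF j] J(4)[OF j] by blast
      qed
    qed
    \<comment> \<open>Finiteness of \<open>J\<close> allows one \<delta> for all characters, so that
      the coefficients \<open>line_coeff\<close> agree and the characters can be summed
      first.\<close>
    then have "\<forall>\<^sub>F \<delta> in at_right 0. \<forall>j\<in>J. ln (real q / pi) / 2 * I \<le> (1 + D) * W + \<Lambda> * Re (S \<delta> j)"
      by (intro eventually_ball_finite J(1)) blast
    then have "\<forall>\<^sub>F \<delta> in at_right 0. (\<forall>j\<in>J. ln (real q / pi) / 2 * I \<le> (1 + D) * W + \<Lambda> * Re (S \<delta> j)) \<and> 0 < \<delta>"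
      by (intro eventually_conj eventually_at_right_less)
    then obtain \<delta> where \<delta>: "\<And>j. j \<in> J \<Longrightarrow> ln (real q / pi) / 2 * I \<le> (1 + D) * W + \<Lambda> * Re (S \<delta> j)" "0 < \<delta>"
      using eventually_happens'[OF trivial_limit_at_right_real] by blast
    have "real (card J) * X (real q) = (\<Sum>j\<in>J. X (real q))" by simp
    also have "\<dots> \<le> (\<Sum>j\<in>J. \<Lambda> * Re (S \<delta> j))"
      by (intro sum_mono) (use \<delta>(1) in \<open>force simp: X_def\<close>)
    also have "\<dots> = \<Lambda> * Re (\<Sum>j\<in>J. S \<delta> j)"
      by (simp add: sum_distrib_left)
    also have "(\<Sum>j\<in>J. S \<delta> j) = (\<Sum>n=1..N. (\<Sum>j\<in>J. \<theta> j n) * (mangoldt n * line_coeff \<kappa> \<Lambda> \<delta> n))"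
      unfolding S_def by (subst sum.swap) (simp add: sum_distrib_right mult.assoc)
    also have "Re \<dots> \<le> norm (\<Sum>n=1..N. (\<Sum>j\<in>J. \<theta> j n) * (mangoldt n * line_coeff \<kappa> \<Lambda> \<delta> n))"
      by (rule complex_Re_le_cmod)
    also have "\<dots> \<le> (\<Sum>n=1..N. ((if [n = 1] (mod q) \<or> [n = q - 1] (mod q) then real q else 0) + 2) * mangoldt n * real n powr (- (1/2)) * (W / \<Lambda>))"
    proof (rule sum_norm_le)
      fix n assume n: "n \<in> {1..N}"
      have "norm (line_coeff \<kappa> \<Lambda> \<delta> n) \<le> real n powr (- (1/2)) * (W / \<Lambda>)"
        unfolding W_def using n \<Lambda> \<kappa> \<delta> by (intro integrable_line_coeff(2)) auto
      then have "norm (\<Sum>j\<in>J. \<theta> j n) * (mangoldt n * norm (line_coeff \<kappa> \<Lambda> \<delta> n))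
         \<le> ((if [n = 1] (mod q) \<or> [n = q - 1] (mod q) then real q else 0) + 2) * (mangoldt n * (real n powr (- (1/2)) * (W / \<Lambda>)))"
        by (intro mult_mono J(6) mult_left_mono mangoldt_nonneg mult_nonneg_nonneg) auto
      then show "norm ((\<Sum>j\<in>J. \<theta> j n) * (mangoldt n * line_coeff \<kappa> \<Lambda> \<delta> n))
        \<le> ((if [n = 1] (mod q) \<or> [n = q - 1] (mod q) then real q else 0) + 2) * mangoldt n * real n powr (- (1/2)) * (W / \<Lambda>)"
        by (simp add: norm_mult mult.assoc)
    qed
    also have "\<dots> = (\<Sum>n=1..N. ((if [n = 1] (mod q) \<or> [n = q - 1] (mod q) then real q else 0) + 2) * mangoldt n * real n powr (- (1/2))) * (W / \<Lambda>)"
      by (rule sum_distrib_right[symmetric])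
    also have "\<dots> \<le> 12 * ln (real N) * sqrt (real N) * (W / \<Lambda>)"
      using q5 N1 W \<Lambda> by (intro mult_right_mono mangoldt_sum_le) auto
    finally have "real (card J) * X (real q) \<le> \<Lambda> * (12 * ln (real N) * sqrt (real N) * (W / \<Lambda>))"
      using \<Lambda> by simp
    also have "\<dots> = 12 * W * (ln (real N) * sqrt (real N))"
      using \<Lambda> by simp
    also have "\<dots> \<le> 12 * W * ((\<sigma> * ln (real q)) * (real q powr (\<sigma> / 2)))"
    proof (intro mult_left_mono mult_mono)
      have "ln (real N) \<le> ln (real q powr \<sigma>)" using N_le N1 by (intro ln_mono) auto
      then show "ln (real N) \<le> \<sigma> * ln (real q)" using q5 by (simp add: ln_powr)
      have "sqrt (real N) \<le> sqrt (real q powr \<sigma>)" using N_le by (rule real_sqrt_le_mono)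
      also have "\<dots> = real q powr (\<sigma> / 2)" by (simp add: powr_half_sqrt[symmetric] powr_powr)
      finally show "sqrt (real N) \<le> real q powr (\<sigma> / 2)" .
    qed (use W \<sigma> lnq0 in auto)
    also have "\<dots> < (real q - 5) / 2 * X (real q)"
      using big by (simp add: mult.assoc)
    also have "\<dots> \<le> real (card J) * X (real q)"
    \<comment> \<open>Passing from \<open>(q - 5) / 2\<close> to the actual number of characters
      needs \<open>X q\<close> to be nonnegative; this follows from \<open>big\<close>, whose right
      side is nonnegative.\<close>
    proof (rule mult_right_mono[OF J(2)])
      have "0 \<le> 12 * W * \<sigma> * ln (real q) * real q powr (\<sigma> / 2)"
        using W \<sigma> lnq0 by simp
      then have "0 < (real q - 5) / 2 * X (real q)" using big by linarith
      then show "0 \<le> X (real q)" using q5 by (simp add: zero_less_mult_iff)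
    qed
    finally show False by simp
  qed
qed

text \<open>\<open>arg_min\<close> has the expected meaning only if the minimum is attained. Under
  GRH the competing zeros lie on a compact segment of the critical line, and a nonconstant entire
  function has finitely many zeros there.\<close>

lemma ordinate_1_le:
  assumes grh: generalised_riemann_hypothesis and q: "q \<in> odd_primes" and \<psi>: "\<psi> \<in> nontrivial_characters q"
    and even: "\<psi> (q - 1) = 1" and \<gamma>: "\<gamma> \<in> zero_ordinates \<psi>" "0 \<le> Re \<gamma>"
  shows "Re (ordinate \<psi> 1) \<le> Re \<gamma>"
proof -
  have p: "prime q" using q by (simp add: odd_primes_def)
  define P where "P = (\<lambda>\<gamma>. \<gamma> \<in> zero_ordinates \<psi> \<and> 0 \<le> Re \<gamma> \<and> count_list (first_ordinates \<psi> 0) \<gamma> < ordinate_multiplicity \<psi> \<gamma>)"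
  note hol = dirichlet_L_continuation(1)[OF p \<psi> even]
  have ord1: "ordinate \<psi> 1 = arg_min Re P"
    by (simp add: ordinate_def P_def)
  have real: "Im g = 0" if "g \<in> zero_ordinates \<psi>" for g
    using grh q \<psi> that by (auto simp: generalised_riemann_hypothesis_def complex_is_Real_iff)
  have nz3: "dirichlet_L \<psi> 3 \<noteq> 0"
  proof -
    have "norm (dseries \<psi> 3) \<ge> 1/2"
      by (rule norm_dseries_ge_half[of \<psi> 3, OF norm_char_le_1[OF p \<psi>] char_Suc_0[OF p \<psi>]]) simp
    then show ?thesis using dirichlet_L_continuation(2)[OF p \<psi> even, of 3] by auto
  qed
  \<comment> \<open>For the first entry the list of exhausted ordinates is empty, so the
    multiplicity condition only says that the order of the zero is positive.\<close>
  have P_iff: "P g \<longleftrightarrow> g \<in> zero_ordinates \<psi> \<and> 0 \<le> Re g" for g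
  proof -
    have "ordinate_multiplicity \<psi> g > 0" if "g \<in> zero_ordinates \<psi>"
    proof -
      have "dirichlet_L \<psi> (1/2 + \<i> * g) = 0"
        using that by (simp add: zero_ordinates_def nontrivial_zeros_def)
      then have "zorder (dirichlet_L \<psi>) (1/2 + \<i> * g) > 0"
        using zorder_exist_zero[OF hol, of "1/2 + \<i> * g"] nz3 by auto
      then show ?thesis by (simp add: ordinate_multiplicity_def)
    qed
    then show ?thesis by (auto simp: P_def)
  qed
  define T where "T = {g. P g \<and> Re g \<le> Re \<gamma>}"
  define K where "K = cbox (Complex (1/2) 0) (Complex (1/2) (Re \<gamma>))"
  have "finite {s \<in> K. dirichlet_L \<psi> s = 0}"
  proof (rule holomorphic_compact_finite_zeros[OF hol])
    show "\<not> dirichlet_L \<psi> constant_on UNIV"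
    proof
      assume "dirichlet_L \<psi> constant_on UNIV"
      then obtain c where "\<And>s. dirichlet_L \<psi> s = c" by (auto simp: constant_on_def)
      moreover have "dirichlet_L \<psi> (1/2 + \<i> * \<gamma>) = 0"
        using \<gamma> by (simp add: zero_ordinates_def nontrivial_zeros_def)
      ultimately show False using nz3 by metis
    qed
  qed (auto simp: K_def)
  moreover have "T \<subseteq> (\<lambda>s. (s - 1/2) / \<i>) ` {s \<in> K. dirichlet_L \<psi> s = 0}"
  proof
    fix g assume g: "g \<in> T"
    then have z: "g \<in> zero_ordinates \<psi>" "0 \<le> Re g" "Re g \<le> Re \<gamma>" by (auto simp: T_def P_iff)
    have "1/2 + \<i> * g \<in> K"
      using z real[OF z(1)] by (simp add: K_def in_cbox_complex_iff)
    moreover have "dirichlet_L \<psi> (1/2 + \<i> * g) = 0"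
      using z by (simp add: zero_ordinates_def nontrivial_zeros_def)
    moreover have "g = ((1/2 + \<i> * g) - 1/2) / \<i>" by simp
    ultimately show "g \<in> (\<lambda>s. (s - 1/2) / \<i>) ` {s \<in> K. dirichlet_L \<psi> s = 0}" by blast
  qed
  ultimately have finT: "finite T" by (rule finite_surj)
  have \<gamma>T: "\<gamma> \<in> T" using \<gamma> by (simp add: T_def P_iff)
  define m where "m = arg_min_on Re T"
  have m: "m \<in> T" "\<And>g. g \<in> T \<Longrightarrow> Re m \<le> Re g"
    using arg_min_if_finite[of T Re] finT \<gamma>T unfolding m_def by (auto simp: not_less)
  have "is_arg_min Re P m"
    unfolding is_arg_min_def
  proof (intro conjI notI)
    show "P m" using m by (simp add: T_def)
    assume "\<exists>y. P y \<and> Re y < Re m"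
    then obtain y where y: "P y" "Re y < Re m" by blast
    then have "y \<in> T" using m(2)[OF \<gamma>T] by (simp add: T_def)
    then show False using m(2) y by force
  qed
  then have "is_arg_min Re P (arg_min Re P)"
    unfolding arg_min_def by (rule someI)
  then have "\<not> Re \<gamma> < Re (arg_min Re P)"
    using \<gamma> by (auto simp: is_arg_min_def P_iff)
  then show ?thesis unfolding ord1 by linarith
qed

lemma zero_ordinates_cnj:
  assumes q: "prime q" and \<psi>: "\<psi> \<in> nontrivial_characters q" and even: "\<psi> (q - 1) = 1"
    and t: "of_real t \<in> zero_ordinates \<psi>"
  shows "of_real (- t) \<in> zero_ordinates (\<lambda>n. cnj (\<psi> n))"
proof -
  have Re: "Re (1/2 + \<i> * of_real u) > 0" for u by simp
  have c: "cnj (1/2 + \<i> * complex_of_real t) = 1/2 + \<i> * of_real (- t)" by (simp add: complex_eq_iff)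
  have "dseries \<psi> (1/2 + \<i> * of_real t) = 0"
    using t dirichlet_L_continuation(2)[OF q \<psi> even Re] by (simp add: zero_ordinates_def nontrivial_zeros_def)
  then have "dseries (\<lambda>n. cnj (\<psi> n)) (1/2 + \<i> * of_real (- t)) = 0"
    using dseries_cnj[OF norm_sum_char_le[OF q \<psi>] Re[of t]] unfolding c by simp
  then have "dirichlet_L (\<lambda>n. cnj (\<psi> n)) (1/2 + \<i> * of_real (- t)) = 0"
    using dirichlet_L_continuation(2)[OF q nontrivial_character_cnj[OF \<psi>] _ Re[of "- t"]] even by simp
  then show ?thesis
    by (simp add: zero_ordinates_def nontrivial_zeros_def)
qed

theorem corollary8p2:
  assumes "generalised_riemann_hypothesis"
  shows "Liminf (inf at_top (principal odd_primes))
           (\<lambda>q. ereal (Min ((\<lambda>\<psi>. Re (scaled_zero q \<psi> 1)) ` nontrivial_characters q)))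
         \<le> ereal (1 / 4)"
proof (rule ccontr)
  let ?m = "\<lambda>q. Min ((\<lambda>\<psi>. Re (scaled_zero q \<psi> 1)) ` nontrivial_characters q)"
  let ?F = "inf at_top (principal odd_primes)"
  assume "\<not> ?thesis"
  then obtain \<beta> where \<beta>: "ereal (1/4) < ereal \<beta>" "ereal \<beta> < Liminf ?F (\<lambda>q. ereal (?m q))"
    using ereal_dense2[of "ereal (1/4)"] by (auto simp: not_le)
  have "\<forall>\<^sub>F q in ?F. ereal \<beta> < ereal (?m q)"
    by (rule less_LiminfD[OF \<beta>(2)])
  then have "\<forall>\<^sub>F q in at_top. q \<in> odd_primes \<longrightarrow> \<beta> < ?m q"
    by (simp add: eventually_inf_principal)
  then obtain Q1 where Q1: "\<And>q. q \<ge> Q1 \<Longrightarrow> q \<in> odd_primes \<Longrightarrow> \<beta> < ?m q"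
    by (auto simp: eventually_at_top_linorder)
  have "\<beta> > 1/4" using \<beta>(1) by simp
  from low_zero_exists[OF assms this] obtain Q2 where Q2: "\<And>q. q \<in> odd_primes \<Longrightarrow> q \<ge> Q2 \<Longrightarrow>
     \<exists>\<psi>\<in>nontrivial_characters q. \<psi> (q - 1) = 1 \<and>
     (\<exists>t::real. of_real t \<in> zero_ordinates \<psi> \<and> \<bar>t\<bar> * ln (real q) / (2 * pi) \<le> \<beta>)"
    by blast
  \<comment> \<open>Infinitude of the primes makes the limit along odd primes nontrivial; over an
    empty tail the lower limit would be infinite.\<close>
  obtain q where q: "prime q" "q > max 2 (max Q1 Q2)" using bigger_prime by blast
  then have qo: "q \<in> odd_primes" using prime_odd_nat by (auto simp: odd_primes_def)
  obtain \<psi> t where \<psi>: "\<psi> \<in> nontrivial_characters q" "\<psi> (q - 1) = 1"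
    and t: "of_real t \<in> zero_ordinates \<psi>" "\<bar>t\<bar> * ln (real q) / (2 * pi) \<le> \<beta>"
    using Q2[OF qo] q by auto
  have "\<exists>\<theta>\<in>nontrivial_characters q. \<theta> (q - 1) = 1 \<and> of_real \<bar>t\<bar> \<in> zero_ordinates \<theta>"
  proof (cases "t \<ge> 0")
    case True
    then show ?thesis using \<psi> t by auto
  next
    case False
    then have "of_real \<bar>t\<bar> \<in> zero_ordinates (\<lambda>n. cnj (\<psi> n))"
      using zero_ordinates_cnj[OF q(1) \<psi> t(1)] by simp
    then show ?thesis
      using nontrivial_character_cnj[OF \<psi>(1)] \<psi>(2) by (intro bexI[of _ "\<lambda>n. cnj (\<psi> n)"]) auto
  qed
  then obtain \<theta> where \<theta>: "\<theta> \<in> nontrivial_characters q" "\<theta> (q - 1) = 1" "of_real \<bar>t\<bar> \<in> zero_ordinates \<theta>"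
    by blast
  have c: "ln (real q) / (2 * pi) \<ge> 0" using q by simp
  have "Re (ordinate \<theta> 1) \<le> \<bar>t\<bar>"
    using ordinate_1_le[OF assms qo \<theta>] by simp
  then have "ln (real q) / (2 * pi) * Re (ordinate \<theta> 1) \<le> ln (real q) / (2 * pi) * \<bar>t\<bar>"
    using c by (rule mult_left_mono)
  also have "\<dots> \<le> \<beta>" using t(2) by (simp add: mult.commute)
  finally have "Re (scaled_zero q \<theta> 1) \<le> \<beta>"
    by (simp add: scaled_zero_def del: of_real_divide of_real_mult)
  moreover have "?m q \<le> Re (scaled_zero q \<theta> 1)"
    using finite_nontrivial_characters[of q] \<theta>(1) q by (intro Min_le) auto
  moreover have "\<beta> < ?m q" using Q1[of q] qo q by simp
  ultimately show False by linarith
qed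

end
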